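(* Let $1\le t\le m\le n$ and let $(\gamma|\lambda)$ be a minimal irreducible representation in $J_t(m,n)$. Then $(\gamma|\lambda)$ is a minimal irreducible representation already in $J_t(m,m+t)$. In particular, if $d(t,m,n)$ denotes the highest degree of a minimal generator of $J_t(m,n)$, then $$d(t,m,n)\le d(t,m,m+t).$$
   Context: $\Bbbk$ is a field of characteristic $0$. For $1\le t\le m\le n$: $V,W$ are $\Bbbk$-vector spaces of dimensions $m,n$; $G=\mathrm{GL}(V)\times\mathrm{GL}(W)$, $E=\bigwedge^tV$, $F=\bigwedge^tW$. $X$ is an $m\times n$ matrix of indeterminates, $\Bbbk[X]=\mathrm{Sym}(V\otimes W^* )$ with the induced $G$-action, $A_t$ is the subalgebra generated by the $t$-minors (which get degree $1$), $S_t=S_t(m,n)=\mathrm{Sym}(E\otimes F^* )$, $\pi:S_t\to A_t$ is the natural graded $G$-equivariant surjection sending basis vectors of $E\otimes F^*$ to the corresponding $t$-minors, and $J_t(m,n)=\ker\pi$. Schur modules $L_\lambda$ are indexed so that $L_{(d)}V=\bigwedge^dV$, $L_{(1^d)}V=\mathrm{Sym}^dV$; $L_\lambda W^*=(L_\lambda W)^*$. A bi-diagram $(\gamma|\lambda)$ is a pair of partitions, and it is a minimal irreducible representation in $J_t(m,n)$ if $J_t(m,n)$ contains a $G$-submodule $Q\cong L_\gamma V\otimes L_\lambda W^*$ (with $\dim V=m$, $\dim W=n$) such that $Q\to J_t/(S_t)_1J_t$ is injective. Minimal generators of $J_t$ are elements with nonzero image in $J_t/(S_t)_1J_t$ (homogeneous,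 when speaking of degrees). *)

theory Defs
  imports
    "HOL-Library.Poly_Mapping"
    "HOL-Library.Extended_Nat"
    "Jordan_Normal_Form.Determinant"
    "Jordan_Normal_Form.DL_Submatrix"
begin

section \<open>Polynomial rings\<close>

text \<open>Monomials are finitely supported exponent vectors; the ring structure is the convolution
  product of \<^theory>\<open>HOL-Library.Poly_Mapping\<close>. A polynomial ring on a set of indeterminates is
  cut out as a carrier set.\<close>

type_synonym ('x, 'k) mpoly = "('x \<Rightarrow>\<^sub>0 nat) \<Rightarrow>\<^sub>0 'k"

definition const :: "'k::field \<Rightarrow> ('x, 'k) mpoly" where
  "const c = Poly_Mapping.single 0 c"

definition var :: "'x \<Rightarrow> ('x, 'k::field) mpoly" where
  "var x = Poly_Mapping.single (Poly_Mapping.single x 1) 1"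

definition scal :: "'k::field \<Rightarrow> ('x, 'k) mpoly \<Rightarrow> ('x, 'k) mpoly" where
  "scal c p = const c * p"

interpretation kpoly: Vector_Spaces.vector_space "scal :: 'k::field \<Rightarrow> ('x, 'k) mpoly \<Rightarrow> _"
  by unfold_locales
    (simp_all add: scal_def const_def algebra_simps single_add mult_single
      flip: mult.assoc)

definition poly_ring :: "'x set \<Rightarrow> ('x, 'k::field) mpoly set" where
  "poly_ring X = {p. \<forall>u\<in>Poly_Mapping.keys p. Poly_Mapping.keys u \<subseteq> X}"

definition mono_degree :: "('x \<Rightarrow>\<^sub>0 nat) \<Rightarrow> nat" where
  "mono_degree u = (\<Sum>x\<in>Poly_Mapping.keys u. Poly_Mapping.lookup u x)"

definition homogeneous :: "nat \<Rightarrow> ('x, 'k::field) mpoly \<Rightarrow> bool" where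
  "homogeneous d p \<longleftrightarrow> (\<forall>u\<in>Poly_Mapping.keys p. mono_degree u = d)"

text \<open>The algebra homomorphism with \<open>var x \<mapsto> \<theta> x\<close>.\<close>

definition subst :: "('x \<Rightarrow> ('y, 'k::field) mpoly) \<Rightarrow> ('x, 'k) mpoly \<Rightarrow> ('y, 'k) mpoly" where
  "subst \<theta> p = (\<Sum>u\<in>Poly_Mapping.keys p.
     scal (Poly_Mapping.lookup p u) (\<Prod>x\<in>Poly_Mapping.keys u. \<theta> x ^ Poly_Mapping.lookup u x))"


section \<open>The relations between the minors of a generic matrix\<close>

text \<open>Coordinates are fixed: \<open>V = k\<^sup>m\<close> with basis \<open>v\<^sub>i\<close> (\<open>i < m\<close>) and \<open>W = k\<^sup>n\<close> with basis
  \<open>w\<^sub>j\<close> (\<open>j < n\<close>) and dual basis \<open>w\<^sub>j\<^sup>*\<close>; the indeterminate \<open>(i, j)\<close> is \<open>v\<^sub>i \<otimes> w\<^sub>j\<^sup>*\<close>.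
  The subsets \<open>I\<close> in \<open>subsets t m\<close> index the basis \<open>v\<^sub>I\<close> of the \<open>t\<close>-th exterior power of \<open>V\<close>.\<close>

definition generic_mat :: "nat \<Rightarrow> nat \<Rightarrow> (nat \<times> nat, 'k::field) mpoly mat" where
  "generic_mat m n = mat m n var"

definition subsets :: "nat \<Rightarrow> nat \<Rightarrow> nat set set" where
  "subsets t m = {I. I \<subseteq> {..<m} \<and> card I = t}"

definition minor :: "'a::comm_ring_1 mat \<Rightarrow> nat set \<Rightarrow> nat set \<Rightarrow> 'a" where
  "minor A I J = det (submatrix A I J)"

definition S_ring :: "nat \<Rightarrow> nat \<Rightarrow> nat \<Rightarrow> (nat set \<times> nat set, 'k::field) mpoly set" where
  "S_ring t m n = poly_ring (subsets t m \<times> subsets t n)"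

definition minor_map ::
  "nat \<Rightarrow> nat \<Rightarrow> (nat set \<times> nat set, 'k::field) mpoly \<Rightarrow> (nat \<times> nat, 'k) mpoly" where
  "minor_map m n = subst (\<lambda>(I, J). minor (generic_mat m n) I J)"

definition J_ideal :: "nat \<Rightarrow> nat \<Rightarrow> nat \<Rightarrow> (nat set \<times> nat set, 'k::field) mpoly set" where
  "J_ideal t m n = {p \<in> S_ring t m n. minor_map m n p = 0}"

text \<open>The subspace \<open>(S\<^sub>t)\<^sub>1 J\<^sub>t\<close>.\<close>

definition S1J :: "nat \<Rightarrow> nat \<Rightarrow> nat \<Rightarrow> (nat set \<times> nat set, 'k::field) mpoly set" where
  "S1J t m n =
     kpoly.span {y * f | y f. y \<in> S_ring t m n \<and> homogeneous 1 y \<and> f \<in> J_ideal t m n}"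


section \<open>The group action\<close>

definition GL :: "nat \<Rightarrow> 'k::field mat monoid" where
  "GL n = units_of (ring_mat TYPE('k) n ())"

text \<open>\<open>A v\<^sub>I = \<Sum>\<^sub>K minor A K I v\<^sub>K\<close> on the exterior power of \<open>V\<close>. On the dual,
  \<open>(B f)(w) = f (B\<^sup>-\<^sup>1 w)\<close>, whence \<open>B w\<^sub>J\<^sup>* = \<Sum>\<^sub>L minor B\<^sup>-\<^sup>1 J L w\<^sub>L\<^sup>*\<close>.\<close>

definition S_act :: "nat \<Rightarrow> nat \<Rightarrow> nat \<Rightarrow> 'k::field mat \<Rightarrow> 'k mat \<Rightarrow>
    (nat set \<times> nat set, 'k) mpoly \<Rightarrow> (nat set \<times> nat set, 'k) mpoly" where
  "S_act t m n A B = subst (\<lambda>(I, J). \<Sum>K\<in>subsets t m. \<Sum>L\<in>subsets t n.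
     scal (minor A K I * minor (inv\<^bsub>GL n\<^esub> B) J L) (var (K, L)))"

definition G_submodule :: "nat \<Rightarrow> nat \<Rightarrow> nat \<Rightarrow> (nat set \<times> nat set, 'k::field) mpoly set \<Rightarrow> bool" where
  "G_submodule t m n Q \<longleftrightarrow> Q \<subseteq> S_ring t m n \<and> kpoly.subspace Q \<and>
     (\<forall>A\<in>carrier (GL m). \<forall>B\<in>carrier (GL n). \<forall>q\<in>Q. S_act t m n A B q \<in> Q)"


section \<open>Schur modules\<close>

definition is_partition :: "nat list \<Rightarrow> bool" where
  "is_partition \<mu> \<longleftrightarrow> sorted_wrt (\<ge>) \<mu> \<and> 0 \<notin> set \<mu>"

text \<open>The Schur module \<open>L\<^sub>\<mu> V\<close> of Akin, Buchsbaum and Weyman is the image of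
  \<open>\<And>\<^sup>\<mu>\<^sup>1 V \<otimes> \<And>\<^sup>\<mu>\<^sup>2 V \<otimes> \<dots> \<rightarrow> Sym\<^sup>\<nu>\<^sup>1 V \<otimes> Sym\<^sup>\<nu>\<^sup>2 V \<otimes> \<dots>\<close> (\<open>\<nu>\<close> the conjugate partition):
  diagonalise each exterior power into a tensor power, then multiply in columns. The target is
  a multihomogeneous component of the polynomial ring on \<open>z\<^sub>i\<^sub>j\<close> (\<open>i < m\<close>, \<open>j < \<mu>\<^sub>1\<close>), where
  \<open>z\<^sub>i\<^sub>j\<close> is \<open>v\<^sub>i\<close> placed in the \<open>j\<close>-th symmetric power. The image of
  \<open>v\<^bsub>I 0\<^esub> \<otimes> v\<^bsub>I 1\<^esub> \<otimes> \<dots>\<close> is the product of the minors of \<open>(z\<^sub>i\<^sub>j)\<close> with rows \<open>I k\<close> and columns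
  \<open>0, \<dots>, \<mu>\<^sub>k - 1\<close>. In particular \<open>[d]\<close> gives the exterior power and \<open>replicate d 1\<close> the
  symmetric power.\<close>

definition schur :: "nat \<Rightarrow> nat list \<Rightarrow> (nat \<times> nat, 'k::field) mpoly set" where
  "schur m \<mu> = kpoly.span
     {\<Prod>k<length \<mu>. minor (generic_mat m (\<mu> ! k)) (I k) {..<\<mu> ! k} | I.
        \<forall>k<length \<mu>. I k \<in> subsets (\<mu> ! k) m}"

definition schur_act :: "nat \<Rightarrow> 'k::field mat \<Rightarrow> (nat \<times> nat, 'k) mpoly \<Rightarrow> (nat \<times> nat, 'k) mpoly" where
  "schur_act m A = subst (\<lambda>(i, j). \<Sum>k<m. scal (A $$ (k, i)) (var (k, j)))"

text \<open>The dual of a subspace \<open>U\<close>: linear functionals on \<open>U\<close>, extended by zero outside \<open>U\<close>.\<close>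

definition dual_space :: "('x, 'k::field) mpoly set \<Rightarrow> (('x, 'k) mpoly \<Rightarrow> 'k) set" where
  "dual_space U = {f. (\<forall>u\<in>U. \<forall>v\<in>U. f (u + v) = f u + f v) \<and>
     (\<forall>c. \<forall>u\<in>U. f (scal c u) = c * f u) \<and> (\<forall>u. u \<notin> U \<longrightarrow> f u = 0)}"

text \<open>\<open>L\<^sub>\<gamma> V \<otimes> (L\<^sub>\<mu> W)\<^sup>*\<close>: the pure tensor \<open>u \<otimes> f\<close> is the function \<open>w \<mapsto> f(w) u\<close>. The induced
  action, determined by \<open>u \<otimes> f \<mapsto> A u \<otimes> B f\<close>, is \<open>\<phi> \<mapsto> A \<circ> \<phi> \<circ> B\<^sup>-\<^sup>1\<close>.\<close>

definition bischur :: "nat \<Rightarrow> nat \<Rightarrow> nat list \<Rightarrow> nat list \<Rightarrow>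
    ((nat \<times> nat, 'k::field) mpoly \<Rightarrow> (nat \<times> nat, 'k) mpoly) set" where
  "bischur m n \<gamma> \<mu> = {\<lambda>w. \<Sum>i<r. scal (f i w) (u i) | (r::nat) u f.
     \<forall>i<r. u i \<in> schur m \<gamma> \<and> f i \<in> dual_space (schur n \<mu>)}"

definition bischur_act :: "nat \<Rightarrow> nat \<Rightarrow> nat list \<Rightarrow> 'k::field mat \<Rightarrow> 'k mat \<Rightarrow>
    ((nat \<times> nat, 'k) mpoly \<Rightarrow> (nat \<times> nat, 'k) mpoly) \<Rightarrow>
    (nat \<times> nat, 'k) mpoly \<Rightarrow> (nat \<times> nat, 'k) mpoly" where
  "bischur_act m n \<mu> A B \<phi> = (\<lambda>w. if w \<in> schur n \<mu>
     then schur_act m A (\<phi> (schur_act n (inv\<^bsub>GL n\<^esub> B) w)) else 0)"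

definition G_iso_bischur :: "nat \<Rightarrow> nat \<Rightarrow> nat \<Rightarrow> nat list \<Rightarrow> nat list \<Rightarrow>
    (nat set \<times> nat set, 'k::field) mpoly set \<Rightarrow> bool" where
  "G_iso_bischur t m n \<gamma> \<mu> Q \<longleftrightarrow> (\<exists>\<Phi>. bij_betw \<Phi> (bischur m n \<gamma> \<mu>) Q \<and>
     (\<forall>\<phi>\<in>bischur m n \<gamma> \<mu>. \<forall>\<psi>\<in>bischur m n \<gamma> \<mu>. \<Phi> (\<lambda>w. \<phi> w + \<psi> w) = \<Phi> \<phi> + \<Phi> \<psi>) \<and>
     (\<forall>c. \<forall>\<phi>\<in>bischur m n \<gamma> \<mu>. \<Phi> (\<lambda>w. scal c (\<phi> w)) = scal c (\<Phi> \<phi>)) \<and>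
     (\<forall>A\<in>carrier (GL m). \<forall>B\<in>carrier (GL n). \<forall>\<phi>\<in>bischur m n \<gamma> \<mu>.
        \<Phi> (bischur_act m n \<mu> A B \<phi>) = S_act t m n A B (\<Phi> \<phi>)))"


section \<open>Minimal irreducible representations and minimal generators\<close>

text \<open>The map \<open>Q \<rightarrow> J\<^sub>t / (S\<^sub>t)\<^sub>1 J\<^sub>t\<close> sends \<open>q\<close> to its coset. Since \<open>L\<^sub>\<gamma> V\<close> vanishes when
  \<open>\<gamma>\<^sub>1 > dim V\<close>, an irreducible representation is explicitly required to be nonzero.\<close>

definition minimal_irrep :: "'k::field_char_0 itself \<Rightarrow> nat \<Rightarrow> nat \<Rightarrow> nat \<Rightarrow>
    nat list \<Rightarrow> nat list \<Rightarrow> bool" where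
  "minimal_irrep _ t m n \<gamma> \<mu> \<longleftrightarrow> is_partition \<gamma> \<and> is_partition \<mu> \<and>
     (\<exists>Q :: (nat set \<times> nat set, 'k) mpoly set.
        G_submodule t m n Q \<and> Q \<subseteq> J_ideal t m n \<and> Q \<noteq> {0} \<and>
        G_iso_bischur t m n \<gamma> \<mu> Q \<and>
        inj_on (\<lambda>q. (+) q ` S1J t m n) Q)"

definition minimal_generator ::
  "nat \<Rightarrow> nat \<Rightarrow> nat \<Rightarrow> nat \<Rightarrow> (nat set \<times> nat set, 'k::field_char_0) mpoly \<Rightarrow> bool" where
  "minimal_generator t m n d f \<longleftrightarrow> homogeneous d f \<and> f \<in> J_ideal t m n \<and> f \<notin> S1J t m n"

text \<open>The supremum is taken in \<^typ>\<open>enat\<close>, where it always exists. As \<open>S\<^sub>t\<close> is Noetherian it is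
  the maximum, unless \<open>J\<^sub>t = 0\<close> has no minimal generators, in which case it is \<open>0\<close>.\<close>

definition max_gen_degree :: "'k::field_char_0 itself \<Rightarrow> nat \<Rightarrow> nat \<Rightarrow> nat \<Rightarrow> enat" where
  "max_gen_degree _ t m n = (SUP d\<in>{d.
     \<exists>f :: (nat set \<times> nat set, 'k) mpoly. minimal_generator t m n d f}. enat d)"

end

theory Submission
  imports Defs "HOL-Library.Fun_Lexorder" "Jordan_Normal_Form.Char_Poly"
begin

text \<open>As a functor of \<open>W\<close>, the degree \<open>d\<close> part of \<open>S\<^sub>t\<close> is polynomial of degree \<open>D = d t\<close>, and so is
  \<open>L\<^sub>\<mu> W\<close> if \<open>|\<mu>| = D\<close>; by density all equivariant maps commute with singular matrices, too.
  On tensors of degree \<open>D\<close> the identity of \<open>k\<^sup>p\<close> is a combination of maps that factor through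
  \<open>k\<^sup>q\<close> and of alternators in \<open>q + 1\<close> letters, since an element of \<open>\<rat>[S\<^sub>D]\<close> killed by all alternators
  in \<open>q + 1\<close> letters and by all symmetrizers of Young subgroups with \<open>q\<close> blocks is zero.

  Let \<open>q = m + t\<close>. On a product \<open>y g\<close> with \<open>y\<close> a variable, which involves only \<open>t\<close> letters, an
  alternator in \<open>q + 1\<close> letters acts through alternators of \<open>g\<close> in at least \<open>m + 1\<close> letters. These map \<open>g\<close>
  into \<open>J\<^sub>t\<close>, because nothing multilinear in the columns of a matrix with \<open>m\<close> rows is alternating in
  \<open>m + 1\<close> of them. So, modulo \<open>(S\<^sub>t)\<^sub>1 J\<^sub>t\<close>, every element of \<open>J\<^sub>t(m, n)\<close> is a combination of images of
  elements of \<open>J\<^sub>t(m, m + t)\<close>. This bounds the degrees of minimal generators and forces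
  \<open>\<mu>\<^sub>1 \<le> m + t\<close>; and for such \<open>\<mu>\<close>, factoring the identity of \<open>L\<^sub>\<mu> k\<^bsup>m + t\<^esup>\<close> through \<open>k\<^sup>n\<close> transports an
  equivariant embedding of \<open>L\<^sub>\<gamma> V \<otimes> (L\<^sub>\<mu> W)\<^sup>*\<close> from \<open>W = k\<^sup>n\<close> to \<open>W = k\<^bsup>m + t\<^esup>\<close>.\<close>

text \<open>Equivariance is given for invertible matrices only, whereas passing between
  \<open>k^n\<close> and \<open>k^(m + t)\<close> takes rectangular ones. Everything is therefore
  phrased through forms of degree D in the entries of a matrix: an identity between D-th tensor
  powers of matrices, checked word by word, may be applied to every such form, be it the action on
  \<open>S_ring\<close> or on a Schur module.

  An alternator is not itself induced by a map of \<open>k^p\<close>. It becomes a combination of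
  matrix actions once D auxiliary letters are introduced, one for each tensor factor, and the part
  that uses every letter once is cut out by inclusion-exclusion.

  Neither irreducibility nor complete reducibility of Schur modules is invoked. Their place is taken
  by positivity of the standard inner product on Q[S_D]; the rational coefficients found there are
  then mapped into the field. The splitting goes from \<open>k^p\<close> through \<open>k^q\<close>
  for arbitrary p and q, so n < m + t and n \<ge> m + t are treated alike, and splittings in both
  directions between \<open>k^n\<close> and \<open>k^(m + t)\<close> occur.\<close>

abbreviation pinv :: "('a \<Rightarrow> 'a) \<Rightarrow> 'a \<Rightarrow> 'a" where "pinv \<equiv> Hilbert_Choice.inv"

section \<open>Symmetrizers and alternators in the group algebra\<close>

text \<open>An injective square matrix has nonzero determinant, hence an inverse. This will invert
  the operator of \<open>young_weight\<close> on Q[S_D], whose injectivity is all that positivity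
  provides.\<close>

lemma solvable_if_trivial_kernel:
  fixes M :: "'a \<Rightarrow> 'a \<Rightarrow> 'k::field"
  assumes "finite X"
    and ker: "\<And>f. \<forall>x\<in>X. (\<Sum>y\<in>X. M x y * f y) = 0 \<Longrightarrow> \<forall>x\<in>X. f x = 0"
  shows "\<exists>f. \<forall>x\<in>X. (\<Sum>y\<in>X. M x y * f y) = g x"
proof -
  define n where "n = card X"
  obtain h where h: "bij_betw h {0..<n} X"
    using ex_bij_betw_nat_finite[OF \<open>finite X\<close>] n_def by blast
  define A where "A = mat n n (\<lambda>(i, j). M (h i) (h j))"
  have A: "A \<in> carrier_mat n n" by (simp add: A_def)
  have mv: "(A *\<^sub>v v) $ i = (\<Sum>j = 0..<n. M (h i) (h j) * v $ j)" if "i < n" "v \<in> carrier_vec n" for i v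
    using that by (simp add: A_def scalar_prod_def)
  have sumX: "(\<Sum>y\<in>X. F y) = (\<Sum>j = 0..<n. F (h j))" for F :: "'a \<Rightarrow> 'k"
    by (rule sum.reindex_bij_betw[OF h, symmetric])
  have hinv: "the_inv_into {0..<n} h (h j) = j" if "j < n" for j
    using h that by (simp add: bij_betw_def the_inv_into_f_f)
  have "det A \<noteq> 0"
  proof
    assume "det A = 0"
    then obtain v where v: "v \<in> carrier_vec n" "v \<noteq> 0\<^sub>v n" "A *\<^sub>v v = 0\<^sub>v n"
      using det_0_iff_vec_prod_zero_field[OF A] by auto
    define f where "f x = v $ (the_inv_into {0..<n} h x)" for x
    have "\<forall>x\<in>X. (\<Sum>y\<in>X. M x y * f y) = 0"
    proof
      fix x assume "x \<in> X"
      then obtain i where i: "i < n" "x = h i" using bij_betw_imp_surj_on[OF h] \<open>x \<in> X\<close> by auto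
      have "(\<Sum>y\<in>X. M x y * f y) = (A *\<^sub>v v) $ i"
        unfolding sumX mv[OF i(1) v(1)] by (simp add: f_def hinv i)
      then show "(\<Sum>y\<in>X. M x y * f y) = 0" using v(3) i by simp
    qed
    from ker[OF this] have z: "\<forall>x\<in>X. f x = 0" .
    have "v = 0\<^sub>v n"
    proof (rule eq_vecI)
      fix i assume i: "i < dim_vec (0\<^sub>v n :: 'k vec)"
      then have "f (h i) = 0" using z h by (auto simp: bij_betw_def)
      then show "v $ i = 0\<^sub>v n $ i" using i by (simp add: f_def hinv)
    qed (use v in auto)
    with v show False by simp
  qed
  from det_non_zero_imp_unit[OF A this, of "()"]
  obtain B where B: "B \<in> carrier_mat n n" "A * B = 1\<^sub>m n"
    by (auto simp: Units_def ring_mat_def)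
  define v where "v = B *\<^sub>v vec n (\<lambda>i. g (h i))"
  have v: "v \<in> carrier_vec n" using B by (simp add: v_def)
  have "A *\<^sub>v v = 1\<^sub>m n *\<^sub>v vec n (\<lambda>i. g (h i))"
    unfolding v_def B(2)[symmetric] using assoc_mult_mat_vec[OF A B(1), of "vec n (\<lambda>i. g (h i))"] by simp
  then have Av: "A *\<^sub>v v = vec n (\<lambda>i. g (h i))" by simp
  define f where "f x = v $ (the_inv_into {0..<n} h x)" for x
  have "(\<Sum>y\<in>X. M x y * f y) = g x" if "x \<in> X" for x
  proof -
    have "x \<in> h ` {0..<n}" using bij_betw_imp_surj_on[OF h] that by simp
    then obtain i where i: "i < n" "x = h i" by auto
    have "(\<Sum>y\<in>X. M x y * f y) = (A *\<^sub>v v) $ i"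
      unfolding sumX mv[OF i(1) v] by (simp add: f_def hinv i)
    then show ?thesis using Av i by simp
  qed
  then show ?thesis by blast
qed

section \<open>Permutations without long descending subsequences\<close>

text \<open>The Young subgroup of the colour classes of \<open>c\<close>. Its elements are composed
  with permutations from the left, so the colours belong to values, not to positions.\<close>

definition young :: "nat \<Rightarrow> (nat \<Rightarrow> nat) \<Rightarrow> (nat \<Rightarrow> nat) set" where
  "young D c = {\<sigma>. \<sigma> permutes {..<D} \<and> (\<forall>s<D. c (\<sigma> s) = c s)}"

definition colourings :: "nat \<Rightarrow> nat \<Rightarrow> (nat \<Rightarrow> nat) set" where
  "colourings D q = {..<D} \<rightarrow>\<^sub>E {..<q}"

definition descending :: "(nat \<Rightarrow> nat) \<Rightarrow> nat set \<Rightarrow> bool" where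
  "descending \<tau> B \<longleftrightarrow> (\<forall>s\<in>B. \<forall>s'\<in>B. s < s' \<longrightarrow> \<tau> s' < \<tau> s)"

definition good_perm :: "nat \<Rightarrow> nat \<Rightarrow> (nat \<Rightarrow> nat) \<Rightarrow> bool" where
  "good_perm q D \<tau> \<longleftrightarrow> (\<forall>B\<subseteq>{..<D}. descending \<tau> B \<longrightarrow> card B \<le> q)"

text \<open>A function on permutations stands for an element of Q[S_D]; the formula is annihilation
  by the alternators of all sets of q + 1 letters, acting from the left. \<open>symmetrized\<close>
  is its counterpart for Young symmetrizers with q colours.\<close>

definition alternated :: "nat \<Rightarrow> nat \<Rightarrow> ((nat \<Rightarrow> nat) \<Rightarrow> rat) \<Rightarrow> bool" where
  "alternated q D f \<longleftrightarrow> (\<forall>A\<in>subsets (Suc q) D. \<forall>\<tau>. \<tau> permutes {..<D} \<longrightarrow>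
     (\<Sum>\<sigma> | \<sigma> permutes A. of_int (sign \<sigma>) * f (\<sigma> \<circ> \<tau>)) = 0)"

definition symmetrized :: "nat \<Rightarrow> nat \<Rightarrow> ((nat \<Rightarrow> nat) \<Rightarrow> rat) \<Rightarrow> bool" where
  "symmetrized q D f \<longleftrightarrow> (\<forall>c\<in>colourings D q. \<forall>\<tau>. \<tau> permutes {..<D} \<longrightarrow>
     (\<Sum>\<sigma>\<in>young D c. f (\<sigma> \<circ> \<tau>)) = 0)"

lemma finite_perms [simp]: "finite {\<sigma>::nat\<Rightarrow>nat. \<sigma> permutes {..<D}}"
  by (simp add: finite_permutations)

lemma young_subset: "young D c \<subseteq> {\<sigma>. \<sigma> permutes {..<D}}"
  by (auto simp: young_def)

lemma finite_young [simp]: "finite (young D c)"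
  by (rule finite_subset[OF young_subset]) simp

lemma id_young: "id \<in> young D c" by (simp add: young_def permutes_id)

lemma young_comp: "\<sigma> \<in> young D c \<Longrightarrow> \<rho> \<in> young D c \<Longrightarrow> \<sigma> \<circ> \<rho> \<in> young D c"
  unfolding young_def using permutes_compose permutes_in_image[of _ "{..<D}"] by auto

lemma young_inv: "\<sigma> \<in> young D c \<Longrightarrow> pinv \<sigma> \<in> young D c"
proof -
  assume s: "\<sigma> \<in> young D c"
  then have p: "\<sigma> permutes {..<D}" by (simp add: young_def)
  have "c (pinv \<sigma> s) = c s" if "s < D" for s
  proof -
    have "pinv \<sigma> s < D" using permutes_in_image[OF permutes_inv[OF p], of s] that by simp
    then have "c (\<sigma> (pinv \<sigma> s)) = c (pinv \<sigma> s)" using s by (simp add: young_def)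
    then show ?thesis using permutes_inverses(1)[OF p] by simp
  qed
  then show ?thesis using permutes_inv[OF p] by (simp add: young_def)
qed

text \<open>Both lexicographic comparisons below look at the first position where
  \<open>\<sigma> \<circ> \<tau>\<close> and \<open>\<tau>\<close> differ. Earlier values are fixed
  by \<open>\<sigma>\<close>, so by injectivity the new value at that position stood further to the
  right.\<close>

lemma first_moved:
  fixes \<sigma> \<tau> :: "nat \<Rightarrow> nat"
  assumes "\<tau> permutes {..<D}" "\<sigma> permutes {..<D}" "\<sigma> \<noteq> id"
  obtains s where "s < D" "\<sigma> (\<tau> s) \<noteq> \<tau> s" "\<And>s'. s' < s \<Longrightarrow> \<sigma> (\<tau> s') = \<tau> s'"
    "\<And>s'. \<sigma> (\<tau> s) = \<tau> s' \<Longrightarrow> s < s'"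
proof -
  from assms(3) obtain v where v: "\<sigma> v \<noteq> v" by (auto simp: fun_eq_iff)
  then have "\<sigma> (\<tau> (pinv \<tau> v)) \<noteq> \<tau> (pinv \<tau> v)" using permutes_inverses(1)[OF assms(1)] by simp
  then have ex: "\<exists>s. \<sigma> (\<tau> s) \<noteq> \<tau> s" by blast
  define s where "s = (LEAST s. \<sigma> (\<tau> s) \<noteq> \<tau> s)"
  have 1: "\<sigma> (\<tau> s) \<noteq> \<tau> s" unfolding s_def by (rule LeastI_ex[OF ex])
  have 2: "\<sigma> (\<tau> s') = \<tau> s'" if "s' < s" for s' using not_less_Least[of s'] that s_def by blast
  have "s < D"
  proof (rule ccontr)
    assume "\<not> s < D"
    then have "\<tau> s = s" "\<sigma> s = s" using assms by (auto simp: permutes_not_in)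
    with 1 show False by simp
  qed
  moreover have "s < s'" if "\<sigma> (\<tau> s) = \<tau> s'" for s'
  proof (rule ccontr)
    assume "\<not> s < s'"
    then have "s' < s" using that 1 by (cases "s' = s") auto
    then have "\<sigma> (\<tau> s') = \<sigma> (\<tau> s)" using 2 that by simp
    then have "s' = s" using permutes_inj[OF assms(1)] permutes_inj[OF assms(2)] by (simp add: inj_eq)
    with \<open>s' < s\<close> show False by simp
  qed
  ultimately show ?thesis using that 1 2 by blast
qed

text \<open>At the first change the new value is taken from a later position of \<open>B\<close>,
  where the descending \<open>\<tau>\<close> is smaller.\<close>

lemma less_fun_alternator:
  assumes "\<tau> permutes {..<D}" "B \<subseteq> {..<D}" "descending \<tau> B" "\<sigma> permutes (\<tau> ` B)" "\<sigma> \<noteq> id"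
  shows "less_fun (\<sigma> \<circ> \<tau>) \<tau>"
proof -
  have sD: "\<sigma> permutes {..<D}"
    using permutes_subset[OF assms(4)] assms(1,2) permutes_image[OF assms(1)] by blast
  obtain s where s: "s < D" "\<sigma> (\<tau> s) \<noteq> \<tau> s" "\<And>s'. s' < s \<Longrightarrow> \<sigma> (\<tau> s') = \<tau> s'"
    "\<And>s'. \<sigma> (\<tau> s) = \<tau> s' \<Longrightarrow> s < s'" by (rule first_moved[OF assms(1) sD assms(5)]) blast
  have in1: "\<tau> s \<in> \<tau> ` B" using s(2) assms(4) permutes_not_in by metis
  then have "s \<in> B" using permutes_inj[OF assms(1)] by (simp add: inj_image_mem_iff)
  obtain s' where s': "s' \<in> B" "\<sigma> (\<tau> s) = \<tau> s'" using in1 permutes_in_image[OF assms(4)] by auto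
  have "\<tau> s' < \<tau> s" using s(4)[OF s'(2)] assms(3) s' \<open>s \<in> B\<close> by (auto simp: descending_def)
  then show ?thesis using s s' by (auto simp: less_fun_def intro!: exI[of _ s])
qed

text \<open>The colour of a letter is the length of the longest descending subsequence that ends in it;
  equally coloured letters ascend.\<close>

lemma good_perm_colouring:
  assumes \<tau>: "\<tau> permutes {..<D}" and good: "good_perm q D \<tau>"
  obtains c where "c \<in> colourings D q"
    "\<And>\<rho>. \<rho> \<in> young D c \<Longrightarrow> \<rho> \<noteq> id \<Longrightarrow> less_fun \<tau> (\<rho> \<circ> \<tau>)"
proof -
  define Bs where "Bs s = {B. B \<subseteq> {..s} \<and> s \<in> B \<and> descending \<tau> B}" for s
  define l where "l s = Max (card ` Bs s)" for s
  have fin: "finite (Bs s)" for s unfolding Bs_def by (rule finite_subset[of _ "Pow {..s}"]) auto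
  have sing: "{s} \<in> Bs s" for s by (auto simp: Bs_def descending_def)
  have l1: "card B \<le> l s" if "B \<in> Bs s" for B s unfolding l_def using that fin by simp
  have l2: "\<exists>B\<in>Bs s. card B = l s" for s
    using Max_in[of "card ` Bs s"] fin sing unfolding l_def by fastforce
  have lpos: "0 < l s" for s using l1[OF sing, of s] by simp
  have lq: "l s \<le> q" if "s < D" for s
  proof -
    obtain B where B: "B \<in> Bs s" "card B = l s" using l2 by blast
    have "B \<subseteq> {..<D}" using B that by (auto simp: Bs_def)
    then show ?thesis using good B by (auto simp: good_perm_def Bs_def)
  qed
  have inc: "\<tau> s < \<tau> s'" if "s < s'" "l s = l s'" for s s'
  proof (rule ccontr)
    assume "\<not> \<tau> s < \<tau> s'"
    moreover have "\<tau> s \<noteq> \<tau> s'" using permutes_inj[OF \<tau>] that by (auto dest: injD)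
    ultimately have lt: "\<tau> s' < \<tau> s" by simp
    obtain B where B: "B \<in> Bs s" "card B = l s" using l2 by blast
    have ge: "\<tau> s \<le> \<tau> x" if "x \<in> B" for x
      using B that unfolding Bs_def descending_def by (cases "x = s") (force simp: less_le)+
    have "insert s' B \<in> Bs s'"
      using B that(1) lt ge unfolding Bs_def descending_def by (auto; force)
    then have "card (insert s' B) \<le> l s'" by (rule l1)
    moreover have "finite B" "s' \<notin> B" using B that(1) unfolding Bs_def by (auto dest: finite_subset)
    ultimately show False using B that by simp
  qed
  \<comment> \<open>The lengths \<open>l\<close> run from 1 to q, so subtracting 1 gives q colours.
    The inverse of \<open>\<tau>\<close> moves the colours from positions to values.\<close>
  define c where "c = restrict (\<lambda>v. l (pinv \<tau> v) - 1) {..<D}"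
  have inD: "pinv \<tau> v < D" if "v < D" for v
    using permutes_in_image[OF permutes_inv[OF \<tau>], of v] that by simp
  have "c \<in> colourings D q" unfolding colourings_def c_def
    using lq lpos inD by (auto simp: Suc_le_eq intro!: diff_less_Suc) (metis One_nat_def Suc_diff_1 Suc_le_lessD)
  moreover have "less_fun \<tau> (\<rho> \<circ> \<tau>)" if \<rho>: "\<rho> \<in> young D c" "\<rho> \<noteq> id" for \<rho>
  proof -
    have \<rho>D: "\<rho> permutes {..<D}" using \<rho> by (simp add: young_def)
    obtain s where s: "s < D" "\<rho> (\<tau> s) \<noteq> \<tau> s" "\<And>s'. s' < s \<Longrightarrow> \<rho> (\<tau> s') = \<tau> s'"
      "\<And>s'. \<rho> (\<tau> s) = \<tau> s' \<Longrightarrow> s < s'" by (rule first_moved[OF \<tau> \<rho>D \<rho>(2)]) blast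
    have ts: "\<tau> s < D" using permutes_in_image[OF \<tau>, of s] s by simp
    then have rts: "\<rho> (\<tau> s) < D" using permutes_in_image[OF \<rho>D, of "\<tau> s"] by simp
    define s' where "s' = pinv \<tau> (\<rho> (\<tau> s))"
    have s': "\<rho> (\<tau> s) = \<tau> s'" using permutes_inverses(1)[OF \<tau>] by (simp add: s'_def)
    have "c (\<rho> (\<tau> s)) = c (\<tau> s)" using \<rho> ts by (simp add: young_def)
    then have "l s' - 1 = l s - 1"
      using ts rts permutes_inverses(2)[OF \<tau>] by (simp add: c_def s')
    then have "l s = l s'" using lpos[of s] lpos[of s'] by simp
    then have "\<tau> s < \<tau> s'" using inc s(4)[OF s'] by blast
    then show ?thesis using s s' by (auto simp: less_fun_def intro!: exI[of _ s])
  qed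
  ultimately show ?thesis using that by blast
qed

lemma finite_less_fun_maximal:
  assumes "finite (S :: (nat \<Rightarrow> nat) set)" "S \<noteq> {}"
  obtains m where "m \<in> S" "\<And>x. x \<in> S \<Longrightarrow> \<not> less_fun m x"
proof -
  interpret lex: order "\<lambda>f g. less_fun f g \<or> f = g" "less_fun :: (nat \<Rightarrow> nat) \<Rightarrow> _"
    by (rule order_less_fun)
  have "\<exists>m\<in>S. \<forall>x\<in>S. \<not> less_fun m x"
    using assms
  proof (induction S rule: finite_ne_induct)
    case (singleton x) then show ?case by (auto simp: less_fun_irrefl)
  next
    case (insert x F)
    then obtain m where m: "m \<in> F" "\<forall>x\<in>F. \<not> less_fun m x" by blast
    show ?case
    proof (cases "less_fun m x")
      case True
      then have "\<forall>y\<in>insert x F. \<not> less_fun x y" using m less_fun_trans less_fun_irrefl by blast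
      then show ?thesis by blast
    next
      case False then show ?thesis using m by blast
    qed
  qed
  then show ?thesis using that by blast
qed

text \<open>Let \<open>m\<close> be lexicographically maximal in the support. The symmetrizer
  adapted to \<open>m\<close> sends every other term strictly above \<open>m\<close>, hence out of
  the support, so the vanishing sum reduces to \<open>g m\<close>.\<close>

lemma good_supported_symmetrized_zero:
  assumes supp: "\<And>\<tau>. \<tau> permutes {..<D} \<Longrightarrow> g \<tau> \<noteq> 0 \<Longrightarrow> good_perm q D \<tau>"
    and sym: "symmetrized q D g" and \<tau>: "\<tau> permutes {..<D}"
  shows "g \<tau> = 0"
proof (rule ccontr)
  assume "g \<tau> \<noteq> 0"
  define S where "S = {\<tau>. \<tau> permutes {..<D} \<and> g \<tau> \<noteq> 0}"
  have "finite S" unfolding S_def by (rule finite_subset[OF _ finite_perms[of D]]) auto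
  moreover have "S \<noteq> {}" using \<tau> \<open>g \<tau> \<noteq> 0\<close> by (auto simp: S_def)
  ultimately obtain m where m: "m \<in> S" "\<And>x. x \<in> S \<Longrightarrow> \<not> less_fun m x"
    using finite_less_fun_maximal by blast
  have mD: "m permutes {..<D}" and gm: "g m \<noteq> 0" using m(1) by (auto simp: S_def)
  obtain c where c: "c \<in> colourings D q"
    "\<And>\<rho>. \<rho> \<in> young D c \<Longrightarrow> \<rho> \<noteq> id \<Longrightarrow> less_fun m (\<rho> \<circ> m)"
    by (rule good_perm_colouring[OF mD supp[OF mD gm]]) blast
  have "0 = (\<Sum>\<sigma>\<in>young D c. g (\<sigma> \<circ> m))" using sym c(1) mD by (simp add: symmetrized_def)
  also have "\<dots> = (\<Sum>\<sigma>\<in>young D c. if \<sigma> = id then g m else 0)"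
  proof (rule sum.cong[OF refl])
    fix \<sigma> assume s: "\<sigma> \<in> young D c"
    show "g (\<sigma> \<circ> m) = (if \<sigma> = id then g m else 0)"
    proof (cases "\<sigma> = id")
      case False
      have "\<sigma> \<circ> m permutes {..<D}" using s mD by (auto simp: young_def intro: permutes_compose)
      then show ?thesis using m(2)[of "\<sigma> \<circ> m"] c(2)[OF s False] False by (auto simp: S_def)
    qed simp
  qed
  also have "\<dots> = g m" by (simp add: id_young)
  finally show False using gm by simp
qed

lemma finite_colourings [simp]: "finite (colourings D q)"
  by (simp add: colourings_def finite_PiE)

lemma finite_subsets [simp]: "finite (subsets t m)"
  unfolding subsets_def by (rule finite_subset[of _ "Pow {..<m}"]) auto

lemma subsets_permutes: "A \<in> subsets t D \<Longrightarrow> \<sigma> permutes A \<Longrightarrow> \<sigma> permutes {..<D}"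
  unfolding subsets_def using permutes_subset by blast

lemma finite_subsets_perms [simp]: "A \<in> subsets t D \<Longrightarrow> finite {\<sigma>. \<sigma> permutes A}"
  unfolding subsets_def by (auto intro!: finite_permutations dest: finite_subset)

text \<open>The two conditions hold for the alternators \<open>\<Sum>\<^sub>\<sigma> sgn(\<sigma>) \<sigma> \<tau>\<close>, and modulo these every
  permutation is a combination of good ones.\<close>

definition straightenable :: "nat \<Rightarrow> nat \<Rightarrow> ((nat \<Rightarrow> nat) \<Rightarrow> rat) \<Rightarrow> bool" where
  "straightenable q D i \<longleftrightarrow> symmetrized q D i \<and>
     (\<forall>h. alternated q D h \<longrightarrow> (\<Sum>\<pi> | \<pi> permutes {..<D}. i \<pi> * h \<pi>) = 0)"

lemma straightenable_sum:
  assumes "\<And>j. j \<in> J \<Longrightarrow> straightenable q D (i j)"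
  shows "straightenable q D (\<lambda>\<pi>. \<Sum>j\<in>J. c j * i j \<pi>)"
  unfolding straightenable_def symmetrized_def
proof (intro conjI ballI allI impI)
  fix k \<tau> assume k: "k \<in> colourings D q" and t: "\<tau> permutes {..<D}"
  have "(\<Sum>\<sigma>\<in>young D k. \<Sum>j\<in>J. c j * i j (\<sigma> \<circ> \<tau>)) = (\<Sum>j\<in>J. c j * (\<Sum>\<sigma>\<in>young D k. i j (\<sigma> \<circ> \<tau>)))"
    by (subst sum.swap) (simp add: sum_distrib_left)
  also have "\<dots> = 0"
    using assms k t by (intro sum.neutral) (simp add: straightenable_def symmetrized_def)
  finally show "(\<Sum>\<sigma>\<in>young D k. \<Sum>j\<in>J. c j * i j (\<sigma> \<circ> \<tau>)) = 0" .
next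
  fix h assume h: "alternated q D h"
  have "(\<Sum>\<pi> | \<pi> permutes {..<D}. (\<Sum>j\<in>J. c j * i j \<pi>) * h \<pi>) =
    (\<Sum>j\<in>J. c j * (\<Sum>\<pi> | \<pi> permutes {..<D}. i j \<pi> * h \<pi>))"
    by (simp add: sum_distrib_right sum_distrib_left mult.assoc) (rule sum.swap)
  also have "\<dots> = 0"
    using assms h by (intro sum.neutral) (simp add: straightenable_def)
  finally show "(\<Sum>\<pi> | \<pi> permutes {..<D}. (\<Sum>j\<in>J. c j * i j \<pi>) * h \<pi>) = 0" .
qed

lemma colouring_collision:
  assumes "A \<in> subsets (Suc q) D" "c \<in> colourings D q"
  obtains a a' where "a \<in> A" "a' \<in> A" "a \<noteq> a'" "c a = c a'"
proof -
  have "finite A" "card A = Suc q" "A \<subseteq> {..<D}" using assms(1) by (auto simp: subsets_def dest: finite_subset)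
  moreover have "c ` A \<subseteq> {..<q}" using assms(2) \<open>A \<subseteq> _\<close> by (auto simp: colourings_def)
  then have "card (c ` A) \<le> q" using card_mono[of "{..<q}"] by fastforce
  ultimately have "\<not> inj_on c A" using card_image[of c A] by auto
  then show ?thesis using that by (auto simp: inj_on_def)
qed

lemma transpose_young: "a < D \<Longrightarrow> a' < D \<Longrightarrow> c a = c a' \<Longrightarrow> transpose a a' \<in> young D c"
  unfolding young_def using permutes_swap_id[of a "{..<D}" a'] by (auto simp: transpose_def)

lemma sum_perms_compose_left:
  assumes "finite A" "\<rho> permutes A"
  shows "(\<Sum>\<sigma> | \<sigma> permutes A. h (\<rho> \<circ> \<sigma>)) = (\<Sum>\<sigma> | \<sigma> permutes A. h \<sigma>)"
  by (rule sum.reindex_bij_betw[OF bij_betw_byWitness[where f' = "\<lambda>\<sigma>. pinv \<rho> \<circ> \<sigma>"]])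
    (auto simp: fun_eq_iff permutes_inverses[OF assms(2)] intro: permutes_compose[unfolded o_def] permutes_compose permutes_inv assms)

lemma sum_perms_compose_right:
  assumes "finite A" "\<rho> permutes A"
  shows "(\<Sum>\<sigma> | \<sigma> permutes A. h (\<sigma> \<circ> \<rho>)) = (\<Sum>\<sigma> | \<sigma> permutes A. h \<sigma>)"
  by (rule sum.reindex_bij_betw[OF bij_betw_byWitness[where f' = "\<lambda>\<sigma>. \<sigma> \<circ> pinv \<rho>"]])
    (auto simp: fun_eq_iff permutes_inverses[OF assms(2)] intro: permutes_compose[unfolded o_def] permutes_compose permutes_inv assms)

lemma sum_young_compose_left:
  assumes "\<rho> \<in> young D c"
  shows "(\<Sum>\<sigma>\<in>young D c. h (\<rho> \<circ> \<sigma>)) = (\<Sum>\<sigma>\<in>young D c. h \<sigma>)"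
proof -
  have r: "\<rho> permutes {..<D}" using assms by (simp add: young_def)
  show ?thesis
    by (rule sum.reindex_bij_betw[OF bij_betw_byWitness[where f' = "\<lambda>\<sigma>. pinv \<rho> \<circ> \<sigma>"]])
      (auto simp: fun_eq_iff permutes_inverses[OF r] intro: young_comp[unfolded o_def] young_comp young_inv assms)
qed

lemma sign_transpose_comp:
  assumes "finite A" "\<sigma> permutes A" "a \<noteq> a'"
  shows "sign (transpose a a' \<circ> \<sigma>) = - sign \<sigma>"
proof -
  have "permutation \<sigma>" using assms permutation_permutes by blast
  then show ?thesis using assms(3) by (simp add: sign_compose permutation_swap_id sign_swap_id)
qed

text \<open>Among q + 1 letters two have the same colour. Their transposition lies both in the Young
  subgroup and in the symmetric group of \<open>A\<close>; multiplying by it reindexes the double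
  sum and reverses its sign. The pairing with an alternated function vanishes by definition.\<close>

lemma straightenable_alternator:
  assumes A: "A \<in> subsets (Suc q) D" and \<tau>: "\<tau> permutes {..<D}"
  shows "straightenable q D (\<lambda>\<pi>. \<Sum>\<sigma> | \<sigma> permutes A. of_int (sign \<sigma>) * (if \<pi> = \<sigma> \<circ> \<tau> then 1 else 0))"
  unfolding straightenable_def symmetrized_def
proof (intro conjI ballI allI impI)
  fix h assume h: "alternated q D h"
  have "(\<Sum>\<pi> | \<pi> permutes {..<D}. (\<Sum>\<sigma> | \<sigma> permutes A. of_int (sign \<sigma>) * (if \<pi> = \<sigma> \<circ> \<tau> then 1 else 0)) * h \<pi>)
    = (\<Sum>\<sigma> | \<sigma> permutes A. \<Sum>\<pi> | \<pi> permutes {..<D}. if \<pi> = \<sigma> \<circ> \<tau> then of_int (sign \<sigma>) * h \<pi> else 0)"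
    unfolding sum_distrib_right by (subst sum.swap) (intro sum.cong, auto)
  also have "\<dots> = (\<Sum>\<sigma> | \<sigma> permutes A. of_int (sign \<sigma>) * h (\<sigma> \<circ> \<tau>))"
    using subsets_permutes[OF A] \<tau> by (intro sum.cong) (auto simp: permutes_compose)
  also have "\<dots> = 0" using h A \<tau> by (simp add: alternated_def)
  finally show "(\<Sum>\<pi> | \<pi> permutes {..<D}. (\<Sum>\<sigma> | \<sigma> permutes A. of_int (sign \<sigma>) * (if \<pi> = \<sigma> \<circ> \<tau> then 1 else 0)) * h \<pi>) = 0" .
next
  fix c \<tau>' assume c: "c \<in> colourings D q" and \<tau>': "\<tau>' permutes {..<D}"
  let ?F = "\<lambda>\<rho> \<sigma>. of_int (sign \<sigma>) * (if \<rho> \<circ> \<tau>' = \<sigma> \<circ> \<tau> then 1 else 0) :: rat"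
  let ?S = "\<Sum>\<rho>\<in>young D c. \<Sum>\<sigma> | \<sigma> permutes A. ?F \<rho> \<sigma>"
  obtain a a' where a: "a \<in> A" "a' \<in> A" "a \<noteq> a'" "c a = c a'" by (rule colouring_collision[OF A c]) blast
  have AD: "A \<subseteq> {..<D}" and fA: "finite A" using A by (auto simp: subsets_def dest: finite_subset)
  let ?t = "transpose a a'"
  have tA: "?t permutes A" using a by (simp add: permutes_swap_id)
  have ty: "?t \<in> young D c" using a AD by (intro transpose_young) auto
  have "?S = (\<Sum>\<rho>\<in>young D c. \<Sum>\<sigma> | \<sigma> permutes A. ?F (?t \<circ> \<rho>) (?t \<circ> \<sigma>))"
    by (simp add: sum_perms_compose_left[OF fA tA, of "\<lambda>\<sigma>. ?F _ \<sigma>"]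
        sum_young_compose_left[OF ty, of "\<lambda>\<rho>. \<Sum>\<sigma> | \<sigma> permutes A. ?F \<rho> \<sigma>"])
  also have "\<dots> = - ?S"
    unfolding sum_negf[symmetric]
  proof (intro sum.cong refl)
    fix \<rho> \<sigma> assume "\<sigma> \<in> {\<sigma>. \<sigma> permutes A}"
    then have "sign (?t \<circ> \<sigma>) = - sign \<sigma>" using sign_transpose_comp[OF fA _ a(3)] by simp
    moreover have "?t \<circ> \<rho> \<circ> \<tau>' = ?t \<circ> \<sigma> \<circ> \<tau> \<longleftrightarrow> \<rho> \<circ> \<tau>' = \<sigma> \<circ> \<tau>"
      by (metis (no_types, lifting) o_assoc transpose_comp_involutory id_o)
    ultimately show "?F (?t \<circ> \<rho>) (?t \<circ> \<sigma>) = - ?F \<rho> \<sigma>" by simp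
  qed
  finally show "?S = 0" by simp
qed

text \<open>A permutation that is not good descends along q + 1 positions. The alternator of the
  values found there rewrites it through lexicographically smaller permutations, so induction on the
  number of smaller permutations applies.\<close>

lemma straighten_modulo_good:
  "\<tau> permutes {..<D} \<Longrightarrow> \<exists>g. (\<forall>\<pi>. \<pi> permutes {..<D} \<longrightarrow> g \<pi> \<noteq> 0 \<longrightarrow> good_perm q D \<pi>) \<and>
     straightenable q D (\<lambda>\<pi>. (if \<pi> = \<tau> then 1 else 0) - g \<pi>)"
proof (induction "card {\<rho>. \<rho> permutes {..<D} \<and> less_fun \<rho> \<tau>}" arbitrary: \<tau> rule: less_induct)
  case less
  show ?case
  proof (cases "good_perm q D \<tau>")
    case True
    have "straightenable q D (\<lambda>\<pi>. 0)" by (simp add: straightenable_def symmetrized_def)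
    with True show ?thesis by (intro exI[of _ "\<lambda>\<pi>. if \<pi> = \<tau> then 1 else 0"]) auto
  next
    case False
    then obtain B0 where B0: "B0 \<subseteq> {..<D}" "descending \<tau> B0" "Suc q \<le> card B0"
      by (auto simp: good_perm_def not_le)
    obtain B where B: "B \<subseteq> B0" "card B = Suc q"
      using obtain_subset_with_card_n[OF B0(3)] by metis
    have BD: "B \<subseteq> {..<D}" and dB: "descending \<tau> B" using B B0 by (auto simp: descending_def)
    \<comment> \<open>Alternators act on values, hence the image of the positions
      \<open>B\<close>.\<close>
    define A where "A = \<tau> ` B"
    have A: "A \<in> subsets (Suc q) D"
      using BD B permutes_image[OF less.prems] card_image[OF inj_on_subset[OF permutes_inj[OF less.prems]], of B]
      by (auto simp: subsets_def A_def)
    have ex: "\<forall>\<sigma>\<in>{\<sigma>. \<sigma> permutes A} - {id}. \<exists>g. (\<forall>\<pi>. \<pi> permutes {..<D} \<longrightarrow> g \<pi> \<noteq> 0 \<longrightarrow> good_perm q D \<pi>) \<and>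
       straightenable q D (\<lambda>\<pi>. (if \<pi> = \<sigma> \<circ> \<tau> then 1 else 0) - g \<pi>)"
    proof
      fix \<sigma> assume "\<sigma> \<in> {\<sigma>. \<sigma> permutes A} - {id}"
      then have s: "\<sigma> permutes A" "\<sigma> \<noteq> id" by auto
      have st: "\<sigma> \<circ> \<tau> permutes {..<D}" using subsets_permutes[OF A s(1)] less.prems by (simp add: permutes_compose)
      have lt: "less_fun (\<sigma> \<circ> \<tau>) \<tau>"
        using less_fun_alternator[OF less.prems BD dB] s by (simp add: A_def)
      have "card {\<rho>. \<rho> permutes {..<D} \<and> less_fun \<rho> (\<sigma> \<circ> \<tau>)} < card {\<rho>. \<rho> permutes {..<D} \<and> less_fun \<rho> \<tau>}"
      proof (rule psubset_card_mono)
        show "finite {\<rho>. \<rho> permutes {..<D} \<and> less_fun \<rho> \<tau>}"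
          by (rule finite_subset[OF _ finite_perms[of D]]) auto
        show "{\<rho>. \<rho> permutes {..<D} \<and> less_fun \<rho> (\<sigma> \<circ> \<tau>)} \<subset> {\<rho>. \<rho> permutes {..<D} \<and> less_fun \<rho> \<tau>}"
          using lt st less_fun_trans less_fun_irrefl by blast
      qed
      from less.hyps[OF this st] show "\<exists>g. (\<forall>\<pi>. \<pi> permutes {..<D} \<longrightarrow> g \<pi> \<noteq> 0 \<longrightarrow> good_perm q D \<pi>) \<and>
       straightenable q D (\<lambda>\<pi>. (if \<pi> = \<sigma> \<circ> \<tau> then 1 else 0) - g \<pi>)" .
    qed
    obtain g where g: "\<And>\<sigma> \<pi>. \<sigma> permutes A \<Longrightarrow> \<sigma> \<noteq> id \<Longrightarrow> \<pi> permutes {..<D} \<Longrightarrow> g \<sigma> \<pi> \<noteq> 0 \<Longrightarrow> good_perm q D \<pi>"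
      "\<And>\<sigma>. \<sigma> permutes A \<Longrightarrow> \<sigma> \<noteq> id \<Longrightarrow> straightenable q D (\<lambda>\<pi>. (if \<pi> = \<sigma> \<circ> \<tau> then 1 else 0) - g \<sigma> \<pi>)"
      using bchoice[OF ex] by auto
    let ?P = "{\<sigma>. \<sigma> permutes A}"
    define G where "G \<pi> = - (\<Sum>\<sigma>\<in>?P - {id}. of_int (sign \<sigma>) * g \<sigma> \<pi>)" for \<pi>
    have fP: "finite ?P" using A by simp
    define alt where "alt \<pi> = (\<Sum>\<sigma>\<in>?P. of_int (sign \<sigma>) * (if \<pi> = \<sigma> \<circ> \<tau> then 1 else 0 :: rat))" for \<pi>
    define rest where "rest \<pi> = (\<Sum>\<sigma>\<in>?P - {id}. of_int (sign \<sigma>) * ((if \<pi> = \<sigma> \<circ> \<tau> then 1 else 0) - g \<sigma> \<pi>))" for \<pi>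
    have "straightenable q D alt" unfolding alt_def by (rule straightenable_alternator[OF A less.prems])
    moreover have "straightenable q D rest" unfolding rest_def using g(2) by (intro straightenable_sum) auto
    ultimately have "straightenable q D (\<lambda>\<pi>. \<Sum>j\<in>{True, False}. (if j then 1 else -1) * (if j then alt \<pi> else rest \<pi>))"
      using straightenable_sum[of "{True, False}" q D "\<lambda>j. if j then alt else rest" "\<lambda>j. if j then 1 else -1"]
      by (simp add: if_distrib cong: if_cong)
    moreover have "(\<Sum>j\<in>{True, False}. (if j then 1 else -1) * (if j then alt \<pi> else rest \<pi>))
        = (if \<pi> = \<tau> then 1 else 0) - G \<pi>" for \<pi>
      unfolding alt_def rest_def G_def
      by (subst sum.remove[OF fP, of id]) (simp_all add: permutes_id right_diff_distrib sum_subtractf)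
    ultimately have "straightenable q D (\<lambda>\<pi>. (if \<pi> = \<tau> then 1 else 0) - G \<pi>)" by simp
    moreover have "good_perm q D \<pi>" if "\<pi> permutes {..<D}" "G \<pi> \<noteq> 0" for \<pi>
    proof (rule ccontr)
      assume "\<not> good_perm q D \<pi>"
      then have "g \<sigma> \<pi> = 0" if "\<sigma> \<in> ?P - {id}" for \<sigma> using g(1) that \<open>\<pi> permutes _\<close> by blast
      then have "G \<pi> = 0" unfolding G_def by (simp add: sum.neutral)
      with that show False by simp
    qed
    ultimately show ?thesis by blast
  qed
qed

text \<open>Straightening writes f = d + G with G supported on good permutations. Since f and d are
  symmetrized, so is G, whence G = 0. Then d = f is orthogonal to the alternated function f, so the
  sum of the squares of its values vanishes.\<close>

lemma alternated_symmetrized_zero: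
  assumes alt: "alternated q D f" and sym: "symmetrized q D f" and \<tau>: "\<tau> permutes {..<D}"
  shows "f \<tau> = 0"
proof -
  let ?P = "{\<pi>. \<pi> permutes {..<D}}"
  have "\<forall>\<tau>\<in>?P. \<exists>g. (\<forall>\<pi>. \<pi> permutes {..<D} \<longrightarrow> g \<pi> \<noteq> 0 \<longrightarrow> good_perm q D \<pi>) \<and>
     straightenable q D (\<lambda>\<pi>. (if \<pi> = \<tau> then 1 else 0) - g \<pi>)"
    using straighten_modulo_good by blast
  from bchoice[OF this] obtain g where g: "\<And>\<tau> \<pi>. \<tau> \<in> ?P \<Longrightarrow> \<pi> permutes {..<D} \<Longrightarrow> g \<tau> \<pi> \<noteq> 0 \<Longrightarrow> good_perm q D \<pi>"
      "\<And>\<tau>. \<tau> \<in> ?P \<Longrightarrow> straightenable q D (\<lambda>\<pi>. (if \<pi> = \<tau> then 1 else 0) - g \<tau> \<pi>)"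
    by auto
  define d where "d \<pi> = (\<Sum>\<tau>\<in>?P. f \<tau> * ((if \<pi> = \<tau> then 1 else 0) - g \<tau> \<pi>))" for \<pi>
  define G where "G \<pi> = (\<Sum>\<tau>\<in>?P. f \<tau> * g \<tau> \<pi>)" for \<pi>
  have d: "straightenable q D d" unfolding d_def using g(2) by (intro straightenable_sum) auto
  have dG: "d \<pi> = f \<pi> - G \<pi>" if "\<pi> permutes {..<D}" for \<pi>
    using that unfolding d_def G_def
    by (simp add: right_diff_distrib sum_subtractf if_distrib[of "(*) (f _)"] cong: if_cong)
  have "symmetrized q D G"
    unfolding symmetrized_def
  proof (intro ballI allI impI)
    fix c \<tau> assume c: "c \<in> colourings D q" and t: "\<tau> permutes {..<D}"
    have "(\<Sum>\<sigma>\<in>young D c. G (\<sigma> \<circ> \<tau>)) = (\<Sum>\<sigma>\<in>young D c. f (\<sigma> \<circ> \<tau>) - d (\<sigma> \<circ> \<tau>))"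
      using t by (intro sum.cong) (auto simp: young_def dG permutes_compose)
    also have "\<dots> = 0" using sym d c t by (simp add: sum_subtractf straightenable_def symmetrized_def)
    finally show "(\<Sum>\<sigma>\<in>young D c. G (\<sigma> \<circ> \<tau>)) = 0" .
  qed
  moreover have "good_perm q D \<pi>" if "\<pi> permutes {..<D}" "G \<pi> \<noteq> 0" for \<pi>
    using that g(1) unfolding G_def by (metis (mono_tags, lifting) mult_eq_0_iff sum.neutral)
  ultimately have G0: "G \<pi> = 0" if "\<pi> permutes {..<D}" for \<pi>
    using good_supported_symmetrized_zero that by blast
  have "0 = (\<Sum>\<pi>\<in>?P. d \<pi> * f \<pi>)" using d alt by (simp add: straightenable_def)
  also have "\<dots> = (\<Sum>\<pi>\<in>?P. f \<pi> * f \<pi>)" by (intro sum.cong) (auto simp: dG G0)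
  finally have "(\<Sum>\<pi>\<in>?P. f \<pi> * f \<pi>) = 0" by simp
  then show ?thesis using \<tau> by (subst (asm) sum_nonneg_eq_0_iff) auto
qed

section \<open>Positivity of symmetrizers and alternators\<close>

text \<open>For a sign character of a subgroup \<open>H\<close> the element e = \<Sum>
  \<open>\<chi> \<sigma>\<close> \<sigma> is self-adjoint with e e = |H| e, hence (e f, e f) = |H|
  (f, e f). The trivial character gives symmetrizers, \<open>sign\<close> gives alternators.\<close>

lemma sum_character_square:
  fixes f :: "(nat \<Rightarrow> nat) \<Rightarrow> rat" and \<chi> :: "(nat \<Rightarrow> nat) \<Rightarrow> rat"
  assumes fin: "finite H" and H: "H \<subseteq> {\<sigma>. \<sigma> permutes {..<D}}"
    and comp: "\<And>\<sigma> \<rho>. \<sigma> \<in> H \<Longrightarrow> \<rho> \<in> H \<Longrightarrow> \<sigma> \<circ> \<rho> \<in> H" and inv: "\<And>\<sigma>. \<sigma> \<in> H \<Longrightarrow> pinv \<sigma> \<in> H"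
    and \<chi>: "\<And>\<sigma> \<rho>. \<sigma> \<in> H \<Longrightarrow> \<rho> \<in> H \<Longrightarrow> \<chi> (\<sigma> \<circ> \<rho>) = \<chi> \<sigma> * \<chi> \<rho>" "\<And>\<sigma>. \<sigma> \<in> H \<Longrightarrow> \<chi> \<sigma> * \<chi> \<sigma> = 1"
  shows "(\<Sum>\<pi> | \<pi> permutes {..<D}. (\<Sum>\<sigma>\<in>H. \<chi> \<sigma> * f (\<sigma> \<circ> \<pi>))\<^sup>2) =
    of_nat (card H) * (\<Sum>\<pi> | \<pi> permutes {..<D}. f \<pi> * (\<Sum>\<sigma>\<in>H. \<chi> \<sigma> * f (\<sigma> \<circ> \<pi>)))"
proof -
  let ?P = "{\<pi>. \<pi> permutes {..<D}}"
  have *: "(\<Sum>\<pi>\<in>?P. (\<chi> \<rho> * f (\<rho> \<circ> \<pi>)) * (\<Sum>\<sigma>\<in>H. \<chi> \<sigma> * f (\<sigma> \<circ> \<pi>))) = (\<Sum>\<pi>\<in>?P. f \<pi> * (\<Sum>\<sigma>\<in>H. \<chi> \<sigma> * f (\<sigma> \<circ> \<pi>)))"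
    if \<rho>: "\<rho> \<in> H" for \<rho>
  proof -
    have rp: "\<rho> permutes {..<D}" using H \<rho> by auto
    have "(\<Sum>\<sigma>\<in>H. \<chi> \<sigma> * f (\<sigma> \<circ> \<pi>)) = \<chi> \<rho> * (\<Sum>\<sigma>\<in>H. \<chi> \<sigma> * f (\<sigma> \<circ> (\<rho> \<circ> \<pi>)))" for \<pi>
    proof -
      have "(\<Sum>\<sigma>\<in>H. \<chi> \<sigma> * f (\<sigma> \<circ> \<pi>)) = (\<Sum>\<sigma>\<in>H. \<chi> (\<sigma> \<circ> \<rho>) * f ((\<sigma> \<circ> \<rho>) \<circ> \<pi>))"
        by (rule sum.reindex_bij_betw[OF bij_betw_byWitness[of H "\<lambda>\<sigma>. \<sigma> \<circ> pinv \<rho>" "\<lambda>\<sigma>. \<sigma> \<circ> \<rho>" H],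
              of "\<lambda>\<sigma>. \<chi> \<sigma> * f (\<sigma> \<circ> \<pi>)", symmetric])
           (auto simp: o_assoc[symmetric] permutes_inv_o[OF rp] comp \<rho> inv)
      also have "\<dots> = \<chi> \<rho> * (\<Sum>\<sigma>\<in>H. \<chi> \<sigma> * f (\<sigma> \<circ> (\<rho> \<circ> \<pi>)))"
        unfolding sum_distrib_left using \<chi>(1) \<rho> by (intro sum.cong) (auto simp: o_assoc ac_simps)
      finally show ?thesis .
    qed
    note shift = this
    have "(\<Sum>\<pi>\<in>?P. (\<chi> \<rho> * f (\<rho> \<circ> \<pi>)) * (\<Sum>\<sigma>\<in>H. \<chi> \<sigma> * f (\<sigma> \<circ> \<pi>))) =
       (\<Sum>\<pi>\<in>?P. (\<chi> \<rho> * \<chi> \<rho>) * (f (\<rho> \<circ> \<pi>) * (\<Sum>\<sigma>\<in>H. \<chi> \<sigma> * f (\<sigma> \<circ> (\<rho> \<circ> \<pi>)))))"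
      by (intro sum.cong refl, subst shift) (simp only: ac_simps)
    also have "\<dots> = (\<Sum>\<pi>\<in>?P. f (\<rho> \<circ> \<pi>) * (\<Sum>\<sigma>\<in>H. \<chi> \<sigma> * f (\<sigma> \<circ> (\<rho> \<circ> \<pi>))))"
      by (simp add: \<chi>(2)[OF \<rho>])
    also have "\<dots> = (\<Sum>\<pi>\<in>?P. f \<pi> * (\<Sum>\<sigma>\<in>H. \<chi> \<sigma> * f (\<sigma> \<circ> \<pi>)))"
      by (rule sum_perms_compose_left[OF _ rp, of "\<lambda>\<pi>. f \<pi> * (\<Sum>\<sigma>\<in>H. \<chi> \<sigma> * f (\<sigma> \<circ> \<pi>))"]) simp
    finally show ?thesis .
  qed
  have "(\<Sum>\<pi>\<in>?P. (\<Sum>\<sigma>\<in>H. \<chi> \<sigma> * f (\<sigma> \<circ> \<pi>))\<^sup>2) =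
    (\<Sum>\<pi>\<in>?P. \<Sum>\<rho>\<in>H. (\<chi> \<rho> * f (\<rho> \<circ> \<pi>)) * (\<Sum>\<sigma>\<in>H. \<chi> \<sigma> * f (\<sigma> \<circ> \<pi>)))"
    by (simp add: power2_eq_square sum_distrib_right)
  also have "\<dots> = (\<Sum>\<rho>\<in>H. \<Sum>\<pi>\<in>?P. (\<chi> \<rho> * f (\<rho> \<circ> \<pi>)) * (\<Sum>\<sigma>\<in>H. \<chi> \<sigma> * f (\<sigma> \<circ> \<pi>)))"
    by (rule sum.swap)
  also have "\<dots> = of_nat (card H) * (\<Sum>\<pi>\<in>?P. f \<pi> * (\<Sum>\<sigma>\<in>H. \<chi> \<sigma> * f (\<sigma> \<circ> \<pi>)))"
    by (simp add: *)
  finally show ?thesis .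
qed

text \<open>The sum of all symmetrizers of Young subgroups with \<open>q\<close> blocks and of all alternators in
  \<open>q + 1\<close> letters. Each summand is a positive semidefinite operator on \<open>\<rat>[S\<^sub>D]\<close>, whence a function
  in the kernel of the sum is killed by all of them.\<close>

definition young_weight :: "nat \<Rightarrow> nat \<Rightarrow> (nat \<Rightarrow> nat) \<Rightarrow> int" where
  "young_weight q D \<sigma> = (\<Sum>c\<in>colourings D q. if \<sigma> \<in> young D c then 1 else 0) +
     (\<Sum>A\<in>subsets (Suc q) D. if \<sigma> permutes A then sign \<sigma> else 0)"

lemma sum_young_weight:
  fixes h :: "(nat \<Rightarrow> nat) \<Rightarrow> 'a::comm_ring_1"
  shows "(\<Sum>\<sigma> | \<sigma> permutes {..<D}. of_int (young_weight q D \<sigma>) * h \<sigma>) =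
    (\<Sum>c\<in>colourings D q. \<Sum>\<sigma>\<in>young D c. h \<sigma>) +
    (\<Sum>A\<in>subsets (Suc q) D. \<Sum>\<sigma> | \<sigma> permutes A. of_int (sign \<sigma>) * h \<sigma>)"
proof -
  let ?P = "{\<sigma>. \<sigma> permutes {..<D}}"
  have "(\<Sum>\<sigma>\<in>?P. \<Sum>c\<in>colourings D q. if \<sigma> \<in> young D c then h \<sigma> else 0) = (\<Sum>c\<in>colourings D q. \<Sum>\<sigma>\<in>young D c. h \<sigma>)"
    by (subst sum.swap) (intro sum.cong refl sum.mono_neutral_cong_right, auto simp: young_def)
  moreover have "(\<Sum>\<sigma>\<in>?P. \<Sum>A\<in>subsets (Suc q) D. if \<sigma> permutes A then of_int (sign \<sigma>) * h \<sigma> else 0)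
     = (\<Sum>A\<in>subsets (Suc q) D. \<Sum>\<sigma> | \<sigma> permutes A. of_int (sign \<sigma>) * h \<sigma>)"
    by (subst sum.swap) (intro sum.cong refl sum.mono_neutral_cong_right, auto dest: subsets_permutes)
  moreover have "of_int (young_weight q D \<sigma>) * h \<sigma> = (\<Sum>c\<in>colourings D q. if \<sigma> \<in> young D c then h \<sigma> else 0)
     + (\<Sum>A\<in>subsets (Suc q) D. if \<sigma> permutes A then of_int (sign \<sigma>) * h \<sigma> else 0)" for \<sigma>
    unfolding young_weight_def of_int_add of_int_sum distrib_right sum_distrib_right
    by (intro arg_cong2[of _ _ _ _ "(+)"] sum.cong) auto
  ultimately show ?thesis by (simp add: sum.distrib)
qed

text \<open>Pairing the equation with f turns it into a vanishing sum of the nonnegative numbers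
  \<open>Q1 c\<close> and \<open>Q2 A\<close>. Each of them is zero, and by the square formula f is
  killed by every summand of the weight.\<close>

lemma young_weight_kernel:
  fixes f :: "(nat \<Rightarrow> nat) \<Rightarrow> rat"
  assumes f: "\<And>\<pi>. \<pi> permutes {..<D} \<Longrightarrow> (\<Sum>\<sigma> | \<sigma> permutes {..<D}. of_int (young_weight q D \<sigma>) * f (\<sigma> \<circ> \<pi>)) = 0"
    and \<tau>: "\<tau> permutes {..<D}"
  shows "f \<tau> = 0"
proof -
  let ?P = "{\<sigma>. \<sigma> permutes {..<D}}"
  define Q1 where "Q1 c = (\<Sum>\<pi>\<in>?P. f \<pi> * (\<Sum>\<sigma>\<in>young D c. 1 * f (\<sigma> \<circ> \<pi>)))" for c
  define Q2 where "Q2 A = (\<Sum>\<pi>\<in>?P. f \<pi> * (\<Sum>\<sigma> | \<sigma> permutes A. of_int (sign \<sigma>) * f (\<sigma> \<circ> \<pi>)))" for A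
  have e1: "(\<Sum>\<pi>\<in>?P. (\<Sum>\<sigma>\<in>young D c. 1 * f (\<sigma> \<circ> \<pi>))\<^sup>2) = of_nat (card (young D c)) * Q1 c" for c
    unfolding Q1_def by (rule sum_character_square) (use young_subset[of D c] young_comp young_inv in \<open>auto simp del: o_apply\<close>)
  have e2: "(\<Sum>\<pi>\<in>?P. (\<Sum>\<sigma> | \<sigma> permutes A. of_int (sign \<sigma>) * f (\<sigma> \<circ> \<pi>))\<^sup>2) = of_nat (card {\<sigma>. \<sigma> permutes A}) * Q2 A"
    if A: "A \<in> subsets (Suc q) D" for A
  proof -
    have fA: "finite A" using A by (auto simp: subsets_def dest: finite_subset)
    have perm: "permutation \<sigma>" if "\<sigma> permutes A" for \<sigma> using that fA permutation_permutes by blast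
    show ?thesis unfolding Q2_def
    proof (rule sum_character_square)
      show "{\<sigma>. \<sigma> permutes A} \<subseteq> {\<sigma>. \<sigma> permutes {..<D}}" using subsets_permutes[OF A] by blast
      show "of_int (sign (\<sigma> \<circ> \<rho>)) = of_int (sign \<sigma>) * (of_int (sign \<rho>) :: rat)"
        if "\<sigma> \<in> {\<sigma>. \<sigma> permutes A}" "\<rho> \<in> {\<sigma>. \<sigma> permutes A}" for \<sigma> \<rho>
        using that perm by (simp add: sign_compose)
      show "of_int (sign \<sigma>) * (of_int (sign \<sigma>) :: rat) = 1" for \<sigma> :: "nat \<Rightarrow> nat"
        by (simp flip: of_int_mult)
    qed (use fA in \<open>auto intro: finite_permutations permutes_compose permutes_inv\<close>)
  qed
  have c1: "card (young D c) > 0" for c using id_young by (auto simp: card_gt_0_iff)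
  have c2: "card {\<sigma>. \<sigma> permutes A} > 0" if "A \<in> subsets (Suc q) D" for A
    using that permutes_id by (auto simp: card_gt_0_iff intro!: exI[of _ id])
  have p1: "0 \<le> Q1 c" for c
    using sum_nonneg[of ?P "\<lambda>\<pi>. (\<Sum>\<sigma>\<in>young D c. 1 * f (\<sigma> \<circ> \<pi>))\<^sup>2"] c1[of c]
    unfolding e1 by (auto simp: zero_le_mult_iff)
  have p2: "0 \<le> Q2 A" if "A \<in> subsets (Suc q) D" for A
    using sum_nonneg[of ?P "\<lambda>\<pi>. (\<Sum>\<sigma> | \<sigma> permutes A. of_int (sign \<sigma>) * f (\<sigma> \<circ> \<pi>))\<^sup>2"] c2[OF that]
    unfolding e2[OF that] by (auto simp: zero_le_mult_iff)
  have "0 = (\<Sum>\<pi>\<in>?P. f \<pi> * (\<Sum>\<sigma>\<in>?P. of_int (young_weight q D \<sigma>) * f (\<sigma> \<circ> \<pi>)))"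
    using f by simp
  also have "\<dots> = (\<Sum>c\<in>colourings D q. Q1 c) + (\<Sum>A\<in>subsets (Suc q) D. Q2 A)"
    unfolding sum_young_weight distrib_left sum.distrib sum_distrib_left Q1_def Q2_def
    by (subst (1 4) sum.swap) simp
  finally have s0: "(\<Sum>c\<in>colourings D q. Q1 c) + (\<Sum>A\<in>subsets (Suc q) D. Q2 A) = 0" by simp
  have n1: "0 \<le> (\<Sum>c\<in>colourings D q. Q1 c)" and n2: "0 \<le> (\<Sum>A\<in>subsets (Suc q) D. Q2 A)"
    using p1 p2 by (auto intro: sum_nonneg)
  have z1: "Q1 c = 0" if "c \<in> colourings D q" for c
    using s0 n1 n2 p1 that sum_nonneg_eq_0_iff[of "colourings D q" Q1] by simp
  have z2: "Q2 A = 0" if "A \<in> subsets (Suc q) D" for A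
    using s0 n1 n2 p2 that sum_nonneg_eq_0_iff[of "subsets (Suc q) D" Q2] by simp
  have "symmetrized q D f"
    unfolding symmetrized_def
  proof (intro ballI allI impI)
    fix c \<tau> assume c: "c \<in> colourings D q" and t: "\<tau> permutes {..<D}"
    have "(\<Sum>\<pi>\<in>?P. (\<Sum>\<sigma>\<in>young D c. 1 * f (\<sigma> \<circ> \<pi>))\<^sup>2) = 0" unfolding e1 z1[OF c] by simp
    then show "(\<Sum>\<sigma>\<in>young D c. f (\<sigma> \<circ> \<tau>)) = 0" using t by (subst (asm) sum_nonneg_eq_0_iff) auto
  qed
  moreover have "alternated q D f"
    unfolding alternated_def
  proof (intro ballI allI impI)
    fix A \<tau> assume A: "A \<in> subsets (Suc q) D" and t: "\<tau> permutes {..<D}"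
    have "(\<Sum>\<pi>\<in>?P. (\<Sum>\<sigma> | \<sigma> permutes A. of_int (sign \<sigma>) * f (\<sigma> \<circ> \<pi>))\<^sup>2) = 0" unfolding e2[OF A] z2[OF A] by simp
    then show "(\<Sum>\<sigma> | \<sigma> permutes A. of_int (sign \<sigma>) * f (\<sigma> \<circ> \<tau>)) = 0"
      using t by (subst (asm) sum_nonneg_eq_0_iff) auto
  qed
  ultimately show ?thesis using alternated_symmetrized_zero \<tau> by blast
qed

text \<open>\<open>young_weight\<close> is injective, hence invertible in Q[S_D], and
  \<open>w\<close> holds the coefficients of the inverse. The identity permutation thus lies in the
  left ideal generated by symmetrizers and alternators; \<open>g\<close> is an arbitrary linear
  functional that evaluates this relation in the field.\<close>

lemma group_algebra_unit:
  "\<exists>w::(nat \<Rightarrow> nat) \<Rightarrow> rat. \<forall>g::(nat \<Rightarrow> nat) \<Rightarrow> 'a::field_char_0.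
     (\<Sum>\<tau> | \<tau> permutes {..<D}. of_rat (w \<tau>) *
       ((\<Sum>c\<in>colourings D q. \<Sum>\<sigma>\<in>young D c. g (\<tau> \<circ> \<sigma>)) +
        (\<Sum>A\<in>subsets (Suc q) D. \<Sum>\<sigma> | \<sigma> permutes A. of_int (sign \<sigma>) * g (\<tau> \<circ> \<sigma>)))) = g id"
proof -
  let ?P = "{\<sigma>. \<sigma> permutes {..<D}}"
  let ?Z = "young_weight q D"
  have shift: "(\<Sum>\<tau>\<in>?P. of_int (?Z (\<tau> \<circ> pinv \<pi>)) * f \<tau>) = (\<Sum>\<sigma>\<in>?P. of_int (?Z \<sigma>) * f (\<sigma> \<circ> \<pi>))"
    if p: "\<pi> permutes {..<D}" for \<pi> and f :: "(nat \<Rightarrow> nat) \<Rightarrow> rat"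
    using sum_perms_compose_right[OF _ p, of "\<lambda>\<tau>. of_int (?Z (\<tau> \<circ> pinv \<pi>)) * f \<tau>"]
    by (simp add: o_assoc[symmetric] permutes_inv_o[OF p])
  have "\<exists>f. \<forall>\<pi>\<in>?P. (\<Sum>\<tau>\<in>?P. of_int (?Z (\<tau> \<circ> pinv \<pi>)) * f \<tau>) = (if \<pi> = id then 1 else 0 :: rat)"
  proof (rule solvable_if_trivial_kernel)
    fix f :: "(nat \<Rightarrow> nat) \<Rightarrow> rat"
    assume "\<forall>\<pi>\<in>?P. (\<Sum>\<tau>\<in>?P. of_int (?Z (\<tau> \<circ> pinv \<pi>)) * f \<tau>) = 0"
    then have "(\<Sum>\<sigma>\<in>?P. of_int (?Z \<sigma>) * f (\<sigma> \<circ> \<pi>)) = 0" if "\<pi> permutes {..<D}" for \<pi>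
      using shift[OF that, of f] that by simp
    then show "\<forall>\<pi>\<in>?P. f \<pi> = 0" using young_weight_kernel by blast
  qed simp
  then obtain w0 :: "(nat \<Rightarrow> nat) \<Rightarrow> rat" where w0: "\<And>\<pi>. \<pi> permutes {..<D} \<Longrightarrow>
      (\<Sum>\<sigma>\<in>?P. of_int (?Z \<sigma>) * w0 (\<sigma> \<circ> \<pi>)) = (if \<pi> = id then 1 else 0)"
    using shift by auto
  \<comment> \<open>The solved system yields products with the weight on the left; passing to
    inverses of permutations produces a factor that stands on the left of the weight.\<close>
  define w where "w \<tau> = w0 (pinv \<tau>)" for \<tau>
  have "(\<Sum>\<tau>\<in>?P. of_rat (w \<tau>) * ((\<Sum>c\<in>colourings D q. \<Sum>\<sigma>\<in>young D c. g (\<tau> \<circ> \<sigma>)) +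
        (\<Sum>A\<in>subsets (Suc q) D. \<Sum>\<sigma> | \<sigma> permutes A. of_int (sign \<sigma>) * g (\<tau> \<circ> \<sigma>)))) = g id"
    for g :: "(nat \<Rightarrow> nat) \<Rightarrow> 'a"
  proof -
    have "(\<Sum>\<tau>\<in>?P. of_rat (w \<tau>) * ((\<Sum>c\<in>colourings D q. \<Sum>\<sigma>\<in>young D c. g (\<tau> \<circ> \<sigma>)) +
        (\<Sum>A\<in>subsets (Suc q) D. \<Sum>\<sigma> | \<sigma> permutes A. of_int (sign \<sigma>) * g (\<tau> \<circ> \<sigma>)))) =
      (\<Sum>\<tau>\<in>?P. of_rat (w \<tau>) * (\<Sum>\<sigma>\<in>?P. of_int (?Z \<sigma>) * g (\<tau> \<circ> \<sigma>)))"
      by (simp add: sum_young_weight)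
    also have "\<dots> = (\<Sum>\<sigma>\<in>?P. \<Sum>\<tau>\<in>?P. of_int (?Z \<sigma>) * of_rat (w \<tau>) * g (\<tau> \<circ> \<sigma>))"
      unfolding sum_distrib_left by (subst sum.swap) (simp add: ac_simps)
    also have "\<dots> = (\<Sum>\<sigma>\<in>?P. \<Sum>\<pi>\<in>?P. of_int (?Z \<sigma>) * of_rat (w0 (\<sigma> \<circ> pinv \<pi>)) * g \<pi>)"
    proof (rule sum.cong[OF refl])
      fix \<sigma> assume "\<sigma> \<in> ?P"
      then have s: "\<sigma> permutes {..<D}" by simp
      have "(\<Sum>\<pi>\<in>?P. of_int (?Z \<sigma>) * of_rat (w0 (\<sigma> \<circ> pinv \<pi>)) * g \<pi>) =
        (\<Sum>\<tau>\<in>?P. of_int (?Z \<sigma>) * of_rat (w0 (\<sigma> \<circ> pinv (\<tau> \<circ> \<sigma>))) * g (\<tau> \<circ> \<sigma>))"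
        by (rule sum_perms_compose_right[OF _ s, of "\<lambda>\<pi>. of_int (?Z \<sigma>) * of_rat (w0 (\<sigma> \<circ> pinv \<pi>)) * g \<pi>", symmetric]) simp
      also have "\<dots> = (\<Sum>\<tau>\<in>?P. of_int (?Z \<sigma>) * of_rat (w \<tau>) * g (\<tau> \<circ> \<sigma>))"
      proof (rule sum.cong[OF refl])
        fix \<tau> assume "\<tau> \<in> ?P"
        then have "pinv (\<tau> \<circ> \<sigma>) = pinv \<sigma> \<circ> pinv \<tau>" using s permutes_bij by (intro o_inv_distrib) auto
        then have "\<sigma> \<circ> pinv (\<tau> \<circ> \<sigma>) = pinv \<tau>" by (simp add: o_assoc permutes_inv_o[OF s])
        then show "of_int (?Z \<sigma>) * of_rat (w0 (\<sigma> \<circ> pinv (\<tau> \<circ> \<sigma>))) * g (\<tau> \<circ> \<sigma>) = of_int (?Z \<sigma>) * of_rat (w \<tau>) * g (\<tau> \<circ> \<sigma>)"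
          by (simp add: w_def)
      qed
      finally show "(\<Sum>\<tau>\<in>?P. of_int (?Z \<sigma>) * of_rat (w \<tau>) * g (\<tau> \<circ> \<sigma>)) =
         (\<Sum>\<pi>\<in>?P. of_int (?Z \<sigma>) * of_rat (w0 (\<sigma> \<circ> pinv \<pi>)) * g \<pi>)" by simp
    qed
    also have "\<dots> = (\<Sum>\<pi>\<in>?P. of_rat (\<Sum>\<sigma>\<in>?P. of_int (?Z \<sigma>) * w0 (\<sigma> \<circ> pinv \<pi>)) * g \<pi>)"
      by (subst sum.swap) (simp add: of_rat_sum of_rat_mult sum_distrib_right)
    also have "\<dots> = (\<Sum>\<pi>\<in>?P. if \<pi> = id then g \<pi> else 0)"
    proof (rule sum.cong[OF refl])
      fix \<pi> assume "\<pi> \<in> ?P"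
      then have p: "\<pi> permutes {..<D}" by simp
      have "pinv \<pi> = id \<longleftrightarrow> \<pi> = id" using permutes_inv_inv[OF p] by (metis inv_id)
      then show "of_rat (\<Sum>\<sigma>\<in>?P. of_int (?Z \<sigma>) * w0 (\<sigma> \<circ> pinv \<pi>)) * g \<pi> = (if \<pi> = id then g \<pi> else 0)"
        by (simp add: w0[OF permutes_inv[OF p]])
    qed
    also have "\<dots> = g id" by (simp add: permutes_id)
    finally show ?thesis .
  qed
  then show ?thesis by blast
qed

section \<open>Factoring the identity through fewer letters\<close>

lemma sum_Pow_alternating:
  assumes "finite A"
  shows "(\<Sum>S\<in>Pow A. (-1) ^ card S) = (if A = {} then 1 else 0 :: 'a::comm_ring_1)"
  using assms
proof (induction A rule: finite_induct)
  case (insert a A)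
  have "(\<Sum>S\<in>Pow (insert a A). (-1) ^ card S) =
     (\<Sum>S\<in>Pow A. (-1) ^ card S) + (\<Sum>S\<in>insert a ` Pow A. (-1 :: 'a) ^ card S)"
    unfolding Pow_insert using insert by (intro sum.union_disjoint) auto
  also have "(\<Sum>S\<in>insert a ` Pow A. (-1 :: 'a) ^ card S) = (\<Sum>S\<in>Pow A. (-1) ^ card (insert a S))"
    using insert by (intro sum.reindex_cong[OF _ refl]) (auto simp: inj_on_def)
  also have "\<dots> = (\<Sum>S\<in>Pow A. - ((-1) ^ card S))"
  proof (rule sum.cong[OF refl])
    fix S assume "S \<in> Pow A"
    then have "finite S" "a \<notin> S" using insert finite_subset by auto
    then show "(-1) ^ card (insert a S) = - ((-1 :: 'a) ^ card S)" by simp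
  qed
  finally show ?case by (simp add: sum_negf)
qed simp

text \<open>Moebius inversion in the lattice of subsets of \<open>U\<close>, by
  complementation.\<close>

lemma sum_supersets_alternating:
  assumes U: "finite U" and B: "B \<subseteq> U"
  shows "(\<Sum>T\<in>Pow U. if B \<subseteq> T then (-1) ^ (card U - card T) else 0) = (if B = U then 1 else 0 :: 'a::comm_ring_1)"
proof -
  have "(\<Sum>T\<in>Pow U. if B \<subseteq> T then (-1) ^ (card U - card T) else 0 :: 'a) =
    (\<Sum>T\<in>{T\<in>Pow U. B \<subseteq> T}. (-1) ^ (card U - card T))"
    using U by (subst sum.inter_filter) auto
  also have "\<dots> = (\<Sum>S\<in>Pow (U - B). (-1) ^ card S)"
    by (rule sum.reindex_bij_witness[of _ "\<lambda>S. U - S" "\<lambda>T. U - T"])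
      (use U B in \<open>auto simp: card_Diff_subset rev_finite_subset[OF U] double_diff\<close>)
  also have "\<dots> = (if B = U then 1 else 0)" using U B by (subst sum_Pow_alternating) auto
  finally show ?thesis .
qed

lemma sum_surjective_PiE:
  assumes "finite U"
  shows "(\<Sum>g\<in>U \<rightarrow>\<^sub>E U. if g ` U = U then h (\<lambda>s. if s \<in> U then g s else s) else 0) = (\<Sum>\<pi> | \<pi> permutes U. h \<pi>)"
proof -
  have "(\<Sum>g\<in>U \<rightarrow>\<^sub>E U. if g ` U = U then h (\<lambda>s. if s \<in> U then g s else s) else 0) =
    (\<Sum>g\<in>{g\<in>U \<rightarrow>\<^sub>E U. g ` U = U}. h (\<lambda>s. if s \<in> U then g s else s))"
    using assms by (simp add: sum.inter_filter finite_PiE)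
  also have "\<dots> = (\<Sum>\<pi> | \<pi> permutes U. h \<pi>)"
  proof (rule sum.reindex_bij_witness[of _ "\<lambda>\<pi>. restrict \<pi> U" "\<lambda>g s. if s \<in> U then g s else s"])
    fix g assume "g \<in> {g\<in>U \<rightarrow>\<^sub>E U. g ` U = U}"
    then have g: "g \<in> U \<rightarrow>\<^sub>E U" "g ` U = U" by auto
    show "restrict (\<lambda>s. if s \<in> U then g s else s) U = g" using PiE_arb[OF g(1)] by (auto simp: fun_eq_iff)
    have "inj_on g U" using g assms by (simp add: eq_card_imp_inj_on)
    then have "bij_betw (\<lambda>s. if s \<in> U then g s else s) U U"
      using g by (auto simp: bij_betw_def inj_on_def)
    then show "(\<lambda>s. if s \<in> U then g s else s) \<in> {\<pi>. \<pi> permutes U}"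
      by (auto intro: bij_imp_permutes)
  next
    fix \<pi> assume "\<pi> \<in> {\<pi>. \<pi> permutes U}"
    then have p: "\<pi> permutes U" by simp
    show "(\<lambda>s. if s \<in> U then restrict \<pi> U s else s) = \<pi>" using p by (auto simp: fun_eq_iff permutes_not_in)
    show "restrict \<pi> U \<in> {g\<in>U \<rightarrow>\<^sub>E U. g ` U = U}" using p by (auto simp: permutes_in_image permutes_image)
  qed auto
  finally show ?thesis .
qed

text \<open>Expand the product over maps from \<open>U\<close> into \<open>T\<close>. A map with
  image \<open>B\<close> is counted once for every \<open>T\<close> above \<open>B\<close>, so the
  signs leave only surjective maps, which are the permutations.\<close>

lemma ryser:
  fixes F :: "'b \<Rightarrow> 'b \<Rightarrow> 'a::comm_ring_1"
  assumes U: "finite U"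
  shows "(\<Sum>T\<in>Pow U. (-1) ^ (card U - card T) * (\<Prod>s\<in>U. \<Sum>u\<in>T. F s u)) =
    (\<Sum>\<pi> | \<pi> permutes U. \<Prod>s\<in>U. F s (\<pi> s))"
proof -
  have "(\<Sum>T\<in>Pow U. (-1) ^ (card U - card T) * (\<Prod>s\<in>U. \<Sum>u\<in>T. F s u)) =
    (\<Sum>T\<in>Pow U. \<Sum>g\<in>U \<rightarrow>\<^sub>E U. (if g ` U \<subseteq> T then (-1) ^ (card U - card T) else 0) * (\<Prod>s\<in>U. F s (g s)))"
  proof (rule sum.cong[OF refl])
    fix T assume T: "T \<in> Pow U"
    then have "finite T" using U finite_subset by blast
    then have "(\<Prod>s\<in>U. \<Sum>u\<in>T. F s u) = (\<Sum>g\<in>U \<rightarrow>\<^sub>E T. \<Prod>s\<in>U. F s (g s))"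
      using U by (intro prod_sum_PiE) auto
    also have "\<dots> = (\<Sum>g\<in>U \<rightarrow>\<^sub>E U. if g ` U \<subseteq> T then \<Prod>s\<in>U. F s (g s) else 0)"
      using T U by (intro sum.mono_neutral_cong_left) (auto simp: finite_PiE PiE_iff)
    finally show "(-1) ^ (card U - card T) * (\<Prod>s\<in>U. \<Sum>u\<in>T. F s u) =
      (\<Sum>g\<in>U \<rightarrow>\<^sub>E U. (if g ` U \<subseteq> T then (-1) ^ (card U - card T) else 0) * (\<Prod>s\<in>U. F s (g s)))"
      by (auto simp: sum_distrib_left intro!: sum.cong)
  qed
  also have "\<dots> = (\<Sum>g\<in>U \<rightarrow>\<^sub>E U. if g ` U = U then \<Prod>s\<in>U. F s (g s) else 0)"
    unfolding sum.swap[of _ "U \<rightarrow>\<^sub>E U"] sum_distrib_right[symmetric]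
    using U by (intro sum.cong refl, subst sum_supersets_alternating) auto
  also have "\<dots> = (\<Sum>g\<in>U \<rightarrow>\<^sub>E U. if g ` U = U then \<Prod>s\<in>U. F s (if s \<in> U then g s else s) else 0)"
    by (auto intro!: sum.cong prod.cong)
  also have "\<dots> = (\<Sum>\<pi> | \<pi> permutes U. \<Prod>s\<in>U. F s (\<pi> s))"
    by (rule sum_surjective_PiE[OF U, of "\<lambda>\<pi>. \<Prod>s\<in>U. F s (\<pi> s)"])
  finally show ?thesis .
qed

text \<open>The entry of the D-th tensor power of \<open>M\<close> in the row of the word
  \<open>\<omega>\<close> and the column of \<open>\<omega>'\<close>. Words are total functions of
  which only the first D letters matter.\<close>

definition tens :: "nat \<Rightarrow> (nat \<Rightarrow> nat \<Rightarrow> 'a::comm_ring_1) \<Rightarrow> (nat \<Rightarrow> nat) \<Rightarrow> (nat \<Rightarrow> nat) \<Rightarrow> 'a" where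
  "tens D M \<omega> \<omega>' = (\<Prod>s<D. M (\<omega> s) (\<omega>' s))"

lemma prod_indicator: "finite S \<Longrightarrow> (\<Prod>s\<in>S. if P s then 1 else 0) = (if \<forall>s\<in>S. P s then 1 else 0 :: 'a::comm_ring_1)"
  by (induction S rule: finite_induct) auto

text \<open>The row word uses fewer than \<open>card A\<close> different letters, so for every
  bijection between positions and \<open>U\<close> two elements of \<open>A\<close> meet equal row
  letters. Exchanging them changes the sign and nothing else. The set \<open>U\<close> of auxiliary
  letters is kept abstract because it will also be the letter set of a monomial.\<close>

lemma alternator_kills_few_rows:
  fixes B E :: "nat \<Rightarrow> nat \<Rightarrow> 'a::comm_ring_1"
  assumes two: "\<And>x::'a. x + x = 0 \<Longrightarrow> x = 0"
    and U: "finite U" "card U = D" and A: "A \<subseteq> U" "q < card A" and \<omega>: "\<And>s. s < D \<Longrightarrow> \<omega> s < q"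
  shows "(\<Sum>T\<in>Pow U. \<Sum>\<sigma> | \<sigma> permutes A. (-1) ^ (D - card T) * of_int (sign \<sigma>) *
     tens D (\<lambda>i l. \<Sum>u\<in>T. B i u * E (\<sigma> u) l) \<omega> \<omega>') = 0"
proof -
  have fA: "finite A" using A U finite_subset by blast
  obtain e where e: "bij_betw e U {..<D}"
    using U by (metis card_lessThan finite_lessThan finite_same_card_bij)
  have eD: "e v < D" if "v \<in> U" for v using e that by (auto dest: bij_betwE)
  have perm: "\<sigma> permutes U" if "\<sigma> permutes A" for \<sigma> using that A permutes_subset by blast
  let ?P = "\<lambda>X. {\<sigma>. \<sigma> permutes X}"
  let ?b = "\<lambda>\<pi>. \<Prod>v\<in>U. B (\<omega> (e v)) (\<pi> v)" and ?e = "\<lambda>\<pi>. \<Prod>v\<in>U. E (\<pi> v) (\<omega>' (e v))"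
  have inner: "(\<Sum>\<sigma>\<in>?P A. of_int (sign \<sigma>) * ?b (\<sigma> \<circ> \<rho>)) = 0" (is "?S = 0") if \<rho>: "\<rho> permutes U" for \<rho>
  proof -
    have "\<not> inj_on (\<lambda>a. \<omega> (e (pinv \<rho> a))) A"
    proof
      assume "inj_on (\<lambda>a. \<omega> (e (pinv \<rho> a))) A"
      moreover have "(\<lambda>a. \<omega> (e (pinv \<rho> a))) ` A \<subseteq> {..<q}"
        using \<omega> eD permutes_in_image[OF permutes_inv[OF \<rho>]] A by auto
      ultimately have "card A \<le> q" by (metis card_inj_on_le card_lessThan finite_lessThan)
      with A show False by simp
    qed
    then obtain a a' where a: "a \<in> A" "a' \<in> A" "a \<noteq> a'" "\<omega> (e (pinv \<rho> a)) = \<omega> (e (pinv \<rho> a'))"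
      by (auto simp: inj_on_def)
    let ?t = "transpose a a'"
    have t: "?t permutes A" using a by (simp add: permutes_swap_id)
    define v v' where "v = pinv \<rho> a" and "v' = pinv \<rho> a'"
    have v: "\<rho> v = a" "\<rho> v' = a'" using permutes_inverses(1)[OF \<rho>] by (auto simp: v_def v'_def)
    have vU: "v \<in> U" "v' \<in> U" using v a A permutes_in_image[OF \<rho>] by auto
    \<comment> \<open>Exchanging the values \<open>a\<close> and \<open>a'\<close> amounts to
      exchanging the places \<open>v\<close> and \<open>v'\<close>, and these carry the same row
      letter.\<close>
    have flip: "?b (\<sigma> \<circ> ?t \<circ> \<rho>) = ?b (\<sigma> \<circ> \<rho>)" for \<sigma>
    proof -
      have tp: "transpose v v' permutes U" using vU by (simp add: permutes_swap_id)
      have "?t (\<rho> x) = \<rho> (transpose v v' x)" for x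
        using v permutes_inj[OF \<rho>] by (auto simp: transpose_def inj_eq)
      then have "?b (\<sigma> \<circ> ?t \<circ> \<rho>) = (\<Prod>x\<in>U. B (\<omega> (e x)) (\<sigma> (\<rho> (transpose v v' x))))" by simp
      also have "\<dots> = (\<Prod>x\<in>U. B (\<omega> (e (transpose v v' x))) (\<sigma> (\<rho> (transpose v v' x))))"
        using a(4) by (intro prod.cong refl) (auto simp: transpose_def v_def v'_def)
      also have "\<dots> = ?b (\<sigma> \<circ> \<rho>)"
        using prod.permute[OF tp, of "\<lambda>x. B (\<omega> (e x)) (\<sigma> (\<rho> x))"] by (simp add: o_def)
      finally show ?thesis .
    qed
    have "?S = (\<Sum>\<sigma>\<in>?P A. of_int (sign (\<sigma> \<circ> ?t)) * ?b (\<sigma> \<circ> ?t \<circ> \<rho>))"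
      by (rule sum_perms_compose_right[OF fA t, of "\<lambda>\<sigma>. of_int (sign \<sigma>) * ?b (\<sigma> \<circ> \<rho>)", symmetric])
    also have "\<dots> = - ?S"
      unfolding sum_negf[symmetric]
    proof (rule sum.cong[OF refl])
      fix \<sigma> assume "\<sigma> \<in> ?P A"
      then have "permutation \<sigma>" using fA permutation_permutes by blast
      then have "sign (\<sigma> \<circ> ?t) = - sign \<sigma>" using a(3) by (simp add: sign_compose permutation_swap_id sign_swap_id)
      then show "of_int (sign (\<sigma> \<circ> ?t)) * ?b (\<sigma> \<circ> ?t \<circ> \<rho>) = - (of_int (sign \<sigma>) * ?b (\<sigma> \<circ> \<rho>))"
        unfolding flip by simp
    qed
    finally have "?S + ?S = 0" by simp
    then show ?thesis by (rule two)
  qed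
  have "(\<Sum>T\<in>Pow U. \<Sum>\<sigma>\<in>?P A. (-1) ^ (D - card T) * of_int (sign \<sigma>) *
       tens D (\<lambda>i l. \<Sum>u\<in>T. B i u * E (\<sigma> u) l) \<omega> \<omega>') =
     (\<Sum>\<sigma>\<in>?P A. of_int (sign \<sigma>) * (\<Sum>T\<in>Pow U. (-1) ^ (card U - card T) *
       (\<Prod>v\<in>U. \<Sum>u\<in>T. B (\<omega> (e v)) u * E (\<sigma> u) (\<omega>' (e v)))))"
    unfolding tens_def using prod.reindex_bij_betw[OF e, symmetric, where 'a = 'a]
    by (subst sum.swap) (simp add: sum_distrib_left U(2) ac_simps)
  also have "\<dots> = (\<Sum>\<sigma>\<in>?P A. of_int (sign \<sigma>) * (\<Sum>\<pi>\<in>?P U. ?b \<pi> * ?e (\<sigma> \<circ> \<pi>)))"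
    unfolding ryser[OF U(1)] by (simp add: prod.distrib)
  \<comment> \<open>The substitution \<open>\<rho> = \<sigma> \<circ> \<pi>\<close> moves the
    alternation from the factor \<open>E\<close> to the factor \<open>B\<close>, where few rows are
    available.\<close>
  also have "\<dots> = (\<Sum>\<sigma>\<in>?P A. of_int (sign \<sigma>) * (\<Sum>\<rho>\<in>?P U. ?b (pinv \<sigma> \<circ> \<rho>) * ?e \<rho>))"
  proof (rule sum.cong[OF refl])
    fix \<sigma> assume "\<sigma> \<in> ?P A"
    then have s: "\<sigma> permutes U" using perm by simp
    have "(\<Sum>\<rho>\<in>?P U. ?b (pinv \<sigma> \<circ> \<rho>) * ?e \<rho>) = (\<Sum>\<pi>\<in>?P U. ?b (pinv \<sigma> \<circ> (\<sigma> \<circ> \<pi>)) * ?e (\<sigma> \<circ> \<pi>))"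
      by (rule sum_perms_compose_left[OF U(1) s, of "\<lambda>\<rho>. ?b (pinv \<sigma> \<circ> \<rho>) * ?e \<rho>", symmetric])
    then show "of_int (sign \<sigma>) * (\<Sum>\<pi>\<in>?P U. ?b \<pi> * ?e (\<sigma> \<circ> \<pi>)) =
      of_int (sign \<sigma>) * (\<Sum>\<rho>\<in>?P U. ?b (pinv \<sigma> \<circ> \<rho>) * ?e \<rho>)"
      by (simp add: permutes_inverses[OF s])
  qed
  also have "\<dots> = (\<Sum>\<rho>\<in>?P U. (\<Sum>\<sigma>\<in>?P A. of_int (sign \<sigma>) * ?b (pinv \<sigma> \<circ> \<rho>)) * ?e \<rho>)"
    unfolding sum_distrib_left sum_distrib_right by (subst sum.swap) (simp add: ac_simps)
  also have "\<dots> = (\<Sum>\<rho>\<in>?P U. (\<Sum>\<sigma>\<in>?P A. of_int (sign \<sigma>) * ?b (\<sigma> \<circ> \<rho>)) * ?e \<rho>)"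
  proof -
    have "(\<Sum>\<sigma>\<in>?P A. of_int (sign \<sigma>) * ?b (pinv \<sigma> \<circ> \<rho>)) = (\<Sum>\<sigma>\<in>?P A. of_int (sign \<sigma>) * ?b (\<sigma> \<circ> \<rho>))" for \<rho>
    proof -
      have "(\<Sum>\<sigma>\<in>?P A. of_int (sign \<sigma>) * ?b (\<sigma> \<circ> \<rho>)) = (\<Sum>\<sigma>\<in>?P A. of_int (sign (pinv \<sigma>)) * ?b (pinv \<sigma> \<circ> \<rho>))"
        by (rule sum_permutations_inverse)
      also have "\<dots> = (\<Sum>\<sigma>\<in>?P A. of_int (sign \<sigma>) * ?b (pinv \<sigma> \<circ> \<rho>))"
      proof (rule sum.cong[OF refl])
        fix \<sigma> assume "\<sigma> \<in> ?P A"
        then have "permutation \<sigma>" using fA permutation_permutes by blast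
        then show "of_int (sign (pinv \<sigma>)) * ?b (pinv \<sigma> \<circ> \<rho>) = of_int (sign \<sigma>) * ?b (pinv \<sigma> \<circ> \<rho>)"
          by (simp only: sign_inverse)
      qed
      finally show ?thesis by (rule sym)
    qed
    then show ?thesis by (simp only:)
  qed
  also have "\<dots> = 0" using inner by (intro sum.neutral) auto
  finally show ?thesis .
qed

text \<open>The matrix of the permutation \<open>\<sigma>\<close>, restricted to the letters in \<open>T\<close>. By Ryser's formula the
  alternating sum over all \<open>T\<close> projects to the multilinear part.\<close>

definition pmat :: "nat \<Rightarrow> nat set \<Rightarrow> (nat \<Rightarrow> nat) \<Rightarrow> 'k::comm_ring_1 mat" where
  "pmat D T \<sigma> = mat D D (\<lambda>(u, v). if u \<in> T \<and> v = \<sigma> u then 1 else 0)"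

lemma pmat_carrier [simp]: "pmat D T \<sigma> \<in> carrier_mat D D"
  by (simp add: pmat_def)

lemma pmat_mult_left:
  assumes E': "E' \<in> carrier_mat D p" and \<sigma>: "\<sigma> permutes {..<D}" and u: "u < D" and l: "l < p"
  shows "(pmat D T \<sigma> * E') $$ (u, l) = (if u \<in> T then E' $$ (\<sigma> u, l) else 0)"
proof -
  have s: "\<sigma> u < D" using permutes_in_image[OF \<sigma>, of u] u by simp
  have "(pmat D T \<sigma> * E') $$ (u, l) = (\<Sum>v = 0..<D. (if u \<in> T \<and> v = \<sigma> u then 1 else 0) * E' $$ (v, l))"
    using E' l u by (simp add: pmat_def scalar_prod_def)
  also have "\<dots> = (\<Sum>v = 0..<D. if v = \<sigma> u then (if u \<in> T then E' $$ (v, l) else 0) else 0)"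
    by (intro sum.cong) auto
  also have "\<dots> = (if u \<in> T then E' $$ (\<sigma> u, l) else 0)" using s by simp
  finally show ?thesis .
qed

lemma pmat_mult_index:
  assumes E: "E \<in> carrier_mat p D" and E': "E' \<in> carrier_mat D p'" and T: "T \<subseteq> {..<D}" and \<sigma>: "\<sigma> permutes {..<D}"
    and i: "i < p" and l: "l < p'"
  shows "(E * (pmat D T \<sigma> * E')) $$ (i, l) = (\<Sum>u\<in>T. E $$ (i, u) * E' $$ (\<sigma> u, l))"
proof -
  have "(E * (pmat D T \<sigma> * E')) $$ (i, l) = (\<Sum>u = 0..<D. E $$ (i, u) * (pmat D T \<sigma> * E') $$ (u, l))"
    using E E' i l by (simp add: scalar_prod_def pmat_def)
  also have "\<dots> = (\<Sum>u = 0..<D. if u \<in> T then E $$ (i, u) * E' $$ (\<sigma> u, l) else 0)"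
    by (intro sum.cong refl) (simp add: pmat_mult_left[OF E' \<sigma> _ l] del: index_mult_mat)
  also have "\<dots> = (\<Sum>u\<in>T. E $$ (i, u) * E' $$ (\<sigma> u, l))"
    by (rule sum.mono_neutral_cong_right) (use T in auto)
  finally show ?thesis .
qed

text \<open>Exactly one \<open>b\<close> satisfies \<open>b \<circ> \<pi> = \<omega>\<close> on the
  first D positions. Summing over all \<open>b\<close> therefore resolves the identity of the space
  of words, once for each \<open>\<pi>\<close>.\<close>

lemma sum_colourings_word:
  assumes \<pi>: "\<pi> permutes {..<D}" and \<omega>: "\<And>s. s < D \<Longrightarrow> \<omega> s < p"
  shows "(\<Sum>b\<in>colourings D p. \<Prod>s<D. (if b (\<pi> s) = \<omega> s then 1 else 0) * (if b (\<pi> s) = \<omega>' s then 1 else 0)) =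
    (if \<forall>s<D. \<omega> s = \<omega>' s then 1 else 0 :: 'a::comm_ring_1)"
proof -
  define b0 where "b0 = restrict (\<lambda>v. \<omega> (pinv \<pi> v)) {..<D}"
  have piD: "\<pi> s < D" "pinv \<pi> s < D" if "s < D" for s
    using permutes_in_image[OF \<pi>, of s] permutes_in_image[OF permutes_inv[OF \<pi>], of s] that by auto
  have b0: "b0 \<in> colourings D p" using \<omega> piD by (auto simp: colourings_def b0_def)
  have b0_iff: "b = b0" if "b \<in> colourings D p" "\<forall>s<D. b (\<pi> s) = \<omega> s" for b
  proof
    fix v
    show "b v = b0 v"
    proof (cases "v < D")
      case True
      then have "b (\<pi> (pinv \<pi> v)) = \<omega> (pinv \<pi> v)" using that piD by simp
      then show ?thesis using True permutes_inverses(1)[OF \<pi>] by (simp add: b0_def)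
    next
      case False
      then show ?thesis using PiE_arb[OF that(1)[unfolded colourings_def], of v] by (simp add: b0_def)
    qed
  qed
  have b0_val: "b0 (\<pi> s) = \<omega> s" if "s < D" for s
    using that piD permutes_inverses(2)[OF \<pi>] by (simp add: b0_def)
  have "(\<Sum>b\<in>colourings D p. \<Prod>s<D. (if b (\<pi> s) = \<omega> s then 1 else 0) * (if b (\<pi> s) = \<omega>' s then 1 else 0)) =
    (\<Sum>b\<in>colourings D p. if b = b0 then (if \<forall>s<D. \<omega> s = \<omega>' s then 1 else 0) else 0 :: 'a)"
  proof (rule sum.cong[OF refl])
    fix b assume b: "b \<in> colourings D p"
    have "(\<Prod>s<D. (if b (\<pi> s) = \<omega> s then 1 else 0) * (if b (\<pi> s) = \<omega>' s then 1 else 0 :: 'a)) =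
      (\<Prod>s<D. if b (\<pi> s) = \<omega> s \<and> b (\<pi> s) = \<omega>' s then 1 else 0)"
      by (intro prod.cong) auto
    also have "\<dots> = (if \<forall>s\<in>{..<D}. b (\<pi> s) = \<omega> s \<and> b (\<pi> s) = \<omega>' s then 1 else 0)"
      by (rule prod_indicator) simp
    also have "\<dots> = (if b = b0 then (if \<forall>s<D. \<omega> s = \<omega>' s then 1 else 0) else 0)"
      using b0_iff[OF b] b0_val by (cases "b = b0") auto
    finally show "(\<Prod>s<D. (if b (\<pi> s) = \<omega> s then 1 else 0) * (if b (\<pi> s) = \<omega>' s then 1 else 0 :: 'a)) =
      (if b = b0 then (if \<forall>s<D. \<omega> s = \<omega>' s then 1 else 0) else 0)" .
  qed
  also have "\<dots> = (if \<forall>s<D. \<omega> s = \<omega>' s then 1 else 0)" using b0 by simp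
  finally show ?thesis .
qed

section \<open>Symmetrizers as polarised tensor powers\<close>

abbreviation ent :: "'a mat \<Rightarrow> nat \<Rightarrow> nat \<Rightarrow> 'a" where
  "ent M \<equiv> \<lambda>i j. M $$ (i, j)"

text \<open>The matrix of \<open>b\<close>, cut down to the letters in \<open>T\<close>, times the
  transposed matrix of the colouring \<open>c\<close>. Together with \<open>rmat\<close> it factors
  a map through \<open>k^q\<close>, with the matrix of the relation \<open>c u = c v\<close> in the
  middle.\<close>

definition lmat :: "nat \<Rightarrow> nat \<Rightarrow> (nat \<Rightarrow> nat) \<Rightarrow> (nat \<Rightarrow> nat) \<Rightarrow> nat set \<Rightarrow> 'k::comm_ring_1 mat" where
  "lmat p q b c T = mat p q (\<lambda>(i, l). \<Sum>u\<in>T. if b u = i \<and> c u = l then 1 else 0)"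

definition rmat :: "nat \<Rightarrow> nat \<Rightarrow> (nat \<Rightarrow> nat) \<Rightarrow> (nat \<Rightarrow> nat) \<Rightarrow> (nat \<Rightarrow> nat) \<Rightarrow> nat set \<Rightarrow> 'k::comm_ring_1 mat" where
  "rmat q p b c \<tau> T = mat q p (\<lambda>(l, i). \<Sum>v\<in>T. if c v = l \<and> b (\<tau> v) = i then 1 else 0)"

definition fmat :: "nat \<Rightarrow> nat \<Rightarrow> (nat \<Rightarrow> nat) \<Rightarrow> 'k::comm_ring_1 mat" where
  "fmat p D b = mat p D (\<lambda>(i, u). if b u = i then 1 else 0)"

definition fmat' :: "nat \<Rightarrow> nat \<Rightarrow> (nat \<Rightarrow> nat) \<Rightarrow> 'k::comm_ring_1 mat" where
  "fmat' p D b = mat D p (\<lambda>(u, i). if b u = i then 1 else 0)"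

text \<open>Equal to 1 if \<open>\<omega>\<close> is \<open>b \<circ> \<pi>\<close> and
  \<open>\<omega>'\<close> is \<open>b \<circ> \<rho> \<circ> \<pi>\<close> on the first D
  positions, otherwise 0. Summed over \<open>b\<close>, it is an entry of the operator by which a
  permutation acts on tensors.\<close>

definition match :: "nat \<Rightarrow> (nat \<Rightarrow> nat) \<Rightarrow> (nat \<Rightarrow> nat) \<Rightarrow> (nat \<Rightarrow> nat) \<Rightarrow> (nat \<Rightarrow> nat) \<Rightarrow> (nat \<Rightarrow> nat) \<Rightarrow> 'a::comm_ring_1" where
  "match D \<omega> \<omega>' b \<pi> \<rho> = (\<Prod>s<D. (if b (\<pi> s) = \<omega> s then 1 else 0) * (if b (\<rho> (\<pi> s)) = \<omega>' s then 1 else 0))"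

lemma lmat_rmat_index:
  assumes c: "c \<in> colourings D q" and T: "T \<subseteq> {..<D}" "T' \<subseteq> {..<D}" and i: "i < p" "i' < p"
  shows "(lmat p q b c T * rmat q p b c \<tau> T' :: 'k::comm_ring_1 mat) $$ (i, i') =
    (\<Sum>u\<in>T. \<Sum>v\<in>T'. (if b u = i then 1 else 0) * (if c u = c v then 1 else 0) * (if b (\<tau> v) = i' then 1 else 0))"
proof -
  have "(lmat p q b c T * rmat q p b c \<tau> T' :: 'k mat) $$ (i, i') =
     (\<Sum>l = 0..<q. (\<Sum>u\<in>T. if b u = i \<and> c u = l then 1 else 0) * (\<Sum>v\<in>T'. if c v = l \<and> b (\<tau> v) = i' then 1 else 0))"
    using i by (simp add: lmat_def rmat_def scalar_prod_def)
  also have "\<dots> = (\<Sum>l = 0..<q. \<Sum>u\<in>T. \<Sum>v\<in>T'.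
      (if b u = i \<and> c u = l then 1 else 0) * (if c v = l \<and> b (\<tau> v) = i' then 1 else 0))"
    by (simp add: sum_product)
  also have "\<dots> = (\<Sum>u\<in>T. \<Sum>v\<in>T'. \<Sum>l = 0..<q.
      (if b u = i \<and> c u = l then 1 else 0) * (if c v = l \<and> b (\<tau> v) = i' then 1 else 0))"
    by (subst sum.swap) (intro sum.cong refl sum.swap)
  also have "\<dots> = (\<Sum>u\<in>T. \<Sum>v\<in>T'. (if b u = i then 1 else 0) * (if c u = c v then 1 else 0) * (if b (\<tau> v) = i' then 1 else 0))"
  proof (intro sum.cong refl)
    fix u v assume "u \<in> T" "v \<in> T'"
    then have "u < D" using T by auto
    then have cu: "c u < q" using c by (auto simp: colourings_def)
    have "(\<Sum>l = 0..<q. (if b u = i \<and> c u = l then 1 else 0) * (if c v = l \<and> b (\<tau> v) = i' then 1 else 0)) =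
      (\<Sum>l = 0..<q. if c u = l then (if b u = i then 1 else 0) * (if c u = c v then 1 else 0) * (if b (\<tau> v) = i' then 1 else 0) else 0 :: 'k)"
      by (intro sum.cong refl) auto
    also have "\<dots> = (if b u = i then 1 else 0) * (if c u = c v then 1 else 0) * (if b (\<tau> v) = i' then 1 else 0)"
      using cu by (subst sum.delta') auto
    finally show "(\<Sum>l = 0..<q. (if b u = i \<and> c u = l then 1 else 0) * (if c v = l \<and> b (\<tau> v) = i' then 1 else 0)) =
      (if b u = i then 1 else 0) * (if c u = c v then 1 else 0) * (if b (\<tau> v) = i' then 1 else 0 :: 'k)" .
  qed
  finally show ?thesis .
qed

text \<open>Applying Ryser's formula in both factors makes u and v run through permutations
  \<open>\<pi>\<close> and \<open>\<sigma> \<circ> \<pi>\<close>. The middle relation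
  \<open>c u = c v\<close> then says that \<open>\<sigma>\<close> preserves colours. So a Young
  symmetrizer with q blocks is a combination of tensor powers of maps through
  \<open>k^q\<close>.\<close>

lemma polarised_symmetrizer:
  assumes c: "c \<in> colourings D q" and \<tau>: "\<tau> permutes {..<D}"
    and \<omega>: "\<And>s. s < D \<Longrightarrow> \<omega> s < p" and \<omega>': "\<And>s. s < D \<Longrightarrow> \<omega>' s < p"
  shows "(\<Sum>T\<in>Pow {..<D}. \<Sum>T'\<in>Pow {..<D}. (-1) ^ (D - card T) * (-1) ^ (D - card T') *
      tens D (ent (lmat p q b c T * rmat q p b c \<tau> T' :: 'k::comm_ring_1 mat)) \<omega> \<omega>') =
    (\<Sum>\<pi> | \<pi> permutes {..<D}. \<Sum>\<sigma>\<in>young D c. match D \<omega> \<omega>' b \<pi> (\<tau> \<circ> \<sigma>))"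
proof -
  let ?U = "{..<D}"
  let ?P = "{\<pi>. \<pi> permutes ?U}"
  let ?X = "\<lambda>s u v. (if b u = \<omega> s then 1 else 0) * (if c u = c v then 1 else 0) * (if b (\<tau> v) = \<omega>' s then 1 else 0) :: 'k"
  have "(\<Sum>T\<in>Pow ?U. \<Sum>T'\<in>Pow ?U. (-1) ^ (D - card T) * (-1) ^ (D - card T') *
      tens D (ent (lmat p q b c T * rmat q p b c \<tau> T' :: 'k mat)) \<omega> \<omega>') =
    (\<Sum>T\<in>Pow ?U. \<Sum>T'\<in>Pow ?U. (-1) ^ (D - card T) * (-1) ^ (D - card T') *
      (\<Prod>s<D. \<Sum>u\<in>T. \<Sum>v\<in>T'. ?X s u v))"
    unfolding tens_def
    by (intro sum.cong refl arg_cong2[of _ _ _ _ "(*)"] prod.cong lmat_rmat_index[OF c]) (use \<omega> \<omega>' in auto)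
  also have "\<dots> = (\<Sum>T'\<in>Pow ?U. (-1) ^ (D - card T') * (\<Sum>T\<in>Pow ?U. (-1) ^ (card ?U - card T) *
      (\<Prod>s<D. \<Sum>u\<in>T. \<Sum>v\<in>T'. ?X s u v)))"
    unfolding sum_distrib_left by (subst sum.swap) (simp add: ac_simps)
  also have "\<dots> = (\<Sum>T'\<in>Pow ?U. (-1) ^ (D - card T') * (\<Sum>\<pi>\<in>?P. \<Prod>s<D. \<Sum>v\<in>T'. ?X s (\<pi> s) v))"
    by (subst ryser) simp_all
  also have "\<dots> = (\<Sum>\<pi>\<in>?P. \<Sum>T'\<in>Pow ?U. (-1) ^ (card ?U - card T') * (\<Prod>s<D. \<Sum>v\<in>T'. ?X s (\<pi> s) v))"
    unfolding sum_distrib_left by (subst sum.swap) simp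
  also have "\<dots> = (\<Sum>\<pi>\<in>?P. \<Sum>\<rho>\<in>?P. \<Prod>s<D. ?X s (\<pi> s) (\<rho> s))"
    by (subst ryser) simp_all
  also have "\<dots> = (\<Sum>\<pi>\<in>?P. \<Sum>\<sigma>\<in>?P. \<Prod>s<D. ?X s (\<pi> s) ((\<sigma> \<circ> \<pi>) s))"
  proof (rule sum.cong[OF refl])
    fix \<pi> assume "\<pi> \<in> ?P"
    then have "\<pi> permutes ?U" by simp
    from sum_perms_compose_right[OF _ this, of "\<lambda>\<rho>. \<Prod>s<D. ?X s (\<pi> s) (\<rho> s)"]
    show "(\<Sum>\<rho>\<in>?P. \<Prod>s<D. ?X s (\<pi> s) (\<rho> s)) = (\<Sum>\<sigma>\<in>?P. \<Prod>s<D. ?X s (\<pi> s) ((\<sigma> \<circ> \<pi>) s))" by simp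
  qed
  \<comment> \<open>The colour condition along \<open>\<pi>\<close> is the same as the colour
    condition on all letters, because \<open>\<pi>\<close> is a bijection of them.\<close>
  also have "\<dots> = (\<Sum>\<pi>\<in>?P. \<Sum>\<sigma>\<in>young D c. match D \<omega> \<omega>' b \<pi> (\<tau> \<circ> \<sigma>))"
  proof (rule sum.cong[OF refl])
    fix \<pi> assume "\<pi> \<in> ?P"
    then have \<pi>: "\<pi> permutes ?U" by simp
    have split: "(\<Prod>s<D. ?X s (\<pi> s) ((\<sigma> \<circ> \<pi>) s)) =
       (if \<sigma> \<in> young D c then match D \<omega> \<omega>' b \<pi> (\<tau> \<circ> \<sigma>) else 0)" if s: "\<sigma> permutes ?U" for \<sigma>
    proof -
      have "(\<Prod>s<D. ?X s (\<pi> s) ((\<sigma> \<circ> \<pi>) s)) = (\<Prod>s<D. if c (\<pi> s) = c (\<sigma> (\<pi> s)) then 1 else 0) * match D \<omega> \<omega>' b \<pi> (\<tau> \<circ> \<sigma>)"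
        unfolding match_def prod.distrib[symmetric] by (intro prod.cong refl) simp
      moreover have "(\<Prod>s<D. if c (\<pi> s) = c (\<sigma> (\<pi> s)) then 1 else 0 :: 'k) = (\<Prod>s<D. if c s = c (\<sigma> s) then 1 else 0)"
        using prod.permute[OF \<pi>, of "\<lambda>s. if c s = c (\<sigma> s) then 1 else 0 :: 'k"] by (simp add: o_def)
      moreover have "\<dots> = (if \<forall>s\<in>{..<D}. c s = c (\<sigma> s) then 1 else 0 :: 'k)" by (rule prod_indicator) simp
      moreover have "(\<forall>s\<in>{..<D}. c s = c (\<sigma> s)) \<longleftrightarrow> \<sigma> \<in> young D c" using s by (auto simp: young_def)
      ultimately show ?thesis by simp
    qed
    show "(\<Sum>\<sigma>\<in>?P. \<Prod>s<D. ?X s (\<pi> s) ((\<sigma> \<circ> \<pi>) s)) = (\<Sum>\<sigma>\<in>young D c. match D \<omega> \<omega>' b \<pi> (\<tau> \<circ> \<sigma>))"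
      by (rule sum.mono_neutral_cong_right)
        (use young_subset[of D c] split in \<open>auto simp del: o_apply simp: young_def\<close>)
  qed
  finally show ?thesis .
qed

text \<open>The counterpart for one permutation: a single application of Ryser's formula turns its
  action on D-fold tensors into a combination of tensor powers of maps through \<open>k^D\<close>.
  Taken with signs it yields the alternators.\<close>

lemma polarised_permutation:
  assumes \<tau>: "\<tau> permutes {..<D}" and \<sigma>: "\<sigma> permutes {..<D}"
    and \<omega>: "\<And>s. s < D \<Longrightarrow> \<omega> s < p" and \<omega>': "\<And>s. s < D \<Longrightarrow> \<omega>' s < p"
  shows "(\<Sum>T\<in>Pow {..<D}. (-1) ^ (D - card T) *
      tens D (ent (fmat p D b * (pmat D T \<sigma> * fmat' p D (b \<circ> \<tau>)) :: 'k::comm_ring_1 mat)) \<omega> \<omega>') =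
    (\<Sum>\<pi> | \<pi> permutes {..<D}. match D \<omega> \<omega>' b \<pi> (\<tau> \<circ> \<sigma>))"
proof -
  let ?U = "{..<D}"
  let ?X = "\<lambda>s u. (if b u = \<omega> s then 1 else 0) * (if b (\<tau> (\<sigma> u)) = \<omega>' s then 1 else 0) :: 'k"
  have sD: "\<sigma> u < D" if "u < D" for u using permutes_in_image[OF \<sigma>, of u] that by simp
  have "(\<Sum>T\<in>Pow ?U. (-1) ^ (D - card T) *
      tens D (ent (fmat p D b * (pmat D T \<sigma> * fmat' p D (b \<circ> \<tau>)) :: 'k mat)) \<omega> \<omega>') =
    (\<Sum>T\<in>Pow ?U. (-1) ^ (card ?U - card T) * (\<Prod>s\<in>?U. \<Sum>u\<in>T. ?X s u))"
  proof (rule sum.cong[OF refl])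
    fix T assume "T \<in> Pow ?U"
    then have T: "T \<subseteq> ?U" by simp
    have "tens D (ent (fmat p D b * (pmat D T \<sigma> * fmat' p D (b \<circ> \<tau>)) :: 'k mat)) \<omega> \<omega>' = (\<Prod>s\<in>?U. \<Sum>u\<in>T. ?X s u)"
      unfolding tens_def
    proof (rule prod.cong[OF refl])
      fix s assume "s \<in> ?U"
      then have s: "\<omega> s < p" "\<omega>' s < p" using \<omega> \<omega>' by auto
      have "(fmat p D b * (pmat D T \<sigma> * fmat' p D (b \<circ> \<tau>)) :: 'k mat) $$ (\<omega> s, \<omega>' s) =
         (\<Sum>u\<in>T. fmat p D b $$ (\<omega> s, u) * fmat' p D (b \<circ> \<tau>) $$ (\<sigma> u, \<omega>' s))"
        by (rule pmat_mult_index[OF _ _ T \<sigma> s]) (simp_all add: fmat_def fmat'_def)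
      also have "\<dots> = (\<Sum>u\<in>T. ?X s u)"
        using T sD s by (intro sum.cong refl) (auto simp: fmat_def fmat'_def)
      finally show "(fmat p D b * (pmat D T \<sigma> * fmat' p D (b \<circ> \<tau>)) :: 'k mat) $$ (\<omega> s, \<omega>' s) = (\<Sum>u\<in>T. ?X s u)" .
    qed
    then show "(-1) ^ (D - card T) * tens D (ent (fmat p D b * (pmat D T \<sigma> * fmat' p D (b \<circ> \<tau>)) :: 'k mat)) \<omega> \<omega>' =
      (-1) ^ (card ?U - card T) * (\<Prod>s\<in>?U. \<Sum>u\<in>T. ?X s u)" by simp
  qed
  also have "\<dots> = (\<Sum>\<pi> | \<pi> permutes ?U. match D \<omega> \<omega>' b \<pi> (\<tau> \<circ> \<sigma>))"
    by (subst ryser) (simp_all add: match_def)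
  finally show ?thesis .
qed

section \<open>Splitting the identity of a tensor power\<close>

lemma finite_sum_nat_reindex:
  assumes "finite X"
  obtains e :: "nat \<Rightarrow> 'b" where "\<And>i. i < card X \<Longrightarrow> e i \<in> X"
    "\<And>f :: 'b \<Rightarrow> 'c::comm_monoid_add. (\<Sum>x\<in>X. f x) = (\<Sum>i<card X. f (e i))"
proof -
  obtain e where e: "bij_betw e {0..<card X} X" using ex_bij_betw_nat_finite[OF assms] by blast
  show ?thesis
  proof
    show "e i \<in> X" if "i < card X" for i using e that by (auto dest: bij_betwE)
    show "(\<Sum>x\<in>X. f x) = (\<Sum>i<card X. f (e i))" for f :: "'b \<Rightarrow> 'c"
      using sum.reindex_bij_betw[OF e, of f] by (simp add: lessThan_atLeast0)
  qed
qed

definition altsgn :: "nat \<Rightarrow> nat set \<Rightarrow> (nat \<Rightarrow> nat) \<Rightarrow> 'k::field" where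
  "altsgn D T \<sigma> = (-1) ^ (D - card T) * of_int (sign \<sigma>)"

text \<open>The number D has two roles, the tensor degree and the number of auxiliary letters.
  \<open>E\<close> and \<open>E'\<close> connect \<open>k^p\<close> with the space of these letters,
  on which the alternators of the sets \<open>A j\<close> act. The identity is demanded only for
  words with letters below p, where the matrices have entries.\<close>

definition splitting :: "nat \<Rightarrow> nat \<Rightarrow> nat \<Rightarrow> nat \<Rightarrow> (nat \<Rightarrow> 'k::field) \<Rightarrow> (nat \<Rightarrow> 'k mat) \<Rightarrow> (nat \<Rightarrow> 'k mat) \<Rightarrow>
    nat \<Rightarrow> (nat \<Rightarrow> 'k) \<Rightarrow> (nat \<Rightarrow> nat set) \<Rightarrow> (nat \<Rightarrow> 'k mat) \<Rightarrow> (nat \<Rightarrow> 'k mat) \<Rightarrow> bool" where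
  "splitting p q D r a C C' r2 b A E E' \<longleftrightarrow>
     (\<forall>i<r. C i \<in> carrier_mat p q \<and> C' i \<in> carrier_mat q p) \<and>
     (\<forall>j<r2. A j \<in> subsets (Suc q) D \<and> E j \<in> carrier_mat p D \<and> E' j \<in> carrier_mat D p) \<and>
     (\<forall>\<omega> \<omega>'. (\<forall>s<D. \<omega> s < p) \<longrightarrow> (\<forall>s<D. \<omega>' s < p) \<longrightarrow>
       (if \<forall>s<D. \<omega> s = \<omega>' s then 1 else 0) = (\<Sum>i<r. a i * tens D (ent (C i * C' i)) \<omega> \<omega>') +
       (\<Sum>j<r2. b j * (\<Sum>T\<in>Pow {..<D}. \<Sum>\<sigma> | \<sigma> permutes A j. altsgn D T \<sigma> *
          tens D (ent (E j * (pmat D T \<sigma> * E' j))) \<omega> \<omega>')))"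

text \<open>Evaluate the relation of \<open>group_algebra_unit\<close> at the functionals given by
  \<open>match\<close>, sum over all \<open>b\<close> and \<open>\<pi>\<close>, and replace
  symmetrizers and permutations by their polarisations.\<close>

lemma splitting_exists:
  obtains r and a :: "nat \<Rightarrow> 'k::field_char_0" and C C' r2 b A E E' where "splitting p q D r a C C' r2 b A E E'"
proof -
  let ?U = "{..<D}"
  let ?P = "{\<pi>. \<pi> permutes ?U}"
  obtain w :: "(nat \<Rightarrow> nat) \<Rightarrow> rat" where w: "\<And>g::(nat \<Rightarrow> nat) \<Rightarrow> 'k.
     (\<Sum>\<tau>\<in>?P. of_rat (w \<tau>) *
       ((\<Sum>c\<in>colourings D q. \<Sum>\<sigma>\<in>young D c. g (\<tau> \<circ> \<sigma>)) +
        (\<Sum>A\<in>subsets (Suc q) D. \<Sum>\<sigma> | \<sigma> permutes A. of_int (sign \<sigma>) * g (\<tau> \<circ> \<sigma>)))) = g id"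
    using group_algebra_unit[where 'a = 'k] by blast
  define X1 where "X1 = colourings D p \<times> ?P \<times> colourings D q \<times> Pow ?U \<times> Pow ?U"
  define X2 where "X2 = colourings D p \<times> ?P \<times> subsets (Suc q) D"
  have "finite X1" "finite X2" unfolding X1_def X2_def by simp_all
  \<comment> \<open>The two signs come from the two applications of Ryser's formula. Division by
    \<open>fact D\<close> compensates for the sum over \<open>\<pi>\<close>, every term of which
    contributes the same identity.\<close>
  define fa :: "_ \<Rightarrow> 'k" where "fa = (\<lambda>(b::nat\<Rightarrow>nat, \<tau>, c::nat\<Rightarrow>nat, T::nat set, T'::nat set).
     of_rat (w \<tau>) * (-1) ^ (D - card T) * (-1) ^ (D - card T') / fact D)"
  define fC :: "_ \<Rightarrow> 'k mat" where "fC = (\<lambda>(b::nat\<Rightarrow>nat, \<tau>::nat\<Rightarrow>nat, c, T, T'::nat set). lmat p q b c T)"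
  define fC' :: "_ \<Rightarrow> 'k mat" where "fC' = (\<lambda>(b::nat\<Rightarrow>nat, \<tau>::nat\<Rightarrow>nat, c::nat\<Rightarrow>nat, T::nat set, T'). rmat q p b c \<tau> T')"
  define fb :: "_ \<Rightarrow> 'k" where "fb = (\<lambda>(b::nat\<Rightarrow>nat, \<tau>, A::nat set). of_rat (w \<tau>) / fact D)"
  define fA where "fA = (\<lambda>(b::nat\<Rightarrow>nat, \<tau>::nat\<Rightarrow>nat, A::nat set). A)"
  define fE :: "_ \<Rightarrow> 'k mat" where "fE = (\<lambda>(b::nat\<Rightarrow>nat, \<tau>::nat\<Rightarrow>nat, A::nat set). fmat p D b)"
  define fE' :: "_ \<Rightarrow> 'k mat" where "fE' = (\<lambda>(b::nat\<Rightarrow>nat, \<tau>::nat\<Rightarrow>nat, A::nat set). fmat' p D (b \<circ> \<tau>))"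
  have main: "(if \<forall>s<D. \<omega> s = \<omega>' s then 1 else 0 :: 'k) = (\<Sum>x\<in>X1. fa x * tens D (ent (fC x * fC' x)) \<omega> \<omega>') +
       (\<Sum>y\<in>X2. fb y * (\<Sum>T\<in>Pow {..<D}. \<Sum>\<sigma> | \<sigma> permutes fA y. (-1) ^ (D - card T) * of_int (sign \<sigma>) *
          tens D (ent (fE y * (pmat D T \<sigma> * fE' y))) \<omega> \<omega>'))"
    if \<omega>: "\<And>s. s < D \<Longrightarrow> \<omega> s < p" and \<omega>': "\<And>s. s < D \<Longrightarrow> \<omega>' s < p" for \<omega> \<omega>'
  proof -
    let ?m = "match D \<omega> \<omega>' :: _ \<Rightarrow> _ \<Rightarrow> _ \<Rightarrow> 'k"
    have S1: "(\<Sum>x\<in>X1. fa x * tens D (ent (fC x * fC' x)) \<omega> \<omega>') =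
      (\<Sum>b\<in>colourings D p. \<Sum>\<tau>\<in>?P. of_rat (w \<tau>) / fact D *
         (\<Sum>c\<in>colourings D q. \<Sum>\<pi>\<in>?P. \<Sum>\<sigma>\<in>young D c. ?m b \<pi> (\<tau> \<circ> \<sigma>)))"
    proof -
      have "(\<Sum>x\<in>X1. fa x * tens D (ent (fC x * fC' x)) \<omega> \<omega>') =
        (\<Sum>b\<in>colourings D p. \<Sum>\<tau>\<in>?P. \<Sum>c\<in>colourings D q. \<Sum>T\<in>Pow ?U. \<Sum>T'\<in>Pow ?U.
          of_rat (w \<tau>) * (-1) ^ (D - card T) * (-1) ^ (D - card T') / fact D *
          tens D (ent (lmat p q b c T * rmat q p b c \<tau> T' :: 'k mat)) \<omega> \<omega>')"
        unfolding X1_def fa_def fC_def fC'_def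
        by (simp add: sum.cartesian_product split_def)
      also have "\<dots> = (\<Sum>b\<in>colourings D p. \<Sum>\<tau>\<in>?P. of_rat (w \<tau>) / fact D * (\<Sum>c\<in>colourings D q. \<Sum>T\<in>Pow ?U. \<Sum>T'\<in>Pow ?U.
          (-1) ^ (D - card T) * (-1) ^ (D - card T') *
          tens D (ent (lmat p q b c T * rmat q p b c \<tau> T' :: 'k mat)) \<omega> \<omega>'))"
        unfolding sum_distrib_left by (simp add: ac_simps)
      also have "\<dots> = (\<Sum>b\<in>colourings D p. \<Sum>\<tau>\<in>?P. of_rat (w \<tau>) / fact D *
         (\<Sum>c\<in>colourings D q. \<Sum>\<pi>\<in>?P. \<Sum>\<sigma>\<in>young D c. ?m b \<pi> (\<tau> \<circ> \<sigma>)))"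
        by (intro sum.cong refl arg_cong2[of _ _ _ _ "(*)"] polarised_symmetrizer) (use \<omega> \<omega>' in auto)
      finally show ?thesis .
    qed
    have S2: "(\<Sum>y\<in>X2. fb y * (\<Sum>T\<in>Pow ?U. \<Sum>\<sigma> | \<sigma> permutes fA y. (-1) ^ (D - card T) * of_int (sign \<sigma>) *
          tens D (ent (fE y * (pmat D T \<sigma> * fE' y))) \<omega> \<omega>')) =
       (\<Sum>b\<in>colourings D p. \<Sum>\<tau>\<in>?P. of_rat (w \<tau>) / fact D *
         (\<Sum>A\<in>subsets (Suc q) D. \<Sum>\<pi>\<in>?P. \<Sum>\<sigma> | \<sigma> permutes A. of_int (sign \<sigma>) * ?m b \<pi> (\<tau> \<circ> \<sigma>)))"
    proof -
      have "(\<Sum>y\<in>X2. fb y * (\<Sum>T\<in>Pow ?U. \<Sum>\<sigma> | \<sigma> permutes fA y. (-1) ^ (D - card T) * of_int (sign \<sigma>) *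
          tens D (ent (fE y * (pmat D T \<sigma> * fE' y))) \<omega> \<omega>')) =
        (\<Sum>b\<in>colourings D p. \<Sum>\<tau>\<in>?P. \<Sum>A\<in>subsets (Suc q) D. of_rat (w \<tau>) / fact D *
          (\<Sum>T\<in>Pow ?U. \<Sum>\<sigma> | \<sigma> permutes A. (-1) ^ (D - card T) * of_int (sign \<sigma>) *
             tens D (ent (fmat p D b * (pmat D T \<sigma> * fmat' p D (b \<circ> \<tau>)) :: 'k mat)) \<omega> \<omega>'))"
        unfolding X2_def fb_def fA_def fE_def fE'_def
        by (simp add: sum.cartesian_product split_def)
      also have "\<dots> = (\<Sum>b\<in>colourings D p. \<Sum>\<tau>\<in>?P. of_rat (w \<tau>) / fact D *
         (\<Sum>A\<in>subsets (Suc q) D. \<Sum>\<pi>\<in>?P. \<Sum>\<sigma> | \<sigma> permutes A. of_int (sign \<sigma>) * ?m b \<pi> (\<tau> \<circ> \<sigma>)))"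
        unfolding sum_distrib_left[symmetric]
      proof (intro sum.cong refl arg_cong2[of _ _ _ _ "(*)"])
        fix b \<tau> A assume "\<tau> \<in> ?P" and A: "A \<in> subsets (Suc q) D"
        then have \<tau>: "\<tau> permutes ?U" by simp
        have "(\<Sum>T\<in>Pow ?U. \<Sum>\<sigma> | \<sigma> permutes A. (-1) ^ (D - card T) * of_int (sign \<sigma>) *
             tens D (ent (fmat p D b * (pmat D T \<sigma> * fmat' p D (b \<circ> \<tau>)) :: 'k mat)) \<omega> \<omega>') =
          (\<Sum>\<sigma> | \<sigma> permutes A. of_int (sign \<sigma>) * (\<Sum>T\<in>Pow ?U. (-1) ^ (D - card T) *
             tens D (ent (fmat p D b * (pmat D T \<sigma> * fmat' p D (b \<circ> \<tau>)) :: 'k mat)) \<omega> \<omega>'))"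
          unfolding sum_distrib_left by (subst sum.swap) (simp add: ac_simps)
        also have "\<dots> = (\<Sum>\<sigma> | \<sigma> permutes A. of_int (sign \<sigma>) * (\<Sum>\<pi>\<in>?P. ?m b \<pi> (\<tau> \<circ> \<sigma>)))"
          by (intro sum.cong refl arg_cong2[of _ _ _ _ "(*)"] polarised_permutation)
            (use \<omega> \<omega>' \<tau> subsets_permutes[OF A] in auto)
        also have "\<dots> = (\<Sum>\<pi>\<in>?P. \<Sum>\<sigma> | \<sigma> permutes A. of_int (sign \<sigma>) * ?m b \<pi> (\<tau> \<circ> \<sigma>))"
          unfolding sum_distrib_left by (rule sum.swap)
        finally show "(\<Sum>T\<in>Pow ?U. \<Sum>\<sigma> | \<sigma> permutes A. (-1) ^ (D - card T) * of_int (sign \<sigma>) *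
             tens D (ent (fmat p D b * (pmat D T \<sigma> * fmat' p D (b \<circ> \<tau>)) :: 'k mat)) \<omega> \<omega>') =
          (\<Sum>\<pi>\<in>?P. \<Sum>\<sigma> | \<sigma> permutes A. of_int (sign \<sigma>) * ?m b \<pi> (\<tau> \<circ> \<sigma>))" .
      qed
      finally show ?thesis .
    qed
    have "(\<Sum>x\<in>X1. fa x * tens D (ent (fC x * fC' x)) \<omega> \<omega>') +
       (\<Sum>y\<in>X2. fb y * (\<Sum>T\<in>Pow {..<D}. \<Sum>\<sigma> | \<sigma> permutes fA y. (-1) ^ (D - card T) * of_int (sign \<sigma>) *
          tens D (ent (fE y * (pmat D T \<sigma> * fE' y))) \<omega> \<omega>')) =
       (\<Sum>b\<in>colourings D p. \<Sum>\<tau>\<in>?P. of_rat (w \<tau>) / fact D *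
         (\<Sum>\<pi>\<in>?P. (\<Sum>c\<in>colourings D q. \<Sum>\<sigma>\<in>young D c. ?m b \<pi> (\<tau> \<circ> \<sigma>)) +
          (\<Sum>A\<in>subsets (Suc q) D. \<Sum>\<sigma> | \<sigma> permutes A. of_int (sign \<sigma>) * ?m b \<pi> (\<tau> \<circ> \<sigma>))))"
      unfolding S1 S2 sum.distrib[symmetric] distrib_left[symmetric]
      unfolding sum.swap[of _ ?P "colourings D q"] sum.swap[of _ ?P "subsets (Suc q) D"] sum.distrib by simp
    also have "\<dots> = (\<Sum>b\<in>colourings D p. \<Sum>\<pi>\<in>?P. (\<Sum>\<tau>\<in>?P. of_rat (w \<tau>) *
         ((\<Sum>c\<in>colourings D q. \<Sum>\<sigma>\<in>young D c. ?m b \<pi> (\<tau> \<circ> \<sigma>)) +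
          (\<Sum>A\<in>subsets (Suc q) D. \<Sum>\<sigma> | \<sigma> permutes A. of_int (sign \<sigma>) * ?m b \<pi> (\<tau> \<circ> \<sigma>)))) / fact D)"
      unfolding sum_distrib_left[of _ _ ?P] sum_divide_distrib
      by (rule sum.cong[OF refl], subst sum.swap) simp
    also have "\<dots> = (\<Sum>b\<in>colourings D p. \<Sum>\<pi>\<in>?P. ?m b \<pi> id / fact D)"
      by (simp only: w)
    also have "\<dots> = (\<Sum>\<pi>\<in>?P. (\<Sum>b\<in>colourings D p. ?m b \<pi> id) / fact D)"
      unfolding sum_divide_distrib by (rule sum.swap)
    also have "\<dots> = (\<Sum>\<pi>\<in>?P. (if \<forall>s<D. \<omega> s = \<omega>' s then 1 else 0) / fact D)"
    proof (rule sum.cong[OF refl])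
      fix \<pi> assume "\<pi> \<in> ?P"
      then show "(\<Sum>b\<in>colourings D p. ?m b \<pi> id) / fact D = (if \<forall>s<D. \<omega> s = \<omega>' s then 1 else 0) / fact D"
        using sum_colourings_word[of \<pi> D \<omega> p \<omega>'] \<omega> by (simp add: match_def)
    qed
    also have "\<dots> = (if \<forall>s<D. \<omega> s = \<omega>' s then 1 else 0)"
      using card_permutations[of ?U D] by simp
    finally show ?thesis by simp
  qed
  obtain e1 where e1: "\<And>i. i < card X1 \<Longrightarrow> e1 i \<in> X1"
     "\<And>f :: _ \<Rightarrow> 'k. (\<Sum>x\<in>X1. f x) = (\<Sum>i<card X1. f (e1 i))"
    by (rule finite_sum_nat_reindex[OF \<open>finite X1\<close>]) blast
  obtain e2 where e2: "\<And>i. i < card X2 \<Longrightarrow> e2 i \<in> X2"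
     "\<And>f :: _ \<Rightarrow> 'k. (\<Sum>x\<in>X2. f x) = (\<Sum>i<card X2. f (e2 i))"
    by (rule finite_sum_nat_reindex[OF \<open>finite X2\<close>]) blast
  have x1: "fC x \<in> carrier_mat p q" "fC' x \<in> carrier_mat q p" for x
    by (cases x, simp add: fC_def fC'_def lmat_def rmat_def)+
  have x2: "fE y \<in> carrier_mat p D" "fE' y \<in> carrier_mat D p" for y
    by (cases y, simp add: fE_def fE'_def fmat_def fmat'_def)+
  have x3: "fA y \<in> subsets (Suc q) D" if "y \<in> X2" for y using that by (auto simp: X2_def fA_def)
  show ?thesis
  proof (rule that, unfold splitting_def altsgn_def, intro conjI allI impI)
    fix \<omega> \<omega>' :: "nat \<Rightarrow> nat" assume "\<forall>s<D. \<omega> s < p" "\<forall>s<D. \<omega>' s < p"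
    then show "(if \<forall>s<D. \<omega> s = \<omega>' s then 1 else 0 :: 'k) =
       (\<Sum>i<card X1. fa (e1 i) * tens D (ent (fC (e1 i) * fC' (e1 i))) \<omega> \<omega>') +
       (\<Sum>j<card X2. fb (e2 j) * (\<Sum>T\<in>Pow {..<D}. \<Sum>\<sigma> | \<sigma> permutes fA (e2 j). (-1) ^ (D - card T) * of_int (sign \<sigma>) *
          tens D (ent (fE (e2 j) * (pmat D T \<sigma> * fE' (e2 j)))) \<omega> \<omega>'))"
      using main[of \<omega> \<omega>', unfolded e1(2) e2(2)] by blast
  qed (simp_all add: x1 x2 x3 e1(1) e2(1))
qed

section \<open>Substitution homomorphisms\<close>

lemma const_zero [simp]: "const 0 = 0" and const_one [simp]: "const 1 = 1"
  by (simp_all add: const_def)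

lemma const_add: "const (a + b) = const a + const b"
  and const_mult: "const (a * b) = const a * const b"
  by (simp_all add: const_def single_add mult_single)

lemma const_hom: "comm_ring_hom (const :: 'k::field \<Rightarrow> ('x, 'k) mpoly)"
  by unfold_locales (simp_all add: const_add const_mult)

interpretation const: comm_ring_hom "const :: 'k::field \<Rightarrow> ('x, 'k) mpoly"
  by (rule const_hom)

lemma lookup_scal: "Poly_Mapping.lookup (scal c p) u = c * Poly_Mapping.lookup p u"
proof -
  have "scal c p = Poly_Mapping.map ((*) c) p"
    unfolding scal_def const_def by (rule mult_map_scale_conv_mult[symmetric])
  then show ?thesis by (simp add: Poly_Mapping.map.rep_eq when_def)
qed

lemma scal_single: "scal c (Poly_Mapping.single u a) = Poly_Mapping.single u (c * a)"
  by (simp add: scal_def const_def mult_single)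

lemma scal_scal [simp]: "scal a (scal b p) = scal (a * b) p"
  by (simp add: scal_def const_mult mult.assoc)

lemma scal_1 [simp]: "scal 1 p = p" and scal_0 [simp]: "scal 0 p = 0" and scal_zero [simp]: "scal c 0 = 0"
  by (simp_all add: scal_def)

lemma scal_mult_right: "p * scal c q = scal c (p * q)"
  by (simp add: scal_def ac_simps)

lemma scal_sum: "scal c (\<Sum>i\<in>X. f i) = (\<Sum>i\<in>X. scal c (f i))"
  by (simp add: scal_def sum_distrib_left)

lemma scal_sum_left: "scal (\<Sum>i\<in>X. f i) p = (\<Sum>i\<in>X. scal (f i) p)"
  by (simp add: scal_def const.hom_sum sum_distrib_right)

lemma scal_add: "scal c (p + q) = scal c p + scal c q"
  by (simp add: scal_def distrib_left)

text \<open>The cancellation law that the sign arguments need in the polynomial ring, where the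
  forms take their values.\<close>

lemma mpoly_double_zero: "x = 0" if "x + x = 0" for x :: "('x, 'k::field_char_0) mpoly"
proof (rule poly_mapping_eqI)
  fix u
  have "Poly_Mapping.lookup x u + Poly_Mapping.lookup x u = 0" using that by (metis lookup_add lookup_zero)
  then have "2 * Poly_Mapping.lookup x u = 0" by simp
  then show "Poly_Mapping.lookup x u = Poly_Mapping.lookup 0 u" by simp
qed

section \<open>Evaluation of monomials and algebra homomorphisms\<close>

definition mono_eval :: "('x \<Rightarrow> 'r::comm_ring_1) \<Rightarrow> ('x \<Rightarrow>\<^sub>0 nat) \<Rightarrow> 'r" where
  "mono_eval \<theta> u = (\<Prod>x\<in>Poly_Mapping.keys u. \<theta> x ^ Poly_Mapping.lookup u x)"

lemma mono_eval_superset: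
  assumes "finite X" "Poly_Mapping.keys u \<subseteq> X"
  shows "mono_eval \<theta> u = (\<Prod>x\<in>X. \<theta> x ^ Poly_Mapping.lookup u x)"
  unfolding mono_eval_def using assms
  by (intro prod.mono_neutral_left) (auto simp: in_keys_iff)

lemma mono_eval_add: "mono_eval \<theta> (u + v) = mono_eval \<theta> u * mono_eval \<theta> v"
proof -
  let ?X = "Poly_Mapping.keys u \<union> Poly_Mapping.keys v"
  have k: "Poly_Mapping.keys (u + v) \<subseteq> ?X" by (rule keys_add)
  show ?thesis
    by (simp add: mono_eval_superset[of ?X] k lookup_add power_add prod.distrib)
qed

lemma mono_eval_zero [simp]: "mono_eval \<theta> 0 = 1"
  and mono_eval_single [simp]: "mono_eval \<theta> (Poly_Mapping.single x 1) = \<theta> x"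
  by (simp_all add: mono_eval_def)

lemma subst_eq: "subst \<theta> p = (\<Sum>u\<in>Poly_Mapping.keys p. const (Poly_Mapping.lookup p u) * mono_eval \<theta> u)"
  by (simp add: subst_def mono_eval_def scal_def)

lemma subst_superset:
  assumes "finite X" "Poly_Mapping.keys p \<subseteq> X"
  shows "subst \<theta> p = (\<Sum>u\<in>X. const (Poly_Mapping.lookup p u) * mono_eval \<theta> u)"
  unfolding subst_eq using assms by (intro sum.mono_neutral_left) (auto simp: in_keys_iff)

lemma subst_add: "subst \<theta> (p + q) = subst \<theta> p + subst \<theta> q"
proof -
  let ?X = "Poly_Mapping.keys p \<union> Poly_Mapping.keys q"
  have k: "Poly_Mapping.keys (p + q) \<subseteq> ?X" by (rule keys_add)
  show ?thesis
    by (simp add: subst_superset[of ?X] k lookup_add const_add distrib_right sum.distrib)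
qed

lemma subst_single: "subst \<theta> (Poly_Mapping.single u c) = const c * mono_eval \<theta> u"
  by (subst subst_superset[of "{u}"]) auto

lemma subst_0 [simp]: "subst \<theta> 0 = 0" by (simp add: subst_eq)

lemma subst_sum: "subst \<theta> (\<Sum>i\<in>X. f i) = (\<Sum>i\<in>X. subst \<theta> (f i))"
  by (induction X rule: infinite_finite_induct) (simp_all add: subst_add)

lemma mpoly_sum_monomials: "(\<Sum>u\<in>Poly_Mapping.keys p. Poly_Mapping.single u (Poly_Mapping.lookup p u)) = p"
  by (rule poly_mapping_eqI) (auto simp: lookup_sum lookup_single when_def in_keys_iff)

lemma subst_mult: "subst \<theta> (p * q) = subst \<theta> p * subst \<theta> q"
proof -
  let ?s = "\<lambda>p u. Poly_Mapping.single u (Poly_Mapping.lookup p u)"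
  have "p * q = (\<Sum>u\<in>Poly_Mapping.keys p. \<Sum>v\<in>Poly_Mapping.keys q. ?s p u * ?s q v)"
    by (simp add: sum_product[symmetric] mpoly_sum_monomials)
  then have "subst \<theta> (p * q) = (\<Sum>u\<in>Poly_Mapping.keys p. \<Sum>v\<in>Poly_Mapping.keys q. subst \<theta> (?s p u) * subst \<theta> (?s q v))"
    by (simp add: subst_sum mult_single subst_single mono_eval_add const_mult ac_simps)
  also have "\<dots> = subst \<theta> p * subst \<theta> q"
    by (simp add: sum_product[symmetric] subst_sum[symmetric] mpoly_sum_monomials)
  finally show ?thesis .
qed

lemma subst_const [simp]: "subst \<theta> (const c) = const c"
  by (simp add: const_def subst_single[unfolded const_def])

lemma subst_var [simp]: "subst \<theta> (var x) = \<theta> x"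
  using mono_eval_single[of \<theta> x] by (simp add: var_def subst_single)

lemma subst_1 [simp]: "subst \<theta> 1 = 1"
  using subst_const[of \<theta> 1] by simp

lemma subst_scal: "subst \<theta> (scal c p) = scal c (subst \<theta> p)"
  by (simp add: scal_def subst_mult)

interpretation subst: comm_ring_hom "subst \<theta> :: ('x, 'k::field) mpoly \<Rightarrow> ('y, 'k) mpoly"
  by unfold_locales (simp_all add: subst_add subst_mult)

lemma mono_eval_hom: "subst \<theta> (mono_eval \<eta> u) = mono_eval (\<lambda>x. subst \<theta> (\<eta> x)) u"
  by (simp add: mono_eval_def subst.hom_prod subst.hom_power)

lemma subst_subst: "subst \<theta> (subst \<eta> p) = subst (\<lambda>x. subst \<theta> (\<eta> x)) p"
  unfolding subst_eq[of \<eta>] subst_eq[of "\<lambda>x. subst \<theta> (\<eta> x)"]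
  by (simp add: subst_sum subst_mult mono_eval_hom)

lemma mono_eval_cong: "(\<And>x. x \<in> Poly_Mapping.keys u \<Longrightarrow> \<theta> x = \<eta> x) \<Longrightarrow> mono_eval \<theta> u = mono_eval \<eta> u"
  unfolding mono_eval_def by (intro prod.cong) auto

lemma subst_cong:
  assumes "p \<in> poly_ring X" "\<And>x. x \<in> X \<Longrightarrow> \<theta> x = \<eta> x"
  shows "subst \<theta> p = subst \<eta> p"
  unfolding subst_eq using assms
  by (intro sum.cong refl arg_cong2[of _ _ _ _ "(*)"] mono_eval_cong) (auto simp: poly_ring_def)

lemma mono_eval_var: "mono_eval var u = Poly_Mapping.single u (1 :: 'k::field)"
proof -
  have pow: "var x ^ n = Poly_Mapping.single (Poly_Mapping.single x n) (1 :: 'k)" for x :: 'a and n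
    by (induction n) (simp_all add: var_def mult_single single_add[symmetric])
  have pr: "(\<Prod>x\<in>X. Poly_Mapping.single (f x) (1 :: 'k)) = Poly_Mapping.single (\<Sum>x\<in>X. f x) 1"
    if "finite X" for X and f :: "'a \<Rightarrow> 'a \<Rightarrow>\<^sub>0 nat"
    using that by (induction X rule: finite_induct) (simp_all add: mult_single)
  have "(\<Sum>x\<in>Poly_Mapping.keys u. Poly_Mapping.single x (Poly_Mapping.lookup u x)) = u"
    by (rule poly_mapping_eqI) (auto simp: lookup_sum lookup_single when_def in_keys_iff)
  then show ?thesis by (simp add: mono_eval_def pow pr)
qed

lemma subst_var_id: "subst var p = p"
  unfolding subst_eq mono_eval_var
  using mpoly_sum_monomials[of p] by (simp add: const_def mult_single)

section \<open>Polynomial rings as carrier sets\<close>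

lemma poly_ring_zero [simp]: "0 \<in> poly_ring X" by (simp add: poly_ring_def)

lemma poly_ring_add: "p \<in> poly_ring X \<Longrightarrow> q \<in> poly_ring X \<Longrightarrow> p + q \<in> poly_ring X"
  using keys_add[of p q] by (auto simp: poly_ring_def)

lemma poly_ring_mult: "p \<in> poly_ring X \<Longrightarrow> q \<in> poly_ring X \<Longrightarrow> p * q \<in> poly_ring X"
proof -
  assume *: "p \<in> poly_ring X" "q \<in> poly_ring X"
  show ?thesis unfolding poly_ring_def
  proof (intro CollectI ballI)
    fix u assume "u \<in> Poly_Mapping.keys (p * q)"
    then obtain a b where "u = a + b" "a \<in> Poly_Mapping.keys p" "b \<in> Poly_Mapping.keys q"
      using keys_mult[of p q] by blast
    moreover from this have "Poly_Mapping.keys a \<subseteq> X" "Poly_Mapping.keys b \<subseteq> X"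
      using * by (auto simp: poly_ring_def)
    ultimately show "Poly_Mapping.keys u \<subseteq> X" using keys_add[of a b] by blast
  qed
qed

lemma poly_ring_const [simp]: "const c \<in> poly_ring X"
  by (auto simp: poly_ring_def const_def)

lemma poly_ring_var: "x \<in> X \<Longrightarrow> var x \<in> poly_ring X"
  by (auto simp: poly_ring_def var_def)

lemma poly_ring_scal: "p \<in> poly_ring X \<Longrightarrow> scal c p \<in> poly_ring X"
  by (simp add: scal_def poly_ring_mult)

lemma poly_ring_sum: "(\<And>i. i \<in> I \<Longrightarrow> f i \<in> poly_ring X) \<Longrightarrow> (\<Sum>i\<in>I. f i) \<in> poly_ring X"
  by (induction I rule: infinite_finite_induct) (auto simp: poly_ring_add)

lemma poly_ring_prod: "(\<And>i. i \<in> I \<Longrightarrow> f i \<in> poly_ring X) \<Longrightarrow> (\<Prod>i\<in>I. f i) \<in> poly_ring X"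
  using poly_ring_const[of 1 X] by (induction I rule: infinite_finite_induct) (auto simp: poly_ring_mult)

lemma poly_ring_power: "p \<in> poly_ring X \<Longrightarrow> p ^ n \<in> poly_ring X"
  using poly_ring_const[of 1 X] by (induction n) (auto simp: poly_ring_mult)

lemma poly_ring_mono: "X \<subseteq> Y \<Longrightarrow> p \<in> poly_ring X \<Longrightarrow> p \<in> poly_ring Y"
  by (auto simp: poly_ring_def)

lemma poly_ring_subst:
  assumes "p \<in> poly_ring X" "\<And>x. x \<in> X \<Longrightarrow> \<theta> x \<in> poly_ring Y"
  shows "subst \<theta> p \<in> poly_ring Y"
  unfolding subst_eq mono_eval_def
proof (intro poly_ring_sum poly_ring_mult poly_ring_const poly_ring_prod poly_ring_power)
  fix u x assume "u \<in> Poly_Mapping.keys p" "x \<in> Poly_Mapping.keys u"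
  then have "x \<in> X" using assms(1) unfolding poly_ring_def by blast
  then show "\<theta> x \<in> poly_ring Y" by (rule assms(2))
qed

section \<open>Degree and homogeneity\<close>

lemma mono_degree_superset:
  assumes "finite X" "Poly_Mapping.keys u \<subseteq> X"
  shows "mono_degree u = (\<Sum>x\<in>X. Poly_Mapping.lookup u x)"
  unfolding mono_degree_def using assms by (intro sum.mono_neutral_left) (auto simp: in_keys_iff)

lemma mono_degree_add: "mono_degree (u + v) = mono_degree u + mono_degree v"
proof -
  let ?X = "Poly_Mapping.keys u \<union> Poly_Mapping.keys v"
  have k: "Poly_Mapping.keys (u + v) \<subseteq> ?X" by (rule keys_add)
  show ?thesis by (simp add: mono_degree_superset[of ?X] k lookup_add sum.distrib)
qed

lemma mono_degree_zero [simp]: "mono_degree 0 = 0"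
  and mono_degree_single [simp]: "mono_degree (Poly_Mapping.single x n) = n"
  by (simp_all add: mono_degree_def)

lemma homogeneous_zero [simp]: "homogeneous d 0" by (simp add: homogeneous_def)

lemma homogeneous_add: "homogeneous d p \<Longrightarrow> homogeneous d q \<Longrightarrow> homogeneous d (p + q)"
  using keys_add[of p q] by (auto simp: homogeneous_def)

lemma homogeneous_mult: "homogeneous d p \<Longrightarrow> homogeneous e q \<Longrightarrow> homogeneous (d + e) (p * q)"
proof -
  assume *: "homogeneous d p" "homogeneous e q"
  show ?thesis unfolding homogeneous_def
  proof
    fix u assume "u \<in> Poly_Mapping.keys (p * q)"
    then obtain a b where "u = a + b" "a \<in> Poly_Mapping.keys p" "b \<in> Poly_Mapping.keys q"
      using keys_mult[of p q] by blast
    then show "mono_degree u = d + e" using * by (auto simp: homogeneous_def mono_degree_add)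
  qed
qed

lemma homogeneous_const [simp]: "homogeneous 0 (const c)"
  by (auto simp: homogeneous_def const_def)

lemma homogeneous_var [simp]: "homogeneous 1 (var x)"
  by (auto simp: homogeneous_def var_def)

lemma homogeneous_scal: "homogeneous d p \<Longrightarrow> homogeneous d (scal c p)"
  using homogeneous_mult[OF homogeneous_const, of d p c] by (simp add: scal_def)

lemma homogeneous_sum: "(\<And>i. i \<in> I \<Longrightarrow> homogeneous d (f i)) \<Longrightarrow> homogeneous d (\<Sum>i\<in>I. f i)"
  by (induction I rule: infinite_finite_induct) (auto simp: homogeneous_add)

lemma homogeneous_prod: "(\<And>i. i \<in> I \<Longrightarrow> homogeneous (e i) (f i)) \<Longrightarrow> homogeneous (\<Sum>i\<in>I. e i) (\<Prod>i\<in>I. f i)"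
  using homogeneous_const[of 1] by (induction I rule: infinite_finite_induct) (auto simp: homogeneous_mult)

lemma homogeneous_power: "homogeneous d p \<Longrightarrow> homogeneous (n * d) (p ^ n)"
  using homogeneous_const[of 1] by (induction n) (auto simp: homogeneous_mult)

lemma homogeneous_subst:
  assumes "p \<in> poly_ring X" "\<And>x. x \<in> X \<Longrightarrow> homogeneous e (\<theta> x)" "homogeneous d p"
  shows "homogeneous (d * e) (subst \<theta> p)"
  unfolding subst_eq
proof (rule homogeneous_sum)
  fix u assume u: "u \<in> Poly_Mapping.keys p"
  then have k: "Poly_Mapping.keys u \<subseteq> X" and d: "mono_degree u = d" using assms by (auto simp: poly_ring_def homogeneous_def)
  have "homogeneous (\<Sum>x\<in>Poly_Mapping.keys u. Poly_Mapping.lookup u x * e) (mono_eval \<theta> u)"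
    unfolding mono_eval_def using k assms(2) by (intro homogeneous_prod homogeneous_power) auto
  moreover have "(\<Sum>x\<in>Poly_Mapping.keys u. Poly_Mapping.lookup u x * e) = d * e"
    using d unfolding mono_degree_def by (simp flip: sum_distrib_right)
  ultimately have "homogeneous (d * e) (mono_eval \<theta> u)" by simp
  then show "homogeneous (d * e) (const (Poly_Mapping.lookup p u) * mono_eval \<theta> u)"
    using homogeneous_scal[of "d * e"] by (simp add: scal_def)
qed

lemma mono_degree_zero_iff: "mono_degree u = 0 \<longleftrightarrow> u = 0"
proof
  assume "mono_degree u = 0"
  then have "\<forall>x\<in>Poly_Mapping.keys u. Poly_Mapping.lookup u x = 0" by (simp add: mono_degree_def)
  then show "u = 0" by (intro poly_mapping_eqI) (auto simp: in_keys_iff)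
qed simp

lemma monomial_split:
  assumes "mono_degree u = Suc d" "Poly_Mapping.keys u \<subseteq> X"
  obtains x v where "x \<in> X" "u = Poly_Mapping.single x 1 + v" "mono_degree v = d" "Poly_Mapping.keys v \<subseteq> X"
proof -
  have "u \<noteq> 0" using assms(1) by auto
  then obtain x where x: "x \<in> Poly_Mapping.keys u" by (metis keys_eq_empty all_not_in_conv)
  define v where "v = u - Poly_Mapping.single x 1"
  have "u = Poly_Mapping.single x 1 + v"
    using x by (intro poly_mapping_eqI) (auto simp: v_def lookup_add lookup_minus lookup_single when_def in_keys_iff)
  moreover from this have "mono_degree v = d" using assms(1) by (simp add: mono_degree_add)
  moreover have "Poly_Mapping.keys v \<subseteq> Poly_Mapping.keys u"
    by (auto simp: v_def in_keys_iff lookup_minus)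
  ultimately show ?thesis using that x assms(2) by blast
qed

text \<open>Reduces a statement that is stable under addition to scalar multiples of monomials of
  the given degree.\<close>

lemma homogeneous_subspace_induct:
  assumes p: "p \<in> poly_ring X" "homogeneous d p"
    and zero: "P 0" and add: "\<And>p q. P p \<Longrightarrow> P q \<Longrightarrow> P (p + q)"
    and mono: "\<And>c u. Poly_Mapping.keys u \<subseteq> X \<Longrightarrow> mono_degree u = d \<Longrightarrow> P (scal c (mono_eval var u))"
  shows "P p"
proof -
  have S: "P (\<Sum>i\<in>I. f i)" if "finite I" "\<And>i. i \<in> I \<Longrightarrow> P (f i)" for I and f :: "('a \<Rightarrow>\<^sub>0 nat) \<Rightarrow> _"
    using that by (induction I rule: finite_induct) (auto simp: zero add)
  have "P (\<Sum>u\<in>Poly_Mapping.keys p. scal (Poly_Mapping.lookup p u) (mono_eval var u))"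
    using p by (intro S mono) (auto simp: poly_ring_def homogeneous_def)
  then show ?thesis
    using mpoly_sum_monomials[of p] by (simp add: mono_eval_var scal_single)
qed

section \<open>Minors of products\<close>

lemma pick_subset:
  assumes "I \<in> subsets t m" "a < t"
  shows "pick I a \<in> I" "pick I a < m"
proof -
  show "pick I a \<in> I" using assms by (intro pick_in_set_le) (simp add: subsets_def)
  then show "pick I a < m" using assms(1) by (auto simp: subsets_def)
qed

lemma pick_bij:
  assumes "I \<in> subsets t m"
  shows "bij_betw (pick I) {0..<t} I"
proof -
  have fin: "finite I" "card I = t" using assms by (auto simp: subsets_def dest: finite_subset)
  have "inj_on (pick I) {0..<t}"
  proof (rule inj_onI)
    fix a b assume "a \<in> {0..<t}" "b \<in> {0..<t}" "pick I a = pick I b"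
    then show "a = b" using pick_mono_le[of a I b] pick_mono_le[of b I a] fin
      by (cases a b rule: linorder_cases) auto
  qed
  moreover have "pick I ` {0..<t} \<subseteq> I" using pick_subset[OF assms] by auto
  ultimately show ?thesis using fin by (simp add: bij_betw_def card_subset_eq card_image)
qed

lemma minor_eq:
  assumes A: "A \<in> carrier_mat m n" and I: "I \<in> subsets t m" and J: "J \<in> subsets t n"
  shows "minor A I J = det (mat t t (\<lambda>(a, b). A $$ (pick I a, pick J b)))"
proof -
  have "{i. i < dim_row A \<and> i \<in> I} = I" "{j. j < dim_col A \<and> j \<in> J} = J"
    using A I J by (auto simp: subsets_def)
  then show ?thesis using I J by (simp add: minor_def submatrix_def subsets_def)
qed

lemma minor_cong:
  assumes "A \<in> carrier_mat m n" "B \<in> carrier_mat m' n'"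
    and "I \<in> subsets t m" "J \<in> subsets t n" "I \<in> subsets t m'" "J \<in> subsets t n'"
    and "\<And>i j. i \<in> I \<Longrightarrow> j \<in> J \<Longrightarrow> A $$ (i, j) = B $$ (i, j)"
  shows "minor A I J = minor B I J"
  unfolding minor_eq[OF assms(1,3,4)] minor_eq[OF assms(2,5,6)]
  using assms pick_subset by (intro arg_cong[of _ _ det] cong_mat) auto

lemma (in comm_ring_hom) minor_hom:
  assumes "A \<in> carrier_mat m n" "I \<in> subsets t m" "J \<in> subsets t n"
  shows "minor (map_mat hom A) I J = hom (minor A I J)"
proof -
  have "minor (map_mat hom A) I J = det (map_mat hom (mat t t (\<lambda>(a, b). A $$ (pick I a, pick J b))))"
    unfolding minor_eq[OF map_carrier_mat[THEN iffD2, OF assms(1)] assms(2,3)]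
    using assms pick_subset by (intro arg_cong[of _ _ det] eq_matI) auto
  then show ?thesis unfolding minor_eq[OF assms] by simp
qed

lemma minor_transpose:
  assumes "A \<in> carrier_mat m n" "I \<in> subsets t m" "J \<in> subsets t n"
  shows "minor (transpose_mat A) J I = minor A I J"
proof -
  have "minor (transpose_mat A) J I = det (transpose_mat (mat t t (\<lambda>(a, b). A $$ (pick I a, pick J b))))"
    unfolding minor_eq[OF transpose_carrier_mat[THEN iffD2, OF assms(1)] assms(3,2)]
    using assms pick_subset by (intro arg_cong[of _ _ det] eq_matI) auto
  also have "\<dots> = minor A I J" unfolding minor_eq[OF assms] by (rule det_transpose[of _ t]) simp
  finally show ?thesis .
qed

lemma det_zero_row:
  assumes "A \<in> carrier_mat t t" "a < t" "\<And>b. b < t \<Longrightarrow> A $$ (a, b) = 0"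
  shows "det A = 0"
  unfolding det_def'[OF assms(1)]
proof (rule sum.neutral, rule ballI)
  fix p assume "p \<in> {p. p permutes {0..<t}}"
  then have "p a < t" using permutes_in_image[of p "{0..<t}" a] assms(2) by simp
  then have "(\<Prod>i = 0..<t. A $$ (i, p i)) = 0" using assms by (intro prod_zero bexI[of _ a]) auto
  then show "signof p * (\<Prod>i = 0..<t. A $$ (i, p i)) = 0" by simp
qed

lemma minor_zero_row:
  assumes "A \<in> carrier_mat m n" "I \<in> subsets t m" "J \<in> subsets t n" "i \<in> I" "\<And>j. j \<in> J \<Longrightarrow> A $$ (i, j) = 0"
  shows "minor A I J = 0"
proof -
  obtain a where a: "a < t" "pick I a = i"
    using bij_betw_imp_surj_on[OF pick_bij[OF assms(2)]] assms(4) by force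
  show ?thesis unfolding minor_eq[OF assms(1-3)]
    by (rule det_zero_row[of _ _ a]) (use a assms pick_subset in auto)
qed

lemma minor_one:
  assumes "I \<in> subsets t m" "J \<in> subsets t m"
  shows "minor (1\<^sub>m m) I J = (if I = J then 1 else 0)"
proof (cases "I = J")
  case True
  have "minor (1\<^sub>m m) I I = det (1\<^sub>m t :: 'a mat)"
    unfolding minor_eq[OF one_carrier_mat assms(1) assms(1)]
    using bij_betw_imp_inj_on[OF pick_bij[OF assms(1)]] pick_subset[OF assms(1)]
    by (intro arg_cong[of _ _ det] eq_matI) (auto simp: inj_on_def)
  with True show ?thesis by simp
next
  case False
  have "finite J" "card I = card J" using assms by (auto simp: subsets_def dest: finite_subset)
  then have "\<not> I \<subseteq> J" using False card_subset_eq by blast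
  then obtain i where "i \<in> I" "i \<notin> J" by auto
  have "(1\<^sub>m m :: 'a mat) $$ (i, j) = 0" if "j \<in> J" for j
  proof -
    have "i < m" "j < m" using \<open>i \<in> I\<close> that assms by (auto simp: subsets_def)
    moreover have "i \<noteq> j" using \<open>i \<notin> J\<close> that by auto
    ultimately show ?thesis by simp
  qed
  then show ?thesis using False minor_zero_row[OF one_carrier_mat assms \<open>i \<in> I\<close>] by auto
qed

section \<open>The Cauchy-Binet formula\<close>

text \<open>Each row of the product is a combination of the rows of \<open>B\<close>; by
  multilinearity the determinant is a sum over the choices \<open>f\<close> of one such row for
  every index.\<close>

lemma det_row_function:
  fixes A B :: "nat \<Rightarrow> nat \<Rightarrow> 'a::comm_ring_1"
  shows "det (mat t t (\<lambda>(a, b). \<Sum>k<n. A a k * B k b)) =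
    (\<Sum>f\<in>{0..<t} \<rightarrow>\<^sub>E {..<n}. (\<Prod>a = 0..<t. A a (f a)) * det (mat t t (\<lambda>(a, b). B (f a) b)))"
proof -
  let ?P = "{p. p permutes {0..<t}}"
  have pt: "p a < t" if "p \<in> ?P" "a < t" for p a using that permutes_in_image[of p "{0..<t}" a] by simp
  have "det (mat t t (\<lambda>(a, b). \<Sum>k<n. A a k * B k b)) =
    (\<Sum>p\<in>?P. signof p * (\<Prod>a = 0..<t. \<Sum>k<n. A a k * B k (p a)))"
    by (subst det_def'[of _ t]) (auto intro!: sum.cong prod.cong arg_cong2[of _ _ _ _ "(*)"] simp: pt)
  also have "\<dots> = (\<Sum>p\<in>?P. signof p * (\<Sum>f\<in>{0..<t} \<rightarrow>\<^sub>E {..<n}. \<Prod>a = 0..<t. A a (f a) * B (f a) (p a)))"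
    by (subst prod_sum_PiE) auto
  also have "\<dots> = (\<Sum>f\<in>{0..<t} \<rightarrow>\<^sub>E {..<n}. \<Sum>p\<in>?P. (\<Prod>a = 0..<t. A a (f a)) * (signof p * (\<Prod>a = 0..<t. B (f a) (p a))))"
    unfolding sum_distrib_left by (subst sum.swap) (simp add: prod.distrib ac_simps)
  also have "\<dots> = (\<Sum>f\<in>{0..<t} \<rightarrow>\<^sub>E {..<n}. (\<Prod>a = 0..<t. A a (f a)) * det (mat t t (\<lambda>(a, b). B (f a) b)))"
    unfolding sum_distrib_left[symmetric]
    by (intro sum.cong refl arg_cong2[of _ _ _ _ "(*)"], subst det_def'[of _ t])
      (auto intro!: sum.cong prod.cong arg_cong2[of _ _ _ _ "(*)"] simp: pt)
  finally show ?thesis .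
qed

text \<open>An injective choice is its image \<open>K\<close> together with the order in which it
  lists \<open>K\<close>.\<close>

lemma injective_choices_bij:
  "bij_betw (\<lambda>(K, p). restrict (\<lambda>a. pick K (p a)) {0..<t})
     (subsets t n \<times> {p. p permutes {0..<t}}) {f\<in>{0..<t} \<rightarrow>\<^sub>E {..<n}. inj_on f {0..<t}}"
  (is "bij_betw ?h (_ \<times> ?P) ?F")
proof (rule bij_betw_imageI)
  let ?U = "{0..<t}"
  have im: "?h (K, p) ` ?U = K" if "K \<in> subsets t n" "p permutes ?U" for K p
  proof -
    have "?h (K, p) ` ?U = pick K ` (p ` ?U)" by (simp add: image_image)
    also have "\<dots> = K" using bij_betw_imp_surj_on[OF pick_bij[OF that(1)]] permutes_image[OF that(2)] by simp
    finally show ?thesis .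
  qed
  show "inj_on ?h (subsets t n \<times> ?P)"
  proof (rule inj_onI)
    fix x y assume x: "x \<in> subsets t n \<times> ?P" and y: "y \<in> subsets t n \<times> ?P" and eq: "?h x = ?h y"
    obtain K p K' p' where xy: "x = (K, p)" "y = (K', p')" by fastforce
    have K: "K \<in> subsets t n" "p permutes ?U" "K' \<in> subsets t n" "p' permutes ?U" using x y xy by auto
    have "K = K'" using im[OF K(1,2)] im[OF K(3,4)] eq unfolding xy by metis
    moreover have "p = p'"
    proof
      fix a
      show "p a = p' a"
      proof (cases "a \<in> ?U")
        case True
        then have "pick K (p a) = pick K (p' a)" using fun_cong[OF eq, of a] \<open>K = K'\<close> xy by simp
        moreover have "p a \<in> ?U" "p' a \<in> ?U" using True permutes_in_image K by metis+
        ultimately show ?thesis using bij_betw_imp_inj_on[OF pick_bij[OF K(1)]] by (meson inj_onD)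
      next
        case False then show ?thesis using K by (simp add: permutes_not_in)
      qed
    qed
    ultimately show "x = y" using xy by simp
  qed
  show "?h ` (subsets t n \<times> ?P) = ?F"
  proof
    show "?h ` (subsets t n \<times> ?P) \<subseteq> ?F"
    proof (rule image_subsetI)
      fix x assume "x \<in> subsets t n \<times> ?P"
      then obtain K p where x: "x = (K, p)" and K: "K \<in> subsets t n" "p permutes ?U" by auto
      have pU: "p a \<in> ?U" if "a \<in> ?U" for a using that permutes_in_image[OF K(2)] by blast
      have "card (?h x ` ?U) = t" using im[OF K] K unfolding x by (simp add: subsets_def)
      then have "inj_on (?h x) ?U" by (intro eq_card_imp_inj_on) auto
      moreover have "?h x \<in> ?U \<rightarrow>\<^sub>E {..<n}" using pU pick_subset(2)[OF K(1)] by (auto simp: x)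
      ultimately show "?h x \<in> ?F" by simp
    qed
    show "?F \<subseteq> ?h ` (subsets t n \<times> ?P)"
    proof
      fix f assume "f \<in> ?F"
      then have f: "f \<in> ?U \<rightarrow>\<^sub>E {..<n}" "inj_on f ?U" by auto
      define K where "K = f ` ?U"
      have K: "K \<in> subsets t n" using f card_image[OF f(2)] by (auto simp: subsets_def K_def)
      let ?g = "the_inv_into ?U (pick K)"
      define p where "p a = (if a \<in> ?U then ?g (f a) else a)" for a
      have "bij_betw (?g \<circ> f) ?U ?U"
        using bij_betw_the_inv_into[OF pick_bij[OF K]] f(2) by (intro bij_betw_trans[of f _ K]) (auto simp: bij_betw_def K_def)
      then have "bij_betw p ?U ?U" by (rule bij_betw_cong[THEN iffD1, rotated]) (simp add: p_def)
      then have "p permutes ?U" by (rule bij_imp_permutes) (simp add: p_def)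
      moreover have "f = ?h (K, p)"
      proof
        fix a
        show "f a = ?h (K, p) a"
        proof (cases "a \<in> ?U")
          case True
          then have "f a \<in> K" by (auto simp: K_def)
          then show ?thesis using True f_the_inv_into_f_bij_betw[OF pick_bij[OF K]] by (simp add: p_def)
        next
          case False then show ?thesis using PiE_arb[OF f(1)] by simp
        qed
      qed
      ultimately show "f \<in> ?h ` (subsets t n \<times> ?P)" using K by blast
    qed
  qed
qed

text \<open>Choices that repeat a row contribute zero. For the injective ones the permutation part
  reassembles the minor of \<open>A\<close>, while sorting the rows turns the remaining determinant
  into a minor of \<open>B\<close> up to sign.\<close>

lemma cauchy_binet:
  fixes A B :: "'a::comm_ring_1 mat"
  assumes A: "A \<in> carrier_mat m n" and B: "B \<in> carrier_mat n p" and I: "I \<in> subsets t m" and J: "J \<in> subsets t p"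
  shows "minor (A * B) I J = (\<Sum>K\<in>subsets t n. minor A I K * minor B K J)"
proof -
  let ?U = "{0..<t}" and ?P = "{p. p permutes {0..<t}}"
  let ?A = "\<lambda>a k. A $$ (pick I a, k)" and ?B = "\<lambda>k b. B $$ (k, pick J b)"
  let ?G = "\<lambda>f. (\<Prod>a = 0..<t. ?A a (f a)) * det (mat t t (\<lambda>(a, b). ?B (f a) b))"
  have "minor (A * B) I J = det (mat t t (\<lambda>(a, b). \<Sum>k<n. ?A a k * ?B k b))"
    unfolding minor_eq[OF mult_carrier_mat[OF A B] I J]
    using A B pick_subset[OF I] pick_subset[OF J]
    by (intro arg_cong[of _ _ det] eq_matI) (auto simp: scalar_prod_def lessThan_atLeast0)
  also have "\<dots> = (\<Sum>f\<in>?U \<rightarrow>\<^sub>E {..<n}. ?G f)" by (rule det_row_function)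
  also have "\<dots> = (\<Sum>f\<in>{f\<in>?U \<rightarrow>\<^sub>E {..<n}. inj_on f ?U}. ?G f)"
  proof (rule sum.mono_neutral_right)
    show "\<forall>f\<in>(?U \<rightarrow>\<^sub>E {..<n}) - {f\<in>?U \<rightarrow>\<^sub>E {..<n}. inj_on f ?U}. ?G f = 0"
    proof
      fix f assume "f \<in> (?U \<rightarrow>\<^sub>E {..<n}) - {f\<in>?U \<rightarrow>\<^sub>E {..<n}. inj_on f ?U}"
      then obtain a a' where a: "a < t" "a' < t" "a \<noteq> a'" "f a = f a'" by (auto simp: inj_on_def)
      have "det (mat t t (\<lambda>(a, b). ?B (f a) b)) = 0"
        by (rule det_identical_rows[OF _ a(3) a(1,2)]) (use a in auto)
      then show "?G f = 0" by simp
    qed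
  qed (auto simp: finite_PiE)
  also have "\<dots> = (\<Sum>x\<in>subsets t n \<times> ?P. ?G ((\<lambda>(K, p). restrict (\<lambda>a. pick K (p a)) ?U) x))"
    by (rule sum.reindex_bij_betw[OF injective_choices_bij, symmetric])
  also have "\<dots> = (\<Sum>K\<in>subsets t n. \<Sum>p\<in>?P. ?G (restrict (\<lambda>a. pick K (p a)) ?U))"
    by (simp add: sum.cartesian_product split_def)
  also have "\<dots> = (\<Sum>K\<in>subsets t n. minor A I K * minor B K J)"
  proof (rule sum.cong[OF refl])
    fix K assume K: "K \<in> subsets t n"
    have G: "?G (restrict (\<lambda>a. pick K (p a)) ?U) = (signof p * (\<Prod>a = 0..<t. ?A a (pick K (p a)))) * minor B K J"
      if p: "p \<in> ?P" for p
    proof -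
      have pt: "p a < t" if "a < t" for a using p that permutes_in_image[of p ?U a] by simp
      have "mat t t (\<lambda>(a, b). ?B (restrict (\<lambda>a. pick K (p a)) ?U a) b) =
        mat t t (\<lambda>(a, b). mat t t (\<lambda>(a, b). ?B (pick K a) b) $$ (p a, b))"
        using pt by (intro cong_mat) auto
      then have "det (mat t t (\<lambda>(a, b). ?B (restrict (\<lambda>a. pick K (p a)) ?U a) b)) = signof p * minor B K J"
        unfolding minor_eq[OF B K J] using p det_permute_rows[of "mat t t (\<lambda>(a, b). ?B (pick K a) b)" t p] by simp
      then show ?thesis by (simp add: ac_simps)
    qed
    have mA: "minor A I K = (\<Sum>p\<in>?P. signof p * (\<Prod>a = 0..<t. ?A a (pick K (p a))))"
      unfolding minor_eq[OF A I K]
      by (subst det_def'[of _ t])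
         (auto intro!: sum.cong prod.cong arg_cong2[of _ _ _ _ "(*)"] dest: permutes_in_image)
    show "(\<Sum>p\<in>?P. ?G (restrict (\<lambda>a. pick K (p a)) ?U)) = minor A I K * minor B K J"
      unfolding mA sum_distrib_right by (rule sum.cong[OF refl]) (rule G)
  qed
  finally show ?thesis .
qed

section \<open>Functoriality\<close>

text \<open>\<open>ract t q C\<close> is contravariant in \<open>W\<close>: a \<open>p \<times> q\<close> matrix \<open>C\<close> maps \<open>S\<^sub>t(m, p)\<close> to \<open>S\<^sub>t(m, q)\<close>. The
  action of \<open>B \<in> GL(W)\<close> is \<open>ract t n B\<^sup>-\<^sup>1\<close>.\<close>

definition ract :: "nat \<Rightarrow> nat \<Rightarrow> 'k::field mat \<Rightarrow> (nat set \<times> nat set, 'k) mpoly \<Rightarrow> (nat set \<times> nat set, 'k) mpoly" where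
  "ract t q C = subst (\<lambda>(I, J). \<Sum>L\<in>subsets t q. scal (minor C J L) (var (I, L)))"

definition lact :: "nat \<Rightarrow> nat \<Rightarrow> 'k::field mat \<Rightarrow> (nat set \<times> nat set, 'k) mpoly \<Rightarrow> (nat set \<times> nat set, 'k) mpoly" where
  "lact t m A = subst (\<lambda>(I, J). \<Sum>K\<in>subsets t m. scal (minor A K I) (var (K, J)))"

lemma ract_add: "ract t q C (f + g) = ract t q C f + ract t q C g"
  and ract_scal: "ract t q C (scal c f) = scal c (ract t q C f)"
  and ract_mult: "ract t q C (f * g) = ract t q C f * ract t q C g"
  and ract_sum: "ract t q C (\<Sum>i\<in>X. h i) = (\<Sum>i\<in>X. ract t q C (h i))"
  and ract_zero [simp]: "ract t q C 0 = 0"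
  by (simp_all add: ract_def subst_add subst_scal subst_mult subst_sum)

lemma lact_scal: "lact t m A (scal c f) = scal c (lact t m A f)"
  and lact_sum: "lact t m A (\<Sum>i\<in>X. h i) = (\<Sum>i\<in>X. lact t m A (h i))"
  by (simp_all add: lact_def subst_scal subst_sum)

lemma ract_var: "ract t q C (var (I, J)) = (\<Sum>L\<in>subsets t q. scal (minor C J L) (var (I, L)))"
  by (simp add: ract_def)

lemma ract_S_ring: "f \<in> S_ring t m p \<Longrightarrow> ract t q C f \<in> S_ring t m q"
  unfolding S_ring_def ract_def
  by (erule poly_ring_subst) (auto intro!: poly_ring_sum poly_ring_scal poly_ring_var)

lemma lact_S_ring: "f \<in> S_ring t m p \<Longrightarrow> lact t m A f \<in> S_ring t m p"
  unfolding S_ring_def lact_def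
  by (erule poly_ring_subst) (auto intro!: poly_ring_sum poly_ring_scal poly_ring_var)

lemma ract_homogeneous:
  assumes "f \<in> S_ring t m p" "homogeneous d f"
  shows "homogeneous d (ract t q C f)"
proof -
  have "homogeneous (d * 1) (ract t q C f)"
    unfolding ract_def
    by (rule homogeneous_subst[OF assms(1)[unfolded S_ring_def] _ assms(2)])
      (auto intro!: homogeneous_sum homogeneous_scal simp del: One_nat_def)
  then show ?thesis by simp
qed

lemma ract_ract:
  assumes f: "f \<in> S_ring t m p" and C: "C \<in> carrier_mat p q" and C': "C' \<in> carrier_mat q q'"
  shows "ract t q' C' (ract t q C f) = ract t q' (C * C') f"
  unfolding ract_def subst_subst
proof (rule subst_cong[OF f[unfolded S_ring_def]], clarify)
  fix I J assume J: "J \<in> subsets t p"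
  have "(\<Sum>L\<in>subsets t q. scal (minor C J L) (\<Sum>L'\<in>subsets t q'. scal (minor C' L L') (var (I, L')))) =
    (\<Sum>L'\<in>subsets t q'. scal (\<Sum>L\<in>subsets t q. minor C J L * minor C' L L') (var (I, L')))"
    by (simp add: scal_sum scal_sum_left) (rule sum.swap)
  then show "subst (\<lambda>(I, J). \<Sum>L\<in>subsets t q'. scal (minor C' J L) (var (I, L)))
       (\<Sum>L\<in>subsets t q. scal (minor C J L) (var (I, L))) =
      (\<Sum>L\<in>subsets t q'. scal (minor (C * C') J L) (var (I, L)))"
    by (simp add: subst_sum subst_scal cauchy_binet[OF C C' J])
qed

lemma ract_one:
  assumes f: "f \<in> S_ring t m p"
  shows "ract t p (1\<^sub>m p) f = f"
proof -
  have "ract t p (1\<^sub>m p) f = subst var f"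
    unfolding ract_def
  proof (rule subst_cong[OF f[unfolded S_ring_def]], clarify)
    fix I J assume J: "J \<in> subsets t p"
    have "(\<Sum>L\<in>subsets t p. scal (minor (1\<^sub>m p) J L) (var (I, L))) = (\<Sum>L\<in>subsets t p. if J = L then var (I, L) else 0 :: (_, 'a) mpoly)"
      by (intro sum.cong refl) (simp add: minor_one[OF J])
    then show "(\<Sum>L\<in>subsets t p. scal (minor (1\<^sub>m p) J L) (var (I, L))) = (var (I, J) :: (_, 'a) mpoly)"
      using J by simp
  qed
  then show ?thesis by (simp add: subst_var_id)
qed

lemma lact_one:
  assumes f: "f \<in> S_ring t m p"
  shows "lact t m (1\<^sub>m m) f = f"
proof -
  have "lact t m (1\<^sub>m m) f = subst var f"
    unfolding lact_def
  proof (rule subst_cong[OF f[unfolded S_ring_def]], clarify)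
    fix I J assume I: "I \<in> subsets t m"
    have "(\<Sum>K\<in>subsets t m. scal (minor (1\<^sub>m m) K I) (var (K, J))) = (\<Sum>K\<in>subsets t m. if K = I then var (K, J) else 0 :: (_, 'a) mpoly)"
      by (intro sum.cong refl) (simp add: minor_one[OF _ I])
    then show "(\<Sum>K\<in>subsets t m. scal (minor (1\<^sub>m m) K I) (var (K, J))) = (var (I, J) :: (_, 'a) mpoly)"
      using I by simp
  qed
  then show ?thesis by (simp add: subst_var_id)
qed

lemma lact_ract: "lact t m A (ract t q C f) = ract t q C (lact t m A f)"
  unfolding ract_def lact_def subst_subst
  by (rule arg_cong[where f = "\<lambda>\<theta>. subst \<theta> f"])
    (auto simp: fun_eq_iff subst_sum subst_scal scal_sum mult.commute intro: sum.swap)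

text \<open>The action of the product group separates into commuting halves, of which the right half
  extends to rectangular matrices.\<close>

lemma S_act_eq: "S_act t m n A B f = lact t m A (ract t n (inv\<^bsub>GL n\<^esub> B) f)"
  unfolding S_act_def ract_def lact_def subst_subst
  by (rule arg_cong[where f = "\<lambda>\<theta>. subst \<theta> f"])
    (auto simp: fun_eq_iff subst_sum subst_scal scal_sum mult.commute intro: sum.swap)

lemma generic_mat_carrier [simp]: "generic_mat m n \<in> carrier_mat m n"
  by (simp add: generic_mat_def)

text \<open>By Cauchy-Binet the right action corresponds to replacing the generic matrix X by X
  times the transpose of \<open>C\<close>. Hence relations go to relations, also for rectangular
  \<open>C\<close>.\<close>

lemma minor_map_ract:
  assumes f: "f \<in> S_ring t m p" and C: "C \<in> carrier_mat p q"
  shows "minor_map m q (ract t q C f) =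
    subst (\<lambda>(i, j). \<Sum>l<q. scal (C $$ (j, l)) (var (i, l))) (minor_map m p f)"
  (is "_ = subst ?\<kappa> _")
  unfolding ract_def minor_map_def subst_subst
proof (rule subst_cong[OF f[unfolded S_ring_def]], clarify)
  fix I J assume I: "I \<in> subsets t m" and J: "J \<in> subsets t p"
  let ?C = "transpose_mat (map_mat const C)"
  have tC: "?C \<in> carrier_mat q p" using C by simp
  have "subst ?\<kappa> (minor (generic_mat m p) I J) = minor (map_mat (subst ?\<kappa>) (generic_mat m p)) I J"
    by (rule subst.minor_hom[symmetric, OF _ I J]) simp
  also have "map_mat (subst ?\<kappa>) (generic_mat m p) = generic_mat m q * ?C"
    using C by (intro eq_matI) (auto simp: generic_mat_def scalar_prod_def scal_def lessThan_atLeast0 mult.commute)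
  also have "minor (generic_mat m q * ?C) I J = (\<Sum>L\<in>subsets t q. minor (generic_mat m q) I L * minor ?C L J)"
    by (rule cauchy_binet[OF _ tC I J]) simp
  also have "\<dots> = (\<Sum>L\<in>subsets t q. scal (minor C J L) (minor (generic_mat m q) I L))"
    using C J by (intro sum.cong refl) (simp add: minor_transpose[of _ p q] const.minor_hom[OF C J] scal_def mult.commute)
  finally show "subst (\<lambda>(I, J). minor (generic_mat m q) I J) (\<Sum>L\<in>subsets t q. scal (minor C J L) (var (I, L))) =
     subst ?\<kappa> (minor (generic_mat m p) I J)"
    by (simp add: subst_sum subst_scal)
qed

lemma ract_J_ideal: "f \<in> J_ideal t m p \<Longrightarrow> C \<in> carrier_mat p q \<Longrightarrow> ract t q C f \<in> J_ideal t m q"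
  by (auto simp: J_ideal_def ract_S_ring minor_map_ract)

lemma span_subspace_induct:
  assumes "x \<in> kpoly.span S" "\<And>x. x \<in> S \<Longrightarrow> P x" "P 0" "\<And>x y. P x \<Longrightarrow> P y \<Longrightarrow> P (x + y)" "\<And>c x. P x \<Longrightarrow> P (scal c x)"
  shows "P x"
  by (rule kpoly.span_induct[OF assms(1)]) (use assms in \<open>auto simp: kpoly.subspace_def\<close>)

text \<open>The right action is multiplicative and preserves both degree and relations. This is what
  allows minimality to be compared between different dimensions of W.\<close>

lemma ract_S1J:
  fixes C :: "'k::field mat"
  assumes "f \<in> S1J t m p" "C \<in> carrier_mat p q"
  shows "ract t q C f \<in> S1J t m q"
  using assms(1) unfolding S1J_def
proof (rule span_subspace_induct)
  fix x :: "(nat set \<times> nat set, 'k) mpoly"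
  assume "x \<in> {y * f |y f. y \<in> S_ring t m p \<and> homogeneous 1 y \<and> f \<in> J_ideal t m p}"
  then obtain y f where x: "x = y * f" and y: "y \<in> S_ring t m p" "homogeneous 1 y" "f \<in> J_ideal t m p" by blast
  have "ract t q C x = ract t q C y * ract t q C f" by (simp add: x ract_mult)
  then show "ract t q C x \<in> kpoly.span {y * f |y f. y \<in> S_ring t m q \<and> homogeneous 1 y \<and> f \<in> J_ideal t m q}"
    using ract_S_ring[OF y(1)] ract_homogeneous[OF y(1,2)] ract_J_ideal[OF y(3) assms(2)]
    by (intro kpoly.span_base) blast
qed (simp_all add: ract_add ract_scal kpoly.span_zero kpoly.span_add kpoly.span_scale)

section \<open>Schur modules as functors\<close>

lemma schur_act_add: "schur_act n C (f + g) = schur_act n C f + schur_act n C g"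
  and schur_act_scal: "schur_act n C (scal c f) = scal c (schur_act n C f)"
  and schur_act_zero [simp]: "schur_act n C 0 = 0"
  by (simp_all add: schur_act_def subst_add subst_scal)

lemma schur_act_schur_act:
  assumes w: "w \<in> poly_ring ({..<r} \<times> UNIV)" and C: "C \<in> carrier_mat n p" and C': "C' \<in> carrier_mat p r"
  shows "schur_act n C (schur_act p C' w) = schur_act n (C * C') w"
  unfolding schur_act_def subst_subst
proof (rule subst_cong[OF w], clarify)
  fix i j assume i: "i < r"
  have "(\<Sum>k<p. scal (C' $$ (k, i)) (\<Sum>l<n. scal (C $$ (l, k)) (var (l, j)))) =
    (\<Sum>l<n. scal (\<Sum>k<p. C $$ (l, k) * C' $$ (k, i)) (var (l, j)))"
    by (simp add: scal_sum scal_sum_left mult.commute) (rule sum.swap)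
  also have "\<dots> = (\<Sum>l<n. scal ((C * C') $$ (l, i)) (var (l, j)))"
    using C C' i by (intro sum.cong refl) (simp add: scalar_prod_def lessThan_atLeast0)
  finally show "subst (\<lambda>(i, j). \<Sum>k<n. scal (C $$ (k, i)) (var (k, j))) (\<Sum>k<p. scal (C' $$ (k, i)) (var (k, j))) =
    (\<Sum>k<n. scal ((C * C') $$ (k, i)) (var (k, j)))"
    by (simp add: subst_sum subst_scal)
qed

lemma schur_act_one:
  assumes w: "w \<in> poly_ring ({..<p} \<times> UNIV)"
  shows "schur_act p (1\<^sub>m p) w = w"
proof -
  have "schur_act p (1\<^sub>m p) w = subst var w"
    unfolding schur_act_def
  proof (rule subst_cong[OF w], clarify)
    fix i j assume i: "i < p"
    have "(\<Sum>k<p. scal (1\<^sub>m p $$ (k, i)) (var (k, j))) = (\<Sum>k<p. if k = i then var (k, j) else 0 :: (_, 'a) mpoly)"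
      using i by (intro sum.cong refl) auto
    then show "(\<Sum>k<p. scal (1\<^sub>m p $$ (k, i)) (var (k, j))) = (var (i, j) :: (_, 'a) mpoly)" using i by simp
  qed
  then show ?thesis by (simp add: subst_var_id)
qed

lemma lessThan_subsets [simp]: "{..<l} \<in> subsets l l"
  by (simp add: subsets_def)

lemma schur_act_minor:
  assumes C: "C \<in> carrier_mat n p" and I: "I \<in> subsets l p"
  shows "schur_act n C (minor (generic_mat p l) I {..<l}) =
    (\<Sum>K\<in>subsets l n. scal (minor C K I) (minor (generic_mat n l) K {..<l}))"
proof -
  let ?C = "transpose_mat (map_mat const C)"
  have tC: "?C \<in> carrier_mat p n" using C by simp
  have "schur_act n C (minor (generic_mat p l) I {..<l}) = minor (map_mat (schur_act n C) (generic_mat p l)) I {..<l}"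
    unfolding schur_act_def by (rule subst.minor_hom[symmetric, OF _ I lessThan_subsets]) simp
  also have "map_mat (schur_act n C) (generic_mat p l) = ?C * generic_mat n l"
    using C by (intro eq_matI) (auto simp: generic_mat_def scalar_prod_def scal_def lessThan_atLeast0 schur_act_def)
  also have "minor (?C * generic_mat n l) I {..<l} = (\<Sum>K\<in>subsets l n. minor ?C I K * minor (generic_mat n l) K {..<l})"
    by (rule cauchy_binet[OF tC _ I lessThan_subsets]) simp
  also have "\<dots> = (\<Sum>K\<in>subsets l n. scal (minor C K I) (minor (generic_mat n l) K {..<l}))"
    using C I by (intro sum.cong refl) (simp add: minor_transpose[of _ n p] const.minor_hom[OF C _ I] scal_def)
  finally show ?thesis .
qed

text \<open>By Cauchy-Binet each factor of a generator becomes a combination of minors with the same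
  columns and new rows; multiplying out gives generators again. Rectangular \<open>C\<close> is
  allowed, so this is functoriality in the space and not just a group action.\<close>

lemma schur_act_schur:
  assumes w: "w \<in> schur p \<mu>" and C: "C \<in> carrier_mat n p"
  shows "schur_act n C w \<in> schur n \<mu>"
  using w unfolding schur_def[of p]
proof (rule span_subspace_induct)
  let ?Z = "\<lambda>n k K. minor (generic_mat n (\<mu> ! k)) K {..<\<mu> ! k} :: (_, 'a) mpoly"
  fix x :: "(nat \<times> nat, 'a) mpoly" assume "x \<in> {\<Prod>k<length \<mu>. minor (generic_mat p (\<mu> ! k)) (I k) {..<\<mu> ! k} | I.
        \<forall>k<length \<mu>. I k \<in> subsets (\<mu> ! k) p}"
  then obtain I where x: "x = (\<Prod>k<length \<mu>. ?Z p k (I k))" and I: "\<forall>k<length \<mu>. I k \<in> subsets (\<mu> ! k) p" by blast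
  have "schur_act n C x = (\<Prod>k<length \<mu>. schur_act n C (?Z p k (I k)))"
    unfolding x schur_act_def by (rule subst.hom_prod)
  also have "\<dots> = (\<Prod>k<length \<mu>. \<Sum>K\<in>subsets (\<mu> ! k) n. scal (minor C K (I k)) (?Z n k K))"
    using I by (intro prod.cong refl schur_act_minor[OF C]) auto
  also have "\<dots> = (\<Sum>g\<in>PiE {..<length \<mu>} (\<lambda>k. subsets (\<mu> ! k) n). \<Prod>k<length \<mu>. scal (minor C (g k) (I k)) (?Z n k (g k)))"
    by (rule prod_sum_PiE) auto
  also have "\<dots> = (\<Sum>g\<in>PiE {..<length \<mu>} (\<lambda>k. subsets (\<mu> ! k) n). scal (\<Prod>k<length \<mu>. minor C (g k) (I k)) (\<Prod>k<length \<mu>. ?Z n k (g k)))"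
    by (simp add: scal_def prod.distrib const.hom_prod)
  also have "\<dots> \<in> schur n \<mu>"
    unfolding schur_def by (intro kpoly.span_sum kpoly.span_scale kpoly.span_base) (auto simp: PiE_iff)
  finally show "schur_act n C x \<in> schur n \<mu>" .
qed (simp_all add: schur_act_add schur_act_scal schur_def kpoly.span_zero kpoly.span_add kpoly.span_scale)

lemma generic_minor_poly:
  assumes I: "I \<in> subsets t m" and J: "J \<in> subsets t n"
  shows "(minor (generic_mat m n) I J :: (_, 'k::field) mpoly) \<in> poly_ring (I \<times> J)" "homogeneous t (minor (generic_mat m n) I J :: (_, 'k::field) mpoly)"
proof -
  have eq: "minor (generic_mat m n) I J = (\<Sum>p | p permutes {0..<t}. scal (of_int (sign p)) (\<Prod>a = 0..<t. var (pick I a, pick J (p a)) :: (_, 'k) mpoly))"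
    unfolding minor_eq[OF generic_mat_carrier I J]
    by (subst det_def'[of _ t])
      (auto intro!: sum.cong prod.cong arg_cong2[of _ _ _ _ "(*)"] dest: permutes_in_image
         simp: generic_mat_def pick_subset[OF I] pick_subset[OF J] scal_def const.hom_of_int)
  have p: "p a < t" if "p permutes {0..<t}" "a < t" for p a using permutes_in_image[OF that(1), of a] that by simp
  show "(minor (generic_mat m n) I J :: (_, 'k) mpoly) \<in> poly_ring (I \<times> J)"
    unfolding eq by (intro poly_ring_sum poly_ring_scal poly_ring_prod poly_ring_var) (auto simp: p pick_subset[OF I] pick_subset[OF J])
  have "homogeneous (\<Sum>a = 0..<t. 1) (\<Prod>a = 0..<t. var (pick I a, pick J (p a)) :: (_, 'k) mpoly)" for p
    by (rule homogeneous_prod) (rule homogeneous_var)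
  then show "homogeneous t (minor (generic_mat m n) I J :: (_, 'k) mpoly)"
    unfolding eq by (intro homogeneous_sum homogeneous_scal) simp
qed

text \<open>The bound \<open>r\<close> on the columns matters: with parts at most q, a Schur module
  lives in the coordinate ring of matrices with q columns.\<close>

lemma schur_poly:
  assumes w: "w \<in> schur p \<mu>" and r: "\<forall>k<length \<mu>. \<mu> ! k \<le> r"
  shows "w \<in> poly_ring ({..<p} \<times> {..<r})" "homogeneous (sum_list \<mu>) w"
proof -
  have "w \<in> poly_ring ({..<p} \<times> {..<r}) \<and> homogeneous (sum_list \<mu>) w"
    using w unfolding schur_def
  proof (rule span_subspace_induct)
    fix x :: "(nat \<times> nat, 'a) mpoly" assume "x \<in> {\<Prod>k<length \<mu>. minor (generic_mat p (\<mu> ! k)) (I k) {..<\<mu> ! k} | I.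
        \<forall>k<length \<mu>. I k \<in> subsets (\<mu> ! k) p}"
    then obtain I where x: "x = (\<Prod>k<length \<mu>. minor (generic_mat p (\<mu> ! k)) (I k) {..<\<mu> ! k})"
      and I: "\<forall>k<length \<mu>. I k \<in> subsets (\<mu> ! k) p" by blast
    have "x \<in> poly_ring ({..<p} \<times> {..<r})"
      unfolding x
    proof (rule poly_ring_prod)
      fix k assume k: "k \<in> {..<length \<mu>}"
      have "I k \<times> {..<\<mu> ! k} \<subseteq> {..<p} \<times> {..<r}" using I k r unfolding subsets_def by (intro Sigma_mono) auto
      then show "minor (generic_mat p (\<mu> ! k)) (I k) {..<\<mu> ! k} \<in> poly_ring ({..<p} \<times> {..<r})"
        using I k by (intro poly_ring_mono[OF _ generic_minor_poly(1)]) auto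
    qed
    moreover have "homogeneous (\<Sum>k<length \<mu>. \<mu> ! k) x"
      unfolding x using I by (intro homogeneous_prod generic_minor_poly(2)) auto
    ultimately show "x \<in> poly_ring ({..<p} \<times> {..<r}) \<and> homogeneous (sum_list \<mu>) x"
      by (simp add: sum_list_sum_nth lessThan_atLeast0)
  qed (simp_all add: poly_ring_add poly_ring_scal homogeneous_add homogeneous_scal)
  then show "w \<in> poly_ring ({..<p} \<times> {..<r})" "homogeneous (sum_list \<mu>) w" by auto
qed

lemma schur_poly_UNIV: "w \<in> schur p \<mu> \<Longrightarrow> w \<in> poly_ring ({..<p} \<times> UNIV)"
proof -
  assume w: "w \<in> schur p \<mu>"
  have "\<forall>k<length \<mu>. \<mu> ! k \<le> Max (set \<mu>)" by simp
  from schur_poly(1)[OF w this] show ?thesis by (rule poly_ring_mono[rotated]) auto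
qed

lemma schur_trivial:
  assumes "k < length \<mu>" "n < \<mu> ! k"
  shows "schur n \<mu> = {0}"
proof -
  have "I \<notin> subsets (\<mu> ! k) n" for I
    using assms(2) card_mono[of "{..<n}" I] unfolding subsets_def by auto
  then have "\<not> (\<forall>k<length \<mu>. I k \<in> subsets (\<mu> ! k) n)" for I :: "nat \<Rightarrow> nat set" using assms(1) by blast
  then have none: "{\<Prod>k<length \<mu>. minor (generic_mat n (\<mu> ! k)) (I k) {..<\<mu> ! k} | I.
      \<forall>k<length \<mu>. I k \<in> subsets (\<mu> ! k) n} = ({} :: (_, 'a) mpoly set)" by blast
  show ?thesis unfolding schur_def none by simp
qed

section \<open>Polynomial functors\<close>

text \<open>Forms of degree D in the entries of a matrix, as functions. The generation by single
  entries is what the construction of the linear functional on tensors recurs on. Entries and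
  coefficients lie in the same ring, so matrices of indeterminates may be inserted as well.\<close>

inductive tensorial :: "nat \<Rightarrow> nat \<Rightarrow> nat \<Rightarrow> ((nat \<Rightarrow> nat \<Rightarrow> 'r::comm_ring_1) \<Rightarrow> 'r) \<Rightarrow> bool" for p q where
  const: "tensorial p q 0 (\<lambda>M. v)"
| entry: "i < p \<Longrightarrow> j < q \<Longrightarrow> tensorial p q D P \<Longrightarrow> tensorial p q (Suc D) (\<lambda>M. M i j * P M)"
| zero: "tensorial p q D (\<lambda>M. 0)"
| add: "tensorial p q D P \<Longrightarrow> tensorial p q D P' \<Longrightarrow> tensorial p q D (\<lambda>M. P M + P' M)"

lemma tensorial_scale: "tensorial p q D P \<Longrightarrow> tensorial p q D (\<lambda>M. v * P M)"
proof (induction rule: tensorial.induct)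
  case (entry i j D P)
  have "(\<lambda>M. v * (M i j * P M)) = (\<lambda>M. M i j * (v * P M))" by (simp add: ac_simps)
  then show ?case using tensorial.entry[OF entry(1,2,4)] by simp
qed (auto simp: distrib_left intro: tensorial.intros)

lemma tensorial_mult: "tensorial p q D P \<Longrightarrow> tensorial p q D' P' \<Longrightarrow> tensorial p q (D + D') (\<lambda>M. P M * P' M)"
proof (induction rule: tensorial.induct)
  case (entry i j D P)
  then have "tensorial p q (Suc (D + D')) (\<lambda>M. M i j * (P M * P' M))" by (intro tensorial.entry) auto
  then show ?case by (simp add: mult.assoc)
qed (auto simp: distrib_right intro: tensorial.intros tensorial_scale)

lemma tensorial_sum: "(\<And>i. i \<in> X \<Longrightarrow> tensorial p q D (P i)) \<Longrightarrow> tensorial p q D (\<lambda>M. \<Sum>i\<in>X. P i M)"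
  by (induction X rule: infinite_finite_induct) (auto intro: tensorial.intros)

text \<open>A form of degree \<open>D\<close> in the entries of \<open>M\<close> is a linear function of \<open>M\<^sup>\<otimes>\<^sup>D\<close>.\<close>

lemma tensorial_hat:
  fixes P :: "(nat \<Rightarrow> nat \<Rightarrow> 'r::comm_ring_1) \<Rightarrow> 'r"
  assumes "tensorial p q D P"
  shows "\<exists>H. (\<forall>h h'. H (\<lambda>\<omega> \<omega>'. h \<omega> \<omega>' + h' \<omega> \<omega>') = H h + H h') \<and>
    (\<forall>c h. H (\<lambda>\<omega> \<omega>'. c * h \<omega> \<omega>') = c * H h) \<and> (\<forall>M. H (tens D M) = P M) \<and>
    (\<forall>h h'. (\<forall>\<omega> \<omega>'. (\<forall>s<D. \<omega> s < p) \<longrightarrow> (\<forall>s<D. \<omega>' s < q) \<longrightarrow> h \<omega> \<omega>' = h' \<omega> \<omega>') \<longrightarrow> H h = H h')"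
  using assms
proof (induction rule: tensorial.induct)
  case (const v)
  show ?case by (rule exI[of _ "\<lambda>h. h id id * v"]) (auto simp: algebra_simps tens_def)
next
  case (entry i j D P)
  then obtain H where H: "\<And>h h'. H (\<lambda>\<omega> \<omega>'. h \<omega> \<omega>' + h' \<omega> \<omega>') = H h + H h'"
    "\<And>c h. H (\<lambda>\<omega> \<omega>'. c * h \<omega> \<omega>') = c * H h" "\<And>M. H (tens D M) = P M"
    "\<And>h h'. (\<forall>\<omega> \<omega>'. (\<forall>s<D. \<omega> s < p) \<longrightarrow> (\<forall>s<D. \<omega>' s < q) \<longrightarrow> h \<omega> \<omega>' = h' \<omega> \<omega>') \<Longrightarrow> H h = H h'"
    by blast
  define H' where "H' h = H (\<lambda>\<omega> \<omega>'. h (\<omega>(D := i)) (\<omega>'(D := j)))" for h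
  have "H' (tens (Suc D) M) = M i j * P M" for M
  proof -
    have "tens (Suc D) M (\<omega>(D := i)) (\<omega>'(D := j)) = M i j * tens D M \<omega> \<omega>'" for \<omega> \<omega>'
      by (simp add: tens_def mult.commute)
    then show ?thesis by (simp add: H'_def H)
  qed
  moreover have "H' h = H' h'" if "\<forall>\<omega> \<omega>'. (\<forall>s<Suc D. \<omega> s < p) \<longrightarrow> (\<forall>s<Suc D. \<omega>' s < q) \<longrightarrow> h \<omega> \<omega>' = h' \<omega> \<omega>'" for h h'
    unfolding H'_def
  proof (rule H(4), intro allI impI)
    fix \<omega> \<omega>' :: "nat \<Rightarrow> nat" assume "\<forall>s<D. \<omega> s < p" "\<forall>s<D. \<omega>' s < q"
    then have "\<forall>s<Suc D. (\<omega>(D := i)) s < p" "\<forall>s<Suc D. (\<omega>'(D := j)) s < q"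
      using entry(1,2) by (auto simp: less_Suc_eq)
    then show "h (\<omega>(D := i)) (\<omega>'(D := j)) = h' (\<omega>(D := i)) (\<omega>'(D := j))" using that by blast
  qed
  moreover have "H' (\<lambda>\<omega> \<omega>'. h \<omega> \<omega>' + h' \<omega> \<omega>') = H' h + H' h'" "H' (\<lambda>\<omega> \<omega>'. c * h \<omega> \<omega>') = c * H' h" for h h' c
    by (simp_all add: H'_def H)
  ultimately show ?case by blast
next
  case (zero D)
  show ?case by (rule exI[of _ "\<lambda>h. 0"]) auto
next
  case (add D P P')
  then obtain H H' where HH: "\<And>h h'. H (\<lambda>\<omega> \<omega>'. h \<omega> \<omega>' + h' \<omega> \<omega>') = H h + H h'"
    "\<And>c h. H (\<lambda>\<omega> \<omega>'. c * h \<omega> \<omega>') = c * H h" "\<And>M. H (tens D M) = P M"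
    "\<And>h h'. (\<forall>\<omega> \<omega>'. (\<forall>s<D. \<omega> s < p) \<longrightarrow> (\<forall>s<D. \<omega>' s < q) \<longrightarrow> h \<omega> \<omega>' = h' \<omega> \<omega>') \<Longrightarrow> H h = H h'"
    "\<And>h h'. H' (\<lambda>\<omega> \<omega>'. h \<omega> \<omega>' + h' \<omega> \<omega>') = H' h + H' h'"
    "\<And>c h. H' (\<lambda>\<omega> \<omega>'. c * h \<omega> \<omega>') = c * H' h" "\<And>M. H' (tens D M) = P' M"
    "\<And>h h'. (\<forall>\<omega> \<omega>'. (\<forall>s<D. \<omega> s < p) \<longrightarrow> (\<forall>s<D. \<omega>' s < q) \<longrightarrow> h \<omega> \<omega>' = h' \<omega> \<omega>') \<Longrightarrow> H' h = H' h'"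
    by blast
  show ?case
  proof (intro exI[of _ "\<lambda>h. H h + H' h"] conjI allI impI)
    fix h h' :: "(nat \<Rightarrow> nat) \<Rightarrow> (nat \<Rightarrow> nat) \<Rightarrow> 'r"
    assume "\<forall>\<omega> \<omega>'. (\<forall>s<D. \<omega> s < p) \<longrightarrow> (\<forall>s<D. \<omega>' s < q) \<longrightarrow> h \<omega> \<omega>' = h' \<omega> \<omega>'"
    then show "H h + H' h = H h' + H' h'" using HH(4)[of h h'] HH(8)[of h h'] by simp
  qed (simp_all add: HH(1-3,5-7) algebra_simps)
qed

text \<open>\<open>H\<close> is linear on arbitrary functions of two words but depends only on words
  with letters in range. Identities between tensor powers thus have to be verified only
  there.\<close>

lemma tensorial_linear:
  assumes "tensorial p q D P"
  obtains H where "\<And>h h'. H (\<lambda>\<omega> \<omega>'. h \<omega> \<omega>' + h' \<omega> \<omega>') = H h + H h'"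
    "\<And>c h. H (\<lambda>\<omega> \<omega>'. c * h \<omega> \<omega>') = c * H h" "\<And>M. H (tens D M) = P M"
    "\<And>h h'. (\<And>\<omega> \<omega>'. (\<And>s. s < D \<Longrightarrow> \<omega> s < p) \<Longrightarrow> (\<And>s. s < D \<Longrightarrow> \<omega>' s < q) \<Longrightarrow> h \<omega> \<omega>' = h' \<omega> \<omega>') \<Longrightarrow> H h = H h'"
  using tensorial_hat[OF assms] by blast

lemma linear_functional_sum:
  fixes H :: "('a \<Rightarrow> 'b \<Rightarrow> 'r::comm_ring_1) \<Rightarrow> 'r"
  assumes add: "\<And>h h'. H (\<lambda>x y. h x y + h' x y) = H h + H h'" and scale: "\<And>c h. H (\<lambda>x y. c * h x y) = c * H h"
  shows "H (\<lambda>x y. \<Sum>i\<in>X. h i x y) = (\<Sum>i\<in>X. H (h i))"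
proof -
  have "H (\<lambda>x y. 0) = 0" using scale[of 0 "\<lambda>x y. 0"] by simp
  then show ?thesis by (induction X rule: infinite_finite_induct) (simp_all add: add)
qed

text \<open>The abstract form of the vanishing: a form in a matrix with q rows cannot survive
  alternation in more than q letters. It will serve for Schur modules, for images of the right
  action, and for polynomials in a generic matrix with few rows.\<close>

lemma tensorial_alternator_zero:
  fixes B E :: "nat \<Rightarrow> nat \<Rightarrow> 'r::comm_ring_1"
  assumes two: "\<And>x::'r. x + x = 0 \<Longrightarrow> x = 0" and P: "tensorial q p D P"
    and U: "finite U" "card U = D" and A: "A \<subseteq> U" "q < card A"
  shows "(\<Sum>T\<in>Pow U. \<Sum>\<sigma> | \<sigma> permutes A. (-1) ^ (D - card T) * of_int (sign \<sigma>) *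
     P (\<lambda>i l. \<Sum>u\<in>T. B i u * E (\<sigma> u) l)) = 0"
proof -
  obtain H where H: "\<And>h h'. H (\<lambda>\<omega> \<omega>'. h \<omega> \<omega>' + h' \<omega> \<omega>') = H h + H h'"
    "\<And>c h. H (\<lambda>\<omega> \<omega>'. c * h \<omega> \<omega>') = c * H h" "\<And>M. H (tens D M) = P M"
    "\<And>h h'. (\<And>\<omega> \<omega>'. (\<And>s. s < D \<Longrightarrow> \<omega> s < q) \<Longrightarrow> (\<And>s. s < D \<Longrightarrow> \<omega>' s < p) \<Longrightarrow> h \<omega> \<omega>' = h' \<omega> \<omega>') \<Longrightarrow> H h = H h'"
    by (rule tensorial_linear[OF P]) blast
  have "(\<Sum>T\<in>Pow U. \<Sum>\<sigma> | \<sigma> permutes A. (-1) ^ (D - card T) * of_int (sign \<sigma>) *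
     P (\<lambda>i l. \<Sum>u\<in>T. B i u * E (\<sigma> u) l)) =
    H (\<lambda>\<omega> \<omega>'. \<Sum>T\<in>Pow U. \<Sum>\<sigma> | \<sigma> permutes A. (-1) ^ (D - card T) * of_int (sign \<sigma>) *
     tens D (\<lambda>i l. \<Sum>u\<in>T. B i u * E (\<sigma> u) l) \<omega> \<omega>')"
    by (simp only: linear_functional_sum[of H, OF H(1,2)] H(2,3))
  also have "\<dots> = H (\<lambda>\<omega> \<omega>'. 0 * 0)"
    by (rule H(4)) (simp add: alternator_kills_few_rows[OF two U A])
  also have "\<dots> = 0" by (subst H(2)) simp
  finally show ?thesis .
qed

section \<open>Splittings applied to polynomial functors\<close>

abbreviation cm :: "'k::field mat \<Rightarrow> nat \<Rightarrow> nat \<Rightarrow> ('x, 'k) mpoly" where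
  "cm C \<equiv> \<lambda>i j. const (C $$ (i, j))"

lemma const_tens: "const (tens D (ent M) \<omega> \<omega>') = tens D (cm M) \<omega> \<omega>'"
  by (simp add: tens_def const.hom_prod)

text \<open>The defining identity of a splitting is linear in tensor powers, so the functional
  \<open>H\<close> of the form \<open>P\<close> can be applied to it term by term.\<close>

lemma tensorial_splitting:
  fixes P :: "(nat \<Rightarrow> nat \<Rightarrow> ('x, 'k::field) mpoly) \<Rightarrow> ('x, 'k) mpoly"
  assumes S: "splitting p q D r a C C' r2 b A E E'" and P: "tensorial p p D P"
  shows "P (cm (1\<^sub>m p)) = (\<Sum>i<r. scal (a i) (P (cm (C i * C' i)))) +
    (\<Sum>j<r2. scal (b j) (\<Sum>T\<in>Pow {..<D}. \<Sum>\<sigma> | \<sigma> permutes A j. scal (altsgn D T \<sigma>) (P (cm (E j * (pmat D T \<sigma> * E' j))))))"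
proof -
  obtain H where H: "\<And>h h'. H (\<lambda>\<omega> \<omega>'. h \<omega> \<omega>' + h' \<omega> \<omega>') = H h + H h'"
    "\<And>c h. H (\<lambda>\<omega> \<omega>'. c * h \<omega> \<omega>') = c * H h" "\<And>M. H (tens D M) = P M"
    "\<And>h h'. (\<And>\<omega> \<omega>'. (\<And>s. s < D \<Longrightarrow> \<omega> s < p) \<Longrightarrow> (\<And>s. s < D \<Longrightarrow> \<omega>' s < p) \<Longrightarrow> h \<omega> \<omega>' = h' \<omega> \<omega>') \<Longrightarrow> H h = H h'"
    by (rule tensorial_linear[OF P]) blast
  have "P (cm (1\<^sub>m p)) = H (tens D (cm (1\<^sub>m p)))" by (simp add: H(3))
  also have "\<dots> = H (\<lambda>\<omega> \<omega>'. (\<Sum>i<r. const (a i) * tens D (cm (C i * C' i)) \<omega> \<omega>') +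
       (\<Sum>j<r2. const (b j) * (\<Sum>T\<in>Pow {..<D}. \<Sum>\<sigma> | \<sigma> permutes A j. const (altsgn D T \<sigma>) *
          tens D (cm (E j * (pmat D T \<sigma> * E' j))) \<omega> \<omega>')))"
  proof (rule H(4))
    fix \<omega> \<omega>' assume w: "\<And>s. s < D \<Longrightarrow> \<omega> s < p" "\<And>s. s < D \<Longrightarrow> \<omega>' s < p"
    have "tens D (cm (1\<^sub>m p)) \<omega> \<omega>' = (\<Prod>s\<in>{..<D}. if \<omega> s = \<omega>' s then 1 else 0 :: ('x, 'k) mpoly)"
      unfolding tens_def using w by (intro prod.cong) auto
    also have "\<dots> = (if \<forall>s\<in>{..<D}. \<omega> s = \<omega>' s then 1 else 0)" by (rule prod_indicator) simp
    also have "\<dots> = const (if \<forall>s<D. \<omega> s = \<omega>' s then 1 else 0)" by simp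
    also have "\<dots> = const ((\<Sum>i<r. a i * tens D (ent (C i * C' i)) \<omega> \<omega>') +
       (\<Sum>j<r2. b j * (\<Sum>T\<in>Pow {..<D}. \<Sum>\<sigma> | \<sigma> permutes A j. altsgn D T \<sigma> *
          tens D (ent (E j * (pmat D T \<sigma> * E' j))) \<omega> \<omega>')))"
      using S w unfolding splitting_def by (intro arg_cong[of _ _ const]) blast
    also have "\<dots> = (\<Sum>i<r. const (a i) * tens D (cm (C i * C' i)) \<omega> \<omega>') +
       (\<Sum>j<r2. const (b j) * (\<Sum>T\<in>Pow {..<D}. \<Sum>\<sigma> | \<sigma> permutes A j. const (altsgn D T \<sigma>) *
          tens D (cm (E j * (pmat D T \<sigma> * E' j))) \<omega> \<omega>'))"
      by (simp only: const.hom_add const.hom_sum const.hom_mult const_tens)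
    finally show "(tens D (cm (1\<^sub>m p)) \<omega> \<omega>' :: ('x, 'k) mpoly) = (\<Sum>i<r. const (a i) * tens D (cm (C i * C' i)) \<omega> \<omega>') +
       (\<Sum>j<r2. const (b j) * (\<Sum>T\<in>Pow {..<D}. \<Sum>\<sigma> | \<sigma> permutes A j. const (altsgn D T \<sigma>) *
          tens D (cm (E j * (pmat D T \<sigma> * E' j))) \<omega> \<omega>'))" .
  qed
  also have "\<dots> = (\<Sum>i<r. scal (a i) (P (cm (C i * C' i)))) +
    (\<Sum>j<r2. scal (b j) (\<Sum>T\<in>Pow {..<D}. \<Sum>\<sigma> | \<sigma> permutes A j. scal (altsgn D T \<sigma>) (P (cm (E j * (pmat D T \<sigma> * E' j))))))"
    by (simp only: linear_functional_sum[of H, OF H(1,2)] H(1,2,3) scal_def)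
  finally show ?thesis .
qed

lemma mono_eval_tensorial:
  assumes "\<And>x. x \<in> X \<Longrightarrow> tensorial p q \<delta> (\<lambda>M. \<theta> M x)"
  shows "mono_degree u = d \<Longrightarrow> Poly_Mapping.keys u \<subseteq> X \<Longrightarrow> tensorial p q (d * \<delta>) (\<lambda>M. mono_eval (\<theta> M) u)"
proof (induction d arbitrary: u)
  case 0
  then have "u = 0" by (simp add: mono_degree_zero_iff)
  then show ?case by (simp add: tensorial.const)
next
  case (Suc d)
  obtain x v where x: "x \<in> X" "u = Poly_Mapping.single x 1 + v" "mono_degree v = d" "Poly_Mapping.keys v \<subseteq> X"
    by (rule monomial_split[OF Suc.prems]) blast
  have "tensorial p q (\<delta> + d * \<delta>) (\<lambda>M. \<theta> M x * mono_eval (\<theta> M) v)"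
    by (rule tensorial_mult[OF assms[OF x(1)] Suc.IH[OF x(3,4)]])
  then show ?case unfolding x(2) mono_eval_add mono_eval_single by simp
qed

lemma subst_tensorial:
  fixes \<theta> :: "_ \<Rightarrow> 'x \<Rightarrow> ('y, 'k::field) mpoly"
  assumes \<theta>: "\<And>x. x \<in> X \<Longrightarrow> tensorial p q \<delta> (\<lambda>M. \<theta> M x)" and f: "f \<in> poly_ring X" "homogeneous d f"
  shows "tensorial p q (d * \<delta>) (\<lambda>M. subst (\<theta> M) f)"
proof (rule homogeneous_subspace_induct[OF f])
  fix c u assume u: "Poly_Mapping.keys u \<subseteq> X" "mono_degree u = d"
  have "tensorial p q (d * \<delta>) (\<lambda>M. const c * mono_eval (\<theta> M) u)"
    by (rule tensorial_scale[OF mono_eval_tensorial[OF \<theta> u(2,1)]])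
  then show "tensorial p q (d * \<delta>) (\<lambda>M. subst (\<theta> M) (scal c (mono_eval var u)))"
    unfolding subst_scal mono_eval_hom subst_var unfolding scal_def .
qed (auto simp: subst_add intro: tensorial.intros)

text \<open>Each variable is sent to a combination of t-minors of \<open>C\<close>, hence the degree
  \<open>d * t\<close>.\<close>

lemma ract_tensorial:
  fixes f :: "(_, 'k::field) mpoly"
  assumes f: "f \<in> S_ring t m p" "homogeneous d f"
  obtains P where "tensorial p q (d * t) P" "\<And>C. C \<in> carrier_mat p q \<Longrightarrow> P (cm C) = ract t q C f"
proof
  \<comment> \<open>The Leibniz formula also makes sense for entries in the polynomial ring; on
    constant matrices it returns the actual minors.\<close>
  let ?minor = "\<lambda>M J L. \<Sum>\<pi> | \<pi> permutes {0..<t}. of_int (sign \<pi>) * (\<Prod>a = 0..<t. M (pick J a) (pick L (\<pi> a)))"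
  let ?\<theta> = "\<lambda>M (I, J). \<Sum>L\<in>subsets t q. ?minor M J L * var (I, L) :: (_, 'k) mpoly"
  have pr: "tensorial p q n (\<lambda>M. \<Prod>a = 0..<n. M (g a) (h a))"
    if "\<And>a. a < n \<Longrightarrow> g a < p" "\<And>a. a < n \<Longrightarrow> h a < q" for n g and h :: "nat \<Rightarrow> nat"
    using that by (induction n) (auto intro: tensorial.intros simp: mult.commute)
  show "tensorial p q (d * t) (\<lambda>M. subst (?\<theta> M) f)"
  proof (rule subst_tensorial[OF _ f[unfolded S_ring_def]])
    fix x :: "nat set \<times> nat set" assume "x \<in> subsets t m \<times> subsets t p"
    then obtain I J where x: "x = (I, J)" and J: "J \<in> subsets t p" by auto
    have "tensorial p q t (\<lambda>M. \<Sum>L\<in>subsets t q. var (I, L) * ?minor M J L :: (_, 'k) mpoly)"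
      by (intro tensorial_sum tensorial_scale pr)
        (auto intro: pick_subset(2)[OF J] pick_subset(2) dest: permutes_in_image)
    then show "tensorial p q t (\<lambda>M. ?\<theta> M x)" by (simp add: x mult.commute)
  qed
  fix C :: "'k mat" assume C: "C \<in> carrier_mat p q"
  show "subst (?\<theta> (cm C)) f = ract t q C f"
    unfolding ract_def
  proof (rule subst_cong[OF f(1)[unfolded S_ring_def]], clarify)
    fix I J assume J: "J \<in> subsets t p"
    show "(\<Sum>L\<in>subsets t q. ?minor (cm C) J L * var (I, L)) = (\<Sum>L\<in>subsets t q. scal (minor C J L) (var (I, L)) :: (_, 'k) mpoly)"
    proof (rule sum.cong[OF refl])
      fix L assume L: "L \<in> subsets t q"
      have "minor C J L = (\<Sum>\<pi> | \<pi> permutes {0..<t}. of_int (sign \<pi>) * (\<Prod>a = 0..<t. C $$ (pick J a, pick L (\<pi> a))))"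
        unfolding minor_eq[OF C J L]
        by (subst det_def'[of _ t])
          (auto intro!: sum.cong prod.cong arg_cong2[of _ _ _ _ "(*)"] dest: permutes_in_image)
      then show "?minor (cm C) J L * var (I, L) = scal (minor C J L) (var (I, L))"
        by (simp add: scal_def const.hom_sum const.hom_mult const.hom_prod const.hom_of_int)
    qed
  qed
qed

lemma schur_act_tensorial:
  fixes w :: "(nat \<times> nat, 'k::field) mpoly"
  assumes w: "w \<in> poly_ring ({..<p} \<times> Y)" "homogeneous D w"
  obtains P where "tensorial n p D P" "\<And>C. P (cm C) = schur_act n C w"
proof
  let ?\<theta> = "\<lambda>M (i, j). \<Sum>k<n. M k i * var (k, j) :: (_, 'k) mpoly"
  have "tensorial n p (D * 1) (\<lambda>M. subst (?\<theta> M) w)"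
  proof (rule subst_tensorial[OF _ w])
    fix x assume "x \<in> {..<p} \<times> Y"
    then obtain i j where x: "x = (i, j)" "i < p" by auto
    have "tensorial n p (Suc 0) (\<lambda>M. \<Sum>k<n. M k i * var (k, j) :: (_, 'k) mpoly)"
      using x(2) by (intro tensorial_sum tensorial.entry tensorial.const) auto
    then show "tensorial n p 1 (\<lambda>M. ?\<theta> M x)" by (simp add: x)
  qed
  then show "tensorial n p D (\<lambda>M. subst (?\<theta> M) w)" by simp
  show "subst (?\<theta> (cm C)) w = schur_act n C w" for C
    by (simp add: schur_act_def scal_def)
qed

lemma altsgn_const: "const (altsgn D T \<sigma>) = (-1) ^ (D - card T) * of_int (sign \<sigma>)"
  by (simp add: altsgn_def const.hom_mult const.hom_power const.hom_of_int const.hom_uminus)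

lemma ract_splitting:
  fixes f :: "(_, 'k::field) mpoly"
  assumes S: "splitting p q (d * t) r a C C' r2 b A E E'" and f: "f \<in> S_ring t m p" "homogeneous d f"
  shows "f = (\<Sum>i<r. scal (a i) (ract t p (C i * C' i) f)) +
    (\<Sum>j<r2. scal (b j) (\<Sum>T\<in>Pow {..<d * t}. \<Sum>\<sigma> | \<sigma> permutes A j. scal (altsgn (d * t) T \<sigma>)
       (ract t p (E j * (pmat (d * t) T \<sigma> * E' j)) f)))"
proof -
  obtain P where P: "tensorial p p (d * t) P" "\<And>C. C \<in> carrier_mat p p \<Longrightarrow> P (cm C) = ract t p C f"
    by (rule ract_tensorial[OF f]) blast
  have c: "C i * C' i \<in> carrier_mat p p" if "i < r" for i
    using S that mult_carrier_mat unfolding splitting_def by blast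
  have e: "E j * (pmat (d * t) T \<sigma> * E' j) \<in> carrier_mat p p" if "j < r2" for j T \<sigma>
    using S that mult_carrier_mat[OF _ mult_carrier_mat[OF pmat_carrier]] unfolding splitting_def by blast
  show ?thesis
    using tensorial_splitting[OF S P(1)] by (simp add: P(2) c e ract_one[OF f(1)])
qed

text \<open>What comes from \<open>k^q\<close> is a form in the product of \<open>C0\<close> with a
  further matrix, which has q rows only. The alternators in q + 1 letters vanish on it, and the
  splitting becomes exact without them.\<close>

lemma ract_image_splitting:
  fixes x0 :: "(_, 'k::field_char_0) mpoly"
  assumes S: "splitting p q (d * t) r a C C' r2 b A E E'" and x0: "x0 \<in> S_ring t m q" "homogeneous d x0"
    and C0: "C0 \<in> carrier_mat q p"
  shows "ract t p C0 x0 = (\<Sum>i<r. scal (a i) (ract t p (C i * C' i) (ract t p C0 x0)))"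
proof -
  let ?D = "d * t"
  obtain P where P: "tensorial q p ?D P" "\<And>C. C \<in> carrier_mat q p \<Longrightarrow> P (cm C) = ract t p C x0"
    by (rule ract_tensorial[OF x0]) blast
  have "(\<Sum>T\<in>Pow {..<?D}. \<Sum>\<sigma> | \<sigma> permutes A j. scal (altsgn ?D T \<sigma>)
       (ract t p (E j * (pmat ?D T \<sigma> * E' j)) (ract t p C0 x0))) = 0" if j: "j < r2" for j
  proof -
    have Aj: "A j \<in> subsets (Suc q) ?D" and E: "E j \<in> carrier_mat p ?D" and E': "E' j \<in> carrier_mat ?D p"
      using S j unfolding splitting_def by blast+
    have "(\<Sum>T\<in>Pow {..<?D}. \<Sum>\<sigma> | \<sigma> permutes A j. scal (altsgn ?D T \<sigma>)
       (ract t p (E j * (pmat ?D T \<sigma> * E' j)) (ract t p C0 x0))) =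
     (\<Sum>T\<in>Pow {..<?D}. \<Sum>\<sigma> | \<sigma> permutes A j. (-1) ^ (?D - card T) * of_int (sign \<sigma>) *
       P (\<lambda>i l. \<Sum>u\<in>T. cm (C0 * E j) i u * cm (E' j) (\<sigma> u) l))"
    proof (intro sum.cong refl)
      fix T \<sigma> assume "T \<in> Pow {..<?D}" "\<sigma> \<in> {\<sigma>. \<sigma> permutes A j}"
      then have T: "T \<subseteq> {..<?D}" and \<sigma>: "\<sigma> permutes {..<?D}" using subsets_permutes[OF Aj] by auto
      have CE: "C0 * E j \<in> carrier_mat q ?D" using C0 E by simp
      have PE: "pmat ?D T \<sigma> * E' j \<in> carrier_mat ?D p" by (rule mult_carrier_mat[OF pmat_carrier E'])
      have M: "C0 * E j * (pmat ?D T \<sigma> * E' j) \<in> carrier_mat q p" by (rule mult_carrier_mat[OF CE PE])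
      have "ract t p (E j * (pmat ?D T \<sigma> * E' j)) (ract t p C0 x0) = ract t p (C0 * E j * (pmat ?D T \<sigma> * E' j)) x0"
        using ract_ract[OF x0(1) C0 mult_carrier_mat[OF E PE]] assoc_mult_mat[OF C0 E PE] by simp
      also have "\<dots> = P (cm (C0 * E j * (pmat ?D T \<sigma> * E' j)))" using P(2)[OF M] by simp
      also have "\<dots> = P (\<lambda>i l. \<Sum>u\<in>T. cm (C0 * E j) i u * cm (E' j) (\<sigma> u) l)"
      proof -
        \<comment> \<open>As functions the two matrices agree only within their dimensions, which is
          all that \<open>H\<close> depends on.\<close>
        obtain H where H: "\<And>M. H (tens ?D M) = P M"
          "\<And>h h'. (\<And>\<omega> \<omega>'. (\<And>s. s < ?D \<Longrightarrow> \<omega> s < q) \<Longrightarrow> (\<And>s. s < ?D \<Longrightarrow> \<omega>' s < p) \<Longrightarrow> h \<omega> \<omega>' = h' \<omega> \<omega>') \<Longrightarrow> H h = H h'"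
          by (rule tensorial_linear[OF P(1)]) blast
        have "H (tens ?D (cm (C0 * E j * (pmat ?D T \<sigma> * E' j)))) = H (tens ?D (\<lambda>i l. \<Sum>u\<in>T. cm (C0 * E j) i u * cm (E' j) (\<sigma> u) l))"
          by (rule H(2), unfold tens_def, rule prod.cong[OF refl],
              subst pmat_mult_index[OF CE E' T \<sigma>]) (auto simp: const.hom_sum const.hom_mult)
        then show ?thesis by (simp add: H(1))
      qed
      finally show "scal (altsgn ?D T \<sigma>) (ract t p (E j * (pmat ?D T \<sigma> * E' j)) (ract t p C0 x0)) =
        (-1) ^ (?D - card T) * of_int (sign \<sigma>) * P (\<lambda>i l. \<Sum>u\<in>T. cm (C0 * E j) i u * cm (E' j) (\<sigma> u) l)"
        by (simp add: scal_def altsgn_const)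
    qed
    also have "\<dots> = 0"
      by (rule tensorial_alternator_zero[OF mpoly_double_zero P(1)]) (use Aj in \<open>auto simp: subsets_def\<close>)
    finally show ?thesis .
  qed
  then show ?thesis
    using ract_splitting[OF S ract_S_ring[OF x0(1)] ract_homogeneous[OF x0], of C0] by simp
qed

text \<open>With parts at most q, \<open>w\<close> is a form in a matrix of indeterminates with q
  columns. Transposed it has q rows, and alternation in q + 1 letters kills it.\<close>

lemma schur_splitting:
  fixes w :: "(_, 'k::field_char_0) mpoly"
  assumes S: "splitting p q (sum_list \<mu>) r a C C' r2 b A E E'" and w: "w \<in> schur p \<mu>"
    and q: "\<forall>k<length \<mu>. \<mu> ! k \<le> q"
  shows "w = (\<Sum>i<r. scal (a i) (schur_act p (C i * C' i) w))"
proof -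
  let ?D = "sum_list \<mu>"
  note wp = schur_poly[OF w q]
  obtain P where P: "tensorial p p ?D P" "\<And>C. P (cm C) = schur_act p C w"
    by (rule schur_act_tensorial[OF wp, where n = p]) blast
  \<comment> \<open>Rows and columns are interchanged, so that the q columns of the indeterminates
    become the rows of \<open>M\<close>.\<close>
  let ?Q = "\<lambda>M. subst (\<lambda>(i, j). M j i) w :: (nat \<times> nat, 'k) mpoly"
  have "tensorial q p (?D * 1) ?Q"
  proof (rule subst_tensorial[OF _ wp])
    fix x :: "nat \<times> nat" assume "x \<in> {..<p} \<times> {..<q}"
    then obtain i j where x: "x = (i, j)" "i < p" "j < q" by auto
    have "tensorial q p (Suc 0) (\<lambda>M. M j i * 1 :: (nat \<times> nat, 'k) mpoly)"
      using x by (intro tensorial.entry tensorial.const)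
    then show "tensorial q p 1 (\<lambda>M. (case x of (i, j) \<Rightarrow> M j i) :: (nat \<times> nat, 'k) mpoly)" by (simp add: x)
  qed
  then have Q: "tensorial q p ?D ?Q" by simp
  have "(\<Sum>T\<in>Pow {..<?D}. \<Sum>\<sigma> | \<sigma> permutes A j. scal (altsgn ?D T \<sigma>)
       (schur_act p (E j * (pmat ?D T \<sigma> * E' j)) w)) = 0" if j: "j < r2" for j
  proof -
    have Aj: "A j \<in> subsets (Suc q) ?D" and E: "E j \<in> carrier_mat p ?D" and E': "E' j \<in> carrier_mat ?D p"
      using S j unfolding splitting_def by blast+
    let ?B = "\<lambda>l u. \<Sum>k<p. var (k, l) * cm (E j) k u :: (nat \<times> nat, 'k) mpoly"
    have "(\<Sum>T\<in>Pow {..<?D}. \<Sum>\<sigma> | \<sigma> permutes A j. scal (altsgn ?D T \<sigma>)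
       (schur_act p (E j * (pmat ?D T \<sigma> * E' j)) w)) =
     (\<Sum>T\<in>Pow {..<?D}. \<Sum>\<sigma> | \<sigma> permutes A j. (-1) ^ (?D - card T) * of_int (sign \<sigma>) *
       ?Q (\<lambda>l i. \<Sum>u\<in>T. ?B l u * cm (E' j) (\<sigma> u) i))"
    proof (intro sum.cong refl)
      fix T \<sigma> assume "T \<in> Pow {..<?D}" "\<sigma> \<in> {\<sigma>. \<sigma> permutes A j}"
      then have T: "T \<subseteq> {..<?D}" and \<sigma>: "\<sigma> permutes {..<?D}" using subsets_permutes[OF Aj] by auto
      have "schur_act p (E j * (pmat ?D T \<sigma> * E' j)) w = ?Q (\<lambda>l i. \<Sum>u\<in>T. ?B l u * cm (E' j) (\<sigma> u) i)"
        unfolding schur_act_def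
      proof (rule subst_cong[OF wp(1)], clarify)
        fix i l assume "i < p"
        have "(\<Sum>k<p. scal ((E j * (pmat ?D T \<sigma> * E' j)) $$ (k, i)) (var (k, l))) =
          (\<Sum>k<p. \<Sum>u\<in>T. var (k, l) * cm (E j) k u * cm (E' j) (\<sigma> u) i :: (nat \<times> nat, 'k) mpoly)"
          by (rule sum.cong[OF refl], subst pmat_mult_index[OF E E' T \<sigma>])
            (auto simp: \<open>i < p\<close> scal_def const.hom_sum const.hom_mult sum_distrib_left sum_distrib_right ac_simps)
        also have "\<dots> = (\<Sum>u\<in>T. ?B l u * cm (E' j) (\<sigma> u) i)"
          unfolding sum_distrib_right by (rule sum.swap)
        finally show "(\<Sum>k<p. scal ((E j * (pmat ?D T \<sigma> * E' j)) $$ (k, i)) (var (k, l))) =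
           (\<Sum>u\<in>T. ?B l u * cm (E' j) (\<sigma> u) i)" .
      qed
      then show "scal (altsgn ?D T \<sigma>) (schur_act p (E j * (pmat ?D T \<sigma> * E' j)) w) =
        (-1) ^ (?D - card T) * of_int (sign \<sigma>) * ?Q (\<lambda>l i. \<Sum>u\<in>T. ?B l u * cm (E' j) (\<sigma> u) i)"
        by (simp add: scal_def altsgn_const)
    qed
    also have "\<dots> = 0"
      by (rule tensorial_alternator_zero[OF mpoly_double_zero Q]) (use Aj in \<open>auto simp: subsets_def\<close>)
    finally show ?thesis .
  qed
  then show ?thesis
    using tensorial_splitting[OF S P(1)] by (simp add: P(2) schur_act_one[OF schur_poly_UNIV[OF w]])
qed

section \<open>Alternators map into the relations\<close>

text \<open>The basis vectors of W that occur in the monomial \<open>u\<close>; only the column sets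
  count.\<close>

definition letters :: "(nat set \<times> nat set \<Rightarrow>\<^sub>0 nat) \<Rightarrow> nat set" where
  "letters u = (\<Union>(I, J)\<in>Poly_Mapping.keys u. J)"

lemma ract_mono_eval: "ract t q C (mono_eval var u) = mono_eval (\<lambda>x. ract t q C (var x)) u"
  by (simp add: ract_def mono_eval_hom)

text \<open>Only the rows of \<open>C\<close> indexed by letters of \<open>u\<close> enter the
  minors involved.\<close>

lemma ract_monomial_cong:
  assumes u: "Poly_Mapping.keys u \<subseteq> subsets t m \<times> subsets t p" and C: "C \<in> carrier_mat p q" "C' \<in> carrier_mat p q"
    and eq: "\<And>j l. j \<in> letters u \<Longrightarrow> l < q \<Longrightarrow> C $$ (j, l) = C' $$ (j, l)"
  shows "ract t q C (mono_eval var u) = ract t q C' (mono_eval var u)"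
  unfolding ract_mono_eval
proof (rule mono_eval_cong)
  fix x assume x: "x \<in> Poly_Mapping.keys u"
  obtain I J where xIJ: "x = (I, J)" by fastforce
  have J: "J \<in> subsets t p" "J \<subseteq> letters u" using x u by (auto simp: letters_def xIJ)
  show "ract t q C (var x) = ract t q C' (var x)"
    unfolding xIJ ract_var
  proof (intro sum.cong refl arg_cong2[of _ _ _ _ scal])
    fix L assume L: "L \<in> subsets t q"
    show "minor C J L = minor C' J L"
    proof (rule minor_cong[OF C J(1) L J(1) L])
      fix i l assume "i \<in> J" "l \<in> L"
      moreover have "L \<subseteq> {..<q}" using L by (simp add: subsets_def)
      ultimately show "C $$ (i, l) = C' $$ (i, l)" using J(2) by (intro eq) auto
    qed
  qed
qed

lemma ract_monomial_zero:
  assumes u: "Poly_Mapping.keys u \<subseteq> subsets t m \<times> subsets t p" and C: "C \<in> carrier_mat p q"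
    and j: "j \<in> letters u" "\<And>l. l < q \<Longrightarrow> C $$ (j, l) = 0"
  shows "ract t q C (mono_eval var u) = 0"
proof -
  obtain I J where x: "(I, J) \<in> Poly_Mapping.keys u" "j \<in> J" using j(1) by (auto simp: letters_def)
  have J: "J \<in> subsets t p" using x u by auto
  have "minor C J L = 0" if "L \<in> subsets t q" for L
    by (rule minor_zero_row[OF C J that x(2)]) (use j(2) that in \<open>auto simp: subsets_def\<close>)
  then have "ract t q C (var (I, J)) = 0" by (simp add: ract_var)
  moreover have "Poly_Mapping.lookup u (I, J) \<noteq> 0" using x(1) by (simp add: in_keys_iff)
  ultimately have "(\<Prod>x\<in>Poly_Mapping.keys u. ract t q C (var x) ^ Poly_Mapping.lookup u x) = 0"
    using x(1) by (intro prod_zero bexI[of _ "(I, J)"]) (auto simp: power_0_left)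
  then show ?thesis unfolding ract_mono_eval by (simp add: mono_eval_def)
qed

lemma mono_eval_S_ring: "Poly_Mapping.keys u \<subseteq> subsets t m \<times> subsets t p \<Longrightarrow> mono_eval var u \<in> S_ring t m p"
  unfolding S_ring_def mono_eval_def
  by (intro poly_ring_prod poly_ring_power poly_ring_var) auto

lemma letters_subset: "Poly_Mapping.keys u \<subseteq> subsets t m \<times> subsets t p \<Longrightarrow> letters u \<subseteq> {..<p}"
  unfolding letters_def subsets_def by fastforce

lemma letters_single_add: "letters (Poly_Mapping.single (I, J) 1 + v) = J \<union> letters v"
proof -
  have "Poly_Mapping.keys (Poly_Mapping.single (I, J) 1 + v) = insert (I, J) (Poly_Mapping.keys v)"
    by (auto simp: in_keys_iff lookup_add lookup_single when_def split: if_splits)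
  then show ?thesis by (auto simp: letters_def)
qed

lemma card_letters: "mono_degree u = d \<Longrightarrow> Poly_Mapping.keys u \<subseteq> subsets t m \<times> subsets t p \<Longrightarrow> card (letters u) \<le> d * t"
proof (induction d arbitrary: u)
  case 0
  then show ?case by (simp add: mono_degree_zero_iff letters_def)
next
  case (Suc d)
  obtain x v where x: "x \<in> subsets t m \<times> subsets t p" "u = Poly_Mapping.single x 1 + v" "mono_degree v = d"
    "Poly_Mapping.keys v \<subseteq> subsets t m \<times> subsets t p"
    by (rule monomial_split[OF Suc.prems]) blast
  obtain I J where xIJ: "x = (I, J)" by fastforce
  have "card (letters u) \<le> card J + card (letters v)" unfolding x(2) xIJ letters_single_add by (rule card_Un_le)
  also have "card J = t" using x(1) by (auto simp: xIJ subsets_def)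
  finally show ?case using Suc.IH[OF x(3,4)] by simp
qed

section \<open>Permuting the letters of a monomial\<close>

abbreviation permat :: "nat \<Rightarrow> (nat \<Rightarrow> nat) \<Rightarrow> 'k::comm_ring_1 mat" where
  "permat D \<equiv> pmat D {..<D}"

text \<open>Row u of a permutation matrix is the unit vector at \<open>\<sigma> u\<close>, so
  products reverse composition. As \<open>ract\<close> reverses products once more, permutations act
  on polynomials from the left.\<close>

lemma pmat_mult_permat:
  assumes "\<sigma> permutes {..<D}" "\<rho> permutes {..<D}"
  shows "pmat D T \<sigma> * permat D \<rho> = pmat D T (\<rho> \<circ> \<sigma>)"
proof (rule eq_matI)
  fix u l assume "u < dim_row (pmat D T (\<rho> \<circ> \<sigma>) :: 'a mat)" "l < dim_col (pmat D T (\<rho> \<circ> \<sigma>) :: 'a mat)"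
  then have ul: "u < D" "l < D" by (auto simp: pmat_def)
  have "\<sigma> u < D" using permutes_in_image[OF assms(1), of u] ul by simp
  then show "(pmat D T \<sigma> * permat D \<rho>) $$ (u, l) = (pmat D T (\<rho> \<circ> \<sigma>) :: 'a mat) $$ (u, l)"
    unfolding pmat_mult_left[OF pmat_carrier assms(1) ul] using ul by (auto simp: pmat_def)
qed (auto simp: pmat_def)

text \<open>A letter outside \<open>T\<close> gives a zero row and kills the monomial; otherwise the
  restriction to \<open>T\<close> is not felt. Inclusion-exclusion leaves the monomials in which all
  D letters occur.\<close>

lemma sum_pmat_monomial:
  fixes u :: "nat set \<times> nat set \<Rightarrow>\<^sub>0 nat"
  assumes u: "Poly_Mapping.keys u \<subseteq> subsets t m \<times> subsets t D"
  shows "(\<Sum>T\<in>Pow {..<D}. scal ((-1) ^ (D - card T)) (ract t D (pmat D T \<sigma>) (mono_eval var u))) =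
    (if letters u = {..<D} then ract t D (permat D \<sigma>) (mono_eval var u) else 0 :: (_, 'k::field) mpoly)"
proof -
  let ?M = "mono_eval var u :: (_, 'k) mpoly"
  have "(\<Sum>T\<in>Pow {..<D}. scal ((-1) ^ (D - card T)) (ract t D (pmat D T \<sigma>) ?M)) =
    (\<Sum>T\<in>Pow {..<D}. scal (if letters u \<subseteq> T then (-1) ^ (card {..<D} - card T) else 0) (ract t D (permat D \<sigma>) ?M))"
  proof (intro sum.cong refl)
    fix T assume T: "T \<in> Pow {..<D}"
    show "scal ((-1) ^ (D - card T)) (ract t D (pmat D T \<sigma>) ?M) =
      scal (if letters u \<subseteq> T then (-1) ^ (card {..<D} - card T) else 0) (ract t D (permat D \<sigma>) ?M)"
    proof (cases "letters u \<subseteq> T")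
      case True
      have "ract t D (pmat D T \<sigma>) ?M = ract t D (permat D \<sigma>) ?M"
      proof (rule ract_monomial_cong[OF u pmat_carrier pmat_carrier])
        fix j l assume "j \<in> letters u" "l < D"
        then have "j \<in> T" "j < D" using True T by auto
        then show "pmat D T \<sigma> $$ (j, l) = permat D \<sigma> $$ (j, l)" using \<open>l < D\<close> by (simp add: pmat_def)
      qed
      with True show ?thesis by simp
    next
      case False
      then obtain j where j: "j \<in> letters u" "j \<notin> T" by auto
      then have "j < D" using letters_subset[OF u] by auto
      then have "ract t D (pmat D T \<sigma>) ?M = 0"
        using j by (intro ract_monomial_zero[OF u pmat_carrier j(1)]) (auto simp: pmat_def)
      with False show ?thesis by simp
    qed
  qed
  also have "\<dots> = (if letters u = {..<D} then ract t D (permat D \<sigma>) ?M else 0)"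
    unfolding scal_sum_left[symmetric] using sum_supersets_alternating[of "{..<D}" "letters u", where 'a = 'k] letters_subset[OF u] by simp
  finally show ?thesis .
qed

lemma minor_map_homogeneous:
  fixes f :: "(_, 'k::field) mpoly"
  assumes f: "f \<in> S_ring t m n" "homogeneous d f"
  shows "minor_map m n f \<in> poly_ring ({..<m} \<times> {..<n})" "homogeneous (d * t) (minor_map m n f)"
proof -
  show "minor_map m n f \<in> poly_ring ({..<m} \<times> {..<n})"
    unfolding minor_map_def
  proof (rule poly_ring_subst[OF f(1)[unfolded S_ring_def]], clarify)
    fix I J assume "I \<in> subsets t m" and "J \<in> subsets t n"
    then show "(minor (generic_mat m n) I J :: (_, 'k) mpoly) \<in> poly_ring ({..<m} \<times> {..<n})"
      by (intro poly_ring_mono[OF _ generic_minor_poly(1)]) (auto simp: subsets_def)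
  qed
  show "homogeneous (d * t) (minor_map m n f)"
    unfolding minor_map_def
    by (rule homogeneous_subst[OF f(1)[unfolded S_ring_def] _ f(2)]) (auto intro: generic_minor_poly(2))
qed

text \<open>With \<open>d * t\<close> distinct letters, the image of the monomial under
  \<open>minor_map\<close> is multilinear in as many columns of a matrix with m rows. Alternating
  more than m of these columns gives zero by \<open>tensorial_alternator_zero\<close>, with the
  letters of \<open>v\<close> as auxiliary letters.\<close>

lemma alternated_monomial_J_ideal:
  fixes v :: "nat set \<times> nat set \<Rightarrow>\<^sub>0 nat"
  assumes v: "Poly_Mapping.keys v \<subseteq> subsets t m \<times> subsets t D" "mono_degree v = d" "card (letters v) = d * t"
    and B: "B \<subseteq> letters v" "m < card B"
  shows "(\<Sum>\<rho> | \<rho> permutes B. scal (of_int (sign \<rho>)) (ract t D (permat D \<rho>) (mono_eval var v))) \<in>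
    (J_ideal t m D :: (_, 'k::field_char_0) mpoly set)"
proof -
  let ?U = "letters v" and ?M = "mono_eval var v :: (_, 'k) mpoly"
  have UD: "?U \<subseteq> {..<D}" by (rule letters_subset[OF v(1)])
  have finU: "finite ?U" using UD finite_subset by blast
  have finB: "finite B" using B finU finite_subset by blast
  have MS: "?M \<in> S_ring t m D" by (rule mono_eval_S_ring[OF v(1)])
  have Mh: "homogeneous d ?M" using v(2) by (simp add: mono_eval_var homogeneous_def)
  note h = minor_map_homogeneous[OF MS Mh]
  let ?h = "minor_map m D ?M"
  let ?Q = "\<lambda>N. subst (\<lambda>(i, j). N i j) ?h :: (nat \<times> nat, 'k) mpoly"
  have "tensorial m D (d * t * 1) ?Q"
  proof (rule subst_tensorial[OF _ h])
    fix x :: "nat \<times> nat" assume "x \<in> {..<m} \<times> {..<D}"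
    then obtain i j where x: "x = (i, j)" "i < m" "j < D" by auto
    have "tensorial m D (Suc 0) (\<lambda>N. N i j * 1 :: (nat \<times> nat, 'k) mpoly)"
      using x by (intro tensorial.entry tensorial.const)
    then show "tensorial m D 1 (\<lambda>N. (case x of (i, j) \<Rightarrow> N i j) :: (nat \<times> nat, 'k) mpoly)" by (simp add: x)
  qed
  then have Q: "tensorial m D (d * t) ?Q" by simp
  \<comment> \<open>Right multiplication of the generic matrix by the transpose of
    \<open>R T \<sigma>\<close> moves column u to place \<open>\<sigma> u\<close> for u in
    \<open>T\<close>. Acting on the monomial, it is the permutation matrix of the inverse if
    \<open>T\<close> contains all letters; otherwise some letter meets a zero row.\<close>
  define R :: "nat set \<Rightarrow> (nat \<Rightarrow> nat) \<Rightarrow> 'k mat" where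
    "R T \<sigma> = mat D D (\<lambda>(j, u). if u \<in> T \<and> \<sigma> u = j then 1 else 0)" for T \<sigma>
  have R: "R T \<sigma> \<in> carrier_mat D D" for T \<sigma> by (simp add: R_def)
  have QR: "?Q (\<lambda>i l. \<Sum>u\<in>T. var (i, u) * (if \<sigma> u = l then 1 else 0)) = minor_map m D (ract t D (R T \<sigma>) ?M)"
    if T: "T \<subseteq> {..<D}" for T \<sigma>
    unfolding minor_map_ract[OF MS R]
  proof (rule subst_cong[OF h(1)], clarify)
    fix i l assume "l < D"
    then have "(\<Sum>u<D. scal (R T \<sigma> $$ (l, u)) (var (i, u))) = (\<Sum>u<D. if u \<in> T then var (i, u) * (if \<sigma> u = l then 1 else 0) else 0)"
      by (intro sum.cong) (auto simp: R_def)
    also have "\<dots> = (\<Sum>u\<in>T. var (i, u) * (if \<sigma> u = l then 1 else 0))"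
      by (rule sum.mono_neutral_cong_right) (use T in auto)
    finally show "(\<Sum>u\<in>T. var (i, u) * (if \<sigma> u = l then 1 else 0)) = (\<Sum>u<D. scal (R T \<sigma> $$ (l, u)) (var (i, u)))" by simp
  qed
  have RM: "ract t D (R T \<sigma>) ?M = (if T = ?U then ract t D (permat D (pinv \<sigma>)) ?M else 0)"
    if T: "T \<subseteq> ?U" and \<sigma>: "\<sigma> permutes B" for T \<sigma>
  proof -
    have sU: "\<sigma> permutes ?U" using \<sigma> B permutes_subset by blast
    have inv_eq: "\<sigma> u = j \<longleftrightarrow> u = pinv \<sigma> j" for u j using permutes_inv_eq[OF \<sigma>] by metis
    show ?thesis
    proof (cases "T = ?U")
      case True
      have "ract t D (R T \<sigma>) ?M = ract t D (permat D (pinv \<sigma>)) ?M"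
      proof (rule ract_monomial_cong[OF v(1) R pmat_carrier])
        fix j l assume j: "j \<in> ?U" and l: "l < D"
        have "pinv \<sigma> j \<in> ?U" using j permutes_in_image[OF permutes_inv[OF sU]] by blast
        then show "R T \<sigma> $$ (j, l) = permat D (pinv \<sigma>) $$ (j, l)"
          using j l UD True by (auto simp: R_def pmat_def inv_eq)
      qed
      with True show ?thesis by simp
    next
      case False
      then obtain u0 where u0: "u0 \<in> ?U" "u0 \<notin> T" using T by auto
      have j: "\<sigma> u0 \<in> ?U" using u0 permutes_in_image[OF sU] by blast
      have "ract t D (R T \<sigma>) ?M = 0"
      proof (rule ract_monomial_zero[OF v(1) R j])
        fix l assume "l < D"
        moreover have "\<sigma> u0 < D" using j UD by auto
        ultimately show "R T \<sigma> $$ (\<sigma> u0, l) = 0"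
          using u0 permutes_inj[OF \<sigma>] by (auto simp: R_def inj_eq)
      qed
      with False show ?thesis by simp
    qed
  qed
  let ?g = "\<Sum>\<rho> | \<rho> permutes B. scal (of_int (sign \<rho>)) (ract t D (permat D \<rho>) ?M)"
  have gS: "?g \<in> S_ring t m D"
    using ract_S_ring[OF MS] unfolding S_ring_def by (intro poly_ring_sum poly_ring_scal) auto
  have "?g = (\<Sum>\<sigma> | \<sigma> permutes B. scal (of_int (sign (pinv \<sigma>))) (ract t D (permat D (pinv \<sigma>)) ?M))"
    by (rule sum_permutations_inverse)
  also have "\<dots> = (\<Sum>\<sigma> | \<sigma> permutes B. scal (of_int (sign \<sigma>)) (ract t D (R ?U \<sigma>) ?M))"
  proof (rule sum.cong[OF refl])
    fix \<sigma> assume "\<sigma> \<in> {\<sigma>. \<sigma> permutes B}"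
    then have \<sigma>: "\<sigma> permutes B" by simp
    then have "permutation \<sigma>" using finB permutation_permutes by blast
    then show "scal (of_int (sign (pinv \<sigma>))) (ract t D (permat D (pinv \<sigma>)) ?M) =
      scal (of_int (sign \<sigma>)) (ract t D (R ?U \<sigma>) ?M)" by (simp add: RM[OF _ \<sigma>] sign_inverse)
  qed
  finally have g: "?g = (\<Sum>\<sigma> | \<sigma> permutes B. scal (of_int (sign \<sigma>)) (ract t D (R ?U \<sigma>) ?M))" .
  have "0 = (\<Sum>T\<in>Pow ?U. \<Sum>\<sigma> | \<sigma> permutes B. (-1) ^ (d * t - card T) * of_int (sign \<sigma>) *
     ?Q (\<lambda>i l. \<Sum>u\<in>T. var (i, u) * (if \<sigma> u = l then 1 else 0)))"
    by (rule tensorial_alternator_zero[OF mpoly_double_zero Q finU v(3) B, symmetric])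
  also have "\<dots> = (\<Sum>T\<in>Pow ?U. \<Sum>\<sigma> | \<sigma> permutes B. if T = ?U then of_int (sign \<sigma>) * minor_map m D (ract t D (R ?U \<sigma>) ?M) else 0)"
  proof (intro sum.cong refl)
    fix T \<sigma> assume T: "T \<in> Pow ?U" and "\<sigma> \<in> {\<sigma>. \<sigma> permutes B}"
    then have \<sigma>: "\<sigma> permutes B" by simp
    have TD: "T \<subseteq> {..<D}" using T UD by auto
    show "(-1) ^ (d * t - card T) * of_int (sign \<sigma>) * ?Q (\<lambda>i l. \<Sum>u\<in>T. var (i, u) * (if \<sigma> u = l then 1 else 0)) =
      (if T = ?U then of_int (sign \<sigma>) * minor_map m D (ract t D (R ?U \<sigma>) ?M) else 0)"
      unfolding QR[OF TD] using T v(3) by (simp add: RM[OF _ \<sigma>] minor_map_def)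
  qed
  also have "\<dots> = (\<Sum>\<sigma> | \<sigma> permutes B. of_int (sign \<sigma>) * minor_map m D (ract t D (R ?U \<sigma>) ?M))"
    by (subst sum.swap) (simp add: finU)
  also have "\<dots> = minor_map m D ?g"
    unfolding g minor_map_def by (simp add: subst_sum subst_mult scal_def const.hom_of_int subst.hom_of_int)
  finally show ?thesis using gS by (simp add: J_ideal_def)
qed

lemma S1J_zero: "0 \<in> S1J t m n" and S1J_add: "f \<in> S1J t m n \<Longrightarrow> g \<in> S1J t m n \<Longrightarrow> f + g \<in> S1J t m n"
  and S1J_scal: "f \<in> S1J t m n \<Longrightarrow> scal c f \<in> S1J t m n"
  and S1J_sum: "(\<And>i. i \<in> X \<Longrightarrow> h i \<in> S1J t m n) \<Longrightarrow> (\<Sum>i\<in>X. h i) \<in> S1J t m n"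
  unfolding S1J_def by (simp_all add: kpoly.span_zero kpoly.span_add kpoly.span_scale kpoly.span_sum)

lemma S1J_mult: "y \<in> S_ring t m n \<Longrightarrow> homogeneous 1 y \<Longrightarrow> f \<in> J_ideal t m n \<Longrightarrow> y * f \<in> S1J t m n"
  unfolding S1J_def by (rule kpoly.span_base) blast

text \<open>Split off a variable y with column set \<open>J\<close>. The rest, alternated over
  \<open>B = A - J\<close>, is a relation g, so y g and its alternation over \<open>A\<close> lie in
  \<open>S1J\<close>. That alternation is \<open>card B\<close> factorial times the alternation of
  the monomial itself, and characteristic 0 permits division.\<close>

lemma alternated_full_monomial_S1J:
  fixes u :: "nat set \<times> nat set \<Rightarrow>\<^sub>0 nat"
  assumes u: "Poly_Mapping.keys u \<subseteq> subsets t m \<times> subsets t D" "mono_degree u = d" and D: "D = d * t"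
    and A: "A \<in> subsets (Suc (m + t)) D" and full: "letters u = {..<D}"
  shows "(\<Sum>\<sigma> | \<sigma> permutes A. scal (of_int (sign \<sigma>)) (ract t D (permat D \<sigma>) (mono_eval var u))) \<in>
    (S1J t m D :: (_, 'k::field_char_0) mpoly set)"
proof -
  let ?P = "\<lambda>A. {\<sigma>. \<sigma> permutes A}"
  have finA: "finite A" and cA: "card A = Suc (m + t)" and AD: "A \<subseteq> {..<D}"
    using A by (auto simp: subsets_def dest: finite_subset)
  \<comment> \<open>The alternated set is nonempty, so the degree is positive and there is a
    variable to split off.\<close>
  have "D \<noteq> 0"
  proof
    assume "D = 0"
    then have "A = {}" using AD by simp
    then show False using cA by simp
  qed
  then obtain d' where d': "d = Suc d'" using D by (cases d) auto
  obtain x v where x: "x \<in> subsets t m \<times> subsets t D" "u = Poly_Mapping.single x 1 + v" "mono_degree v = d'"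
    "Poly_Mapping.keys v \<subseteq> subsets t m \<times> subsets t D"
    by (rule monomial_split[OF u(2)[unfolded d'] u(1)]) blast
  obtain I J where xIJ: "x = (I, J)" by fastforce
  have I: "I \<in> subsets t m" and J: "J \<in> subsets t D" using x(1) by (auto simp: xIJ)
  have finJ: "finite J" and cJ: "card J = t" using J by (auto simp: subsets_def dest: finite_subset)
  have finv: "finite (letters v)" using letters_subset[OF x(4)] finite_subset by blast
  have un: "J \<union> letters v = {..<D}" using full by (simp add: x(2) xIJ letters_single_add del: One_nat_def)
  have cv: "card (letters v) \<le> d' * t" by (rule card_letters[OF x(3,4)])
  have inter: "card (J \<union> letters v) + card (J \<inter> letters v) = t + card (letters v)"
    using card_Un_Int[OF finJ finv] cJ by simp
  \<comment> \<open>All t + d' t letters have to be covered by the t letters of \<open>J\<close> and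
    at most d' t letters of \<open>v\<close>, which leaves no room for overlap.\<close>
  have "card (letters v) = d' * t" and "card (J \<inter> letters v) = 0"
    using inter cv by (auto simp: un D d')
  then have cv': "card (letters v) = d' * t" and disj: "J \<inter> letters v = {}" using finJ by auto
  define B where "B = A - J"
  have BA: "B \<subseteq> A" and BU: "B \<subseteq> letters v" using un AD by (auto simp: B_def)
  have finB: "finite B" using finA by (simp add: B_def)
  have "card A \<le> card B + card J"
    using card_Un_le[of B J] card_mono[of "B \<union> J" A] finB finJ by (auto simp: B_def)
  then have cB: "m < card B" using cA cJ by simp
  let ?y = "var (I, J) :: (_, 'k) mpoly" and ?M' = "mono_eval var v :: (_, 'k) mpoly" and ?M = "mono_eval var u :: (_, 'k) mpoly"
  have MyM: "?M = ?y * ?M'" unfolding x(2) xIJ mono_eval_add mono_eval_single ..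
  have MS: "?M \<in> S_ring t m D" by (rule mono_eval_S_ring[OF u(1)])
  define g where "g = (\<Sum>\<rho>\<in>?P B. scal (of_int (sign \<rho>)) (ract t D (permat D \<rho>) ?M'))"
  have gJ: "g \<in> J_ideal t m D" unfolding g_def by (rule alternated_monomial_J_ideal[OF x(4,3) cv' BU cB])
  have yS: "?y \<in> S_ring t m D" unfolding S_ring_def using I J by (intro poly_ring_var) auto
  have yg: "?y * g \<in> S1J t m D" by (rule S1J_mult[OF yS homogeneous_var gJ])
  \<comment> \<open>Permutations of \<open>B\<close> fix the letters in \<open>J\<close> and hence
    y, so alternating the monomial over \<open>B\<close> is y times alternating
    \<open>v\<close>.\<close>
  have ryM: "ract t D (permat D \<rho>) ?M = ?y * ract t D (permat D \<rho>) ?M'" if \<rho>: "\<rho> permutes B" for \<rho>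
  proof -
    have e: "mono_eval var (Poly_Mapping.single (I, J) 1) = ?y" by (rule mono_eval_single)
    have "ract t D (permat D \<rho>) ?y = ract t D (1\<^sub>m D) ?y"
      unfolding e[symmetric]
    proof (rule ract_monomial_cong[of _ t m D])
      fix j l assume "j \<in> letters (Poly_Mapping.single (I, J) 1)" "l < D"
      then have "j \<in> J" by (simp add: letters_def)
      then have "\<rho> j = j" "j < D" using \<rho> J by (auto simp: B_def permutes_not_in subsets_def)
      then show "permat D \<rho> $$ (j, l) = 1\<^sub>m D $$ (j, l)" using \<open>l < D\<close> by (auto simp: pmat_def)
    qed (use I J in auto)
    then show ?thesis by (simp add: MyM ract_mult ract_one[OF yS])
  qed
  have perm: "\<rho> permutes {..<D}" if "\<rho> permutes A" for \<rho> using that AD permutes_subset by blast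
  have permB: "\<rho> permutes A" if "\<rho> permutes B" for \<rho> using that BA permutes_subset by blast
  have permu: "permutation \<rho>" if "\<rho> permutes A" for \<rho> using that finA permutation_permutes by blast
  let ?S = "\<Sum>\<sigma>\<in>?P A. scal (of_int (sign \<sigma>)) (ract t D (permat D \<sigma>) ?M)"
  have "(\<Sum>\<sigma>\<in>?P A. scal (of_int (sign \<sigma>)) (ract t D (permat D \<sigma>) (?y * g))) =
    (\<Sum>\<sigma>\<in>?P A. \<Sum>\<rho>\<in>?P B. scal (of_int (sign (\<sigma> \<circ> \<rho>))) (ract t D (permat D (\<sigma> \<circ> \<rho>)) ?M))"
  proof (rule sum.cong[OF refl])
    fix \<sigma> assume "\<sigma> \<in> ?P A"
    then have \<sigma>: "\<sigma> permutes A" by simp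
    have "?y * g = (\<Sum>\<rho>\<in>?P B. scal (of_int (sign \<rho>)) (ract t D (permat D \<rho>) ?M))"
      unfolding g_def sum_distrib_left by (intro sum.cong refl) (simp add: ryM scal_mult_right)
    then have "scal (of_int (sign \<sigma>)) (ract t D (permat D \<sigma>) (?y * g)) =
      (\<Sum>\<rho>\<in>?P B. scal (of_int (sign \<sigma> * sign \<rho>)) (ract t D (permat D \<sigma>) (ract t D (permat D \<rho>) ?M)))"
      by (simp add: ract_sum ract_scal scal_sum)
    also have "\<dots> = (\<Sum>\<rho>\<in>?P B. scal (of_int (sign (\<sigma> \<circ> \<rho>))) (ract t D (permat D (\<sigma> \<circ> \<rho>)) ?M))"
    proof (rule sum.cong[OF refl])
      fix \<rho> assume "\<rho> \<in> ?P B"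
      then have \<rho>: "\<rho> permutes A" using permB by simp
      have "ract t D (permat D \<sigma>) (ract t D (permat D \<rho>) ?M) = ract t D (permat D (\<sigma> \<circ> \<rho>)) ?M"
        by (simp add: ract_ract[OF MS pmat_carrier pmat_carrier] pmat_mult_permat perm \<sigma> \<rho>)
      then show "scal (of_int (sign \<sigma> * sign \<rho>)) (ract t D (permat D \<sigma>) (ract t D (permat D \<rho>) ?M)) =
        scal (of_int (sign (\<sigma> \<circ> \<rho>))) (ract t D (permat D (\<sigma> \<circ> \<rho>)) ?M)"
        using permu \<sigma> \<rho> by (simp add: sign_compose)
    qed
    finally show "scal (of_int (sign \<sigma>)) (ract t D (permat D \<sigma>) (?y * g)) =
      (\<Sum>\<rho>\<in>?P B. scal (of_int (sign (\<sigma> \<circ> \<rho>))) (ract t D (permat D (\<sigma> \<circ> \<rho>)) ?M))" .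
  qed
  \<comment> \<open>For fixed \<open>\<rho>\<close>, composition with \<open>\<rho>\<close>
    reindexes the alternation over the larger group and absorbs both \<open>\<rho>\<close> and its
    sign.\<close>
  also have "\<dots> = (\<Sum>\<rho>\<in>?P B. ?S)"
    by (subst sum.swap, rule sum.cong[OF refl],
        rule sum_perms_compose_right[OF finA, of _ "\<lambda>\<sigma>. scal (of_int (sign \<sigma>)) (ract t D (permat D \<sigma>) ?M)"])
      (use permB in simp)
  also have "\<dots> = scal (of_nat (card (?P B))) ?S"
    by (simp add: scal_def const.hom_of_nat)
  finally have eq: "scal (of_nat (card (?P B))) ?S = (\<Sum>\<sigma>\<in>?P A. scal (of_int (sign \<sigma>)) (ract t D (permat D \<sigma>) (?y * g)))" ..
  have "(\<Sum>\<sigma>\<in>?P A. scal (of_int (sign \<sigma>)) (ract t D (permat D \<sigma>) (?y * g))) \<in> S1J t m D"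
    by (intro S1J_sum S1J_scal ract_S1J[OF yg pmat_carrier])
  then have "scal (1 / of_nat (card (?P B))) (scal (of_nat (card (?P B))) ?S) \<in> S1J t m D"
    unfolding eq by (rule S1J_scal)
  moreover have "card (?P B) \<noteq> 0" using finB by (simp add: card_permutations)
  ultimately show ?thesis by simp
qed

text \<open>The operator is the alternator on D letters between the actions of \<open>E\<close> and
  \<open>E'\<close>. Since \<open>ract\<close> preserves \<open>S1J\<close>, it suffices to treat
  the middle factor, and there monomials.\<close>

lemma alternator_S1J:
  fixes f :: "(_, 'k::field_char_0) mpoly"
  assumes f: "f \<in> S_ring t m p" "homogeneous d f" and A: "A \<in> subsets (Suc (m + t)) (d * t)"
    and E: "E \<in> carrier_mat p (d * t)" and E': "E' \<in> carrier_mat (d * t) p"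
  shows "(\<Sum>T\<in>Pow {..<d * t}. \<Sum>\<sigma> | \<sigma> permutes A. scal (altsgn (d * t) T \<sigma>)
       (ract t p (E * (pmat (d * t) T \<sigma> * E')) f)) \<in> S1J t m p"
proof -
  let ?D = "d * t"
  let ?alt = "\<lambda>f. \<Sum>T\<in>Pow {..<?D}. \<Sum>\<sigma> | \<sigma> permutes A. scal (altsgn ?D T \<sigma>) (ract t ?D (pmat ?D T \<sigma>) f) :: (_, 'k) mpoly"
  have alt_mono: "?alt (mono_eval var u) \<in> S1J t m ?D"
    if u: "Poly_Mapping.keys u \<subseteq> subsets t m \<times> subsets t ?D" "mono_degree u = d" for u
  proof -
    have "?alt (mono_eval var u) = (\<Sum>\<sigma> | \<sigma> permutes A. scal (of_int (sign \<sigma>))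
      (\<Sum>T\<in>Pow {..<?D}. scal ((-1) ^ (?D - card T)) (ract t ?D (pmat ?D T \<sigma>) (mono_eval var u))))"
      by (subst sum.swap) (simp add: scal_sum altsgn_def mult.commute)
    also have "\<dots> = (if letters u = {..<?D} then \<Sum>\<sigma> | \<sigma> permutes A. scal (of_int (sign \<sigma>)) (ract t ?D (permat ?D \<sigma>) (mono_eval var u)) else 0)"
      unfolding sum_pmat_monomial[OF u(1)] by simp
    also have "\<dots> \<in> S1J t m ?D"
      using alternated_full_monomial_S1J[OF u refl A, where 'k = 'k] by (simp add: S1J_zero)
    finally show ?thesis .
  qed
  have alt: "?alt f' \<in> S1J t m ?D" if f': "f' \<in> S_ring t m ?D" "homogeneous d f'" for f'
  proof (rule homogeneous_subspace_induct[OF f'[unfolded S_ring_def]])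
    show "?alt 0 \<in> S1J t m ?D" by (simp add: S1J_zero)
    show "?alt (g + h) \<in> S1J t m ?D" if "?alt g \<in> S1J t m ?D" "?alt h \<in> S1J t m ?D" for g h
      using S1J_add[OF that] by (simp add: ract_add scal_add sum.distrib)
    show "?alt (scal c (mono_eval var u)) \<in> S1J t m ?D"
      if "Poly_Mapping.keys u \<subseteq> subsets t m \<times> subsets t ?D" "mono_degree u = d" for c u
      using S1J_scal[OF alt_mono[OF that], of c] by (simp add: ract_scal scal_sum mult.commute)
  qed
  have "(\<Sum>T\<in>Pow {..<?D}. \<Sum>\<sigma> | \<sigma> permutes A. scal (altsgn ?D T \<sigma>) (ract t p (E * (pmat ?D T \<sigma> * E')) f)) =
    ract t p E' (?alt (ract t ?D E f))"
    using ract_ract[OF ract_S_ring[OF f(1)] pmat_carrier E'] ract_ract[OF f(1) E mult_carrier_mat[OF pmat_carrier E']]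
    by (simp add: ract_sum ract_scal)
  also have "\<dots> \<in> S1J t m p"
    by (rule ract_S1J[OF alt[OF ract_S_ring[OF f(1)] ract_homogeneous[OF f]] E'])
  finally show ?thesis .
qed

text \<open>Modulo \<open>S1J\<close> only the part of the splitting that factors through
  \<open>k^(m + t)\<close> remains. This is where the particular number m + t enters the final
  bounds.\<close>

lemma S1J_if_compressions_S1J:
  fixes f :: "(_, 'k::field_char_0) mpoly"
  assumes S: "splitting p (m + t) (d * t) r a C C' r2 b A E E'" and f: "f \<in> S_ring t m p" "homogeneous d f"
    and red: "\<And>i. i < r \<Longrightarrow> ract t p (C i * C' i) f \<in> S1J t m p"
  shows "f \<in> S1J t m p"
proof -
  have "(\<Sum>T\<in>Pow {..<d * t}. \<Sum>\<sigma> | \<sigma> permutes A j. scal (altsgn (d * t) T \<sigma>)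
       (ract t p (E j * (pmat (d * t) T \<sigma> * E' j)) f)) \<in> S1J t m p" if "j < r2" for j
    using S that unfolding splitting_def by (intro alternator_S1J[OF f]) auto
  then show ?thesis
    by (subst ract_splitting[OF S f]) (rule S1J_add; rule S1J_sum; rule S1J_scal; simp add: red)
qed

section \<open>Equivariant maps and singular matrices\<close>

text \<open>Lagrange interpolation: the value at 0 of a polynomial of degree at most D is a fixed
  combination of its values at points taken from any infinite set.\<close>

lemma interpolation_at_zero:
  assumes "infinite (S :: 'k::field set)"
  shows "\<exists>X c. finite X \<and> X \<subseteq> S \<and> (\<forall>e\<le>D. (\<Sum>x\<in>X. c x * x ^ e) = (if e = 0 then 1 else 0))"
  using assms
proof (induction D arbitrary: S)
  case 0
  then obtain x0 where "x0 \<in> S" using infinite_imp_nonempty by blast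
  then show ?case by (intro exI[of _ "{x0}"] exI[of _ "\<lambda>x. 1"]) auto
next
  case (Suc D)
  obtain x0 where x0: "x0 \<in> S" using infinite_imp_nonempty[OF Suc.prems] by blast
  have "infinite (S - {x0})" using Suc.prems by simp
  from Suc.IH[OF this] obtain X c where X: "finite X" "X \<subseteq> S - {x0}"
    and c: "\<And>e. e \<le> D \<Longrightarrow> (\<Sum>x\<in>X. c x * x ^ e) = (if e = 0 then 1 else 0)" by blast
  \<comment> \<open>Write f(x) = f(x0) + (x - x0) g(x). The divided difference g has degree at most
    D, so the given weights compute g(0), and f(0) = f(x0) - x0 g(0).\<close>
  define c' where "c' x = (if x = x0 then 1 + (\<Sum>x\<in>X. x0 * c x / (x - x0)) else - x0 * c x / (x - x0))" for x
  have x0X: "x0 \<notin> X" using X by auto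
  have "(\<Sum>x\<in>insert x0 X. c' x * x ^ e) = (if e = 0 then 1 else 0)" if e: "e \<le> Suc D" for e
  proof -
    have "(\<Sum>x\<in>insert x0 X. c' x * x ^ e) = c' x0 * x0 ^ e + (\<Sum>x\<in>X. - x0 * c x / (x - x0) * x ^ e)"
      using X(1) x0X by (auto simp: c'_def intro!: sum.cong)
    also have "\<dots> = x0 ^ e - x0 * (\<Sum>x\<in>X. c x * ((x ^ e - x0 ^ e) / (x - x0)))"
      by (simp add: c'_def algebra_simps sum_distrib_left sum_distrib_right diff_divide_distrib sum_subtractf sum_negf)
    also have "(\<Sum>x\<in>X. c x * ((x ^ e - x0 ^ e) / (x - x0))) = (\<Sum>x\<in>X. \<Sum>i<e. x0 ^ (e - Suc i) * (c x * x ^ i))"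
    proof (rule sum.cong[OF refl])
      fix x assume "x \<in> X"
      then have "x - x0 \<noteq> 0" using x0X by auto
      then have "(x ^ e - x0 ^ e) / (x - x0) = (\<Sum>i<e. x0 ^ (e - Suc i) * x ^ i)"
        by (simp add: power_diff_sumr2[of x e x0])
      then show "c x * ((x ^ e - x0 ^ e) / (x - x0)) = (\<Sum>i<e. x0 ^ (e - Suc i) * (c x * x ^ i))"
        by (simp add: sum_distrib_left ac_simps)
    qed
    also have "\<dots> = (\<Sum>i<e. x0 ^ (e - Suc i) * (\<Sum>x\<in>X. c x * x ^ i))"
      unfolding sum_distrib_left by (rule sum.swap)
    also have "\<dots> = (\<Sum>i<e. if i = 0 then x0 ^ (e - 1) else 0)"
      using e by (intro sum.cong) (auto simp: c)
    also have "x0 ^ e - x0 * \<dots> = (if e = 0 then 1 else 0)"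
      by (cases e) auto
    finally show ?thesis .
  qed
  then show ?case using X x0 by (intro exI[of _ "insert x0 X"] exI[of _ c']) auto
qed

text \<open>Only eigenvalues are excluded, and these are the finitely many roots of the
  characteristic polynomial.\<close>

lemma invertible_shifts_infinite:
  fixes C :: "'k::field_char_0 mat"
  assumes C: "C \<in> carrier_mat n n"
  shows "infinite {y. det (char_matrix C y) \<noteq> 0}"
proof -
  have "char_poly C \<noteq> 0" using degree_monic_char_poly[OF C] by auto
  then have "finite {y. poly (char_poly C) y = 0}" by (rule poly_roots_finite)
  then have "finite {y. det (char_matrix C y) = 0}"
    using eigenvalue_det[OF C] eigenvalue_root_char_poly[OF C] by simp
  moreover have "{y. det (char_matrix C y) \<noteq> 0} = - {y. det (char_matrix C y) = 0}" by auto
  ultimately show ?thesis using infinite_UNIV_char_0[where 'a = 'k] by (simp add: Compl_eq_Diff_UNIV)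
qed

text \<open>The entries of the D-th tensor power of C - y are polynomials in y of degree at most D.
  Interpolating their value at y = 0 from invertible shifts replaces a Zariski density argument by a
  finite linear combination.\<close>

lemma tensor_density:
  fixes C :: "'k::field_char_0 mat"
  assumes C: "C \<in> carrier_mat n n"
  obtains X c where "finite X" "\<And>y. y \<in> X \<Longrightarrow> det (char_matrix C y) \<noteq> 0"
    "\<And>\<omega> \<omega>'. (\<And>s. s < D \<Longrightarrow> \<omega> s < n) \<Longrightarrow> (\<And>s. s < D \<Longrightarrow> \<omega>' s < n) \<Longrightarrow>
      tens D (ent C) \<omega> \<omega>' = (\<Sum>y\<in>X. c y * tens D (ent (char_matrix C y)) \<omega> \<omega>')"
proof -
  obtain X c where X: "finite X" "X \<subseteq> {y. det (char_matrix C y) \<noteq> 0}"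
    and c: "\<And>e. e \<le> D \<Longrightarrow> (\<Sum>x\<in>X. c x * x ^ e) = (if e = 0 then 1 else 0)"
    using interpolation_at_zero[OF invertible_shifts_infinite[OF C], of D] by blast
  have "tens D (ent C) \<omega> \<omega>' = (\<Sum>y\<in>X. c y * tens D (ent (char_matrix C y)) \<omega> \<omega>')"
    if w: "\<And>s. s < D \<Longrightarrow> \<omega> s < n" "\<And>s. s < D \<Longrightarrow> \<omega>' s < n" for \<omega> \<omega>'
  proof -
    \<comment> \<open>Off the diagonal the shift has no effect, so those factors are constant in
      y.\<close>
    define P where "P = (\<Prod>s<D. [: C $$ (\<omega> s, \<omega>' s), if \<omega> s = \<omega>' s then -1 else 0 :])"
    have val: "tens D (ent (char_matrix C y)) \<omega> \<omega>' = poly P y" for y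
      unfolding tens_def P_def poly_prod
      by (intro prod.cong refl) (use C w in \<open>auto simp: char_matrix_def\<close>)
    have "degree P \<le> (\<Sum>s<D. 1)"
      unfolding P_def
    proof (rule order_trans[OF degree_prod_sum_le sum_mono])
      show "(degree \<circ> (\<lambda>s. [:C $$ (\<omega> s, \<omega>' s), if \<omega> s = \<omega>' s then -1 else 0:])) s \<le> 1" for s
        unfolding o_apply by (rule order_trans[OF degree_pCons_le]) simp
    qed simp
    then have deg: "degree P \<le> D" by simp
    have "(\<Sum>y\<in>X. c y * tens D (ent (char_matrix C y)) \<omega> \<omega>') = (\<Sum>y\<in>X. \<Sum>i\<le>degree P. coeff P i * (c y * y ^ i))"
      unfolding val poly_altdef sum_distrib_left by (simp add: ac_simps)
    also have "\<dots> = (\<Sum>i\<le>degree P. coeff P i * (\<Sum>y\<in>X. c y * y ^ i))"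
      unfolding sum_distrib_left by (rule sum.swap)
    also have "\<dots> = (\<Sum>i\<le>degree P. if i = 0 then coeff P 0 else 0)"
      using deg by (intro sum.cong) (auto simp: c)
    also have "\<dots> = poly P 0" by (simp add: poly_0_coeff_0)
    also have "\<dots> = tens D (ent C) \<omega> \<omega>'" by (simp add: P_def poly_prod tens_def)
    finally show ?thesis by simp
  qed
  then show ?thesis using that X by blast
qed

lemma tensorial_density:
  fixes P :: "(nat \<Rightarrow> nat \<Rightarrow> ('x, 'k::field) mpoly) \<Rightarrow> ('x, 'k) mpoly"
  assumes P: "tensorial p q D P"
    and c: "\<And>\<omega> \<omega>'. (\<And>s. s < D \<Longrightarrow> \<omega> s < p) \<Longrightarrow> (\<And>s. s < D \<Longrightarrow> \<omega>' s < q) \<Longrightarrow>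
      tens D (ent C) \<omega> \<omega>' = (\<Sum>y\<in>(X :: 'k set). c y * tens D (ent (K y)) \<omega> \<omega>')"
  shows "P (cm C) = (\<Sum>y\<in>X. scal (c y) (P (cm (K y))))"
proof -
  obtain H where H: "\<And>h h'. H (\<lambda>\<omega> \<omega>'. h \<omega> \<omega>' + h' \<omega> \<omega>') = H h + H h'"
    "\<And>c h. H (\<lambda>\<omega> \<omega>'. c * h \<omega> \<omega>') = c * H h" "\<And>M. H (tens D M) = P M"
    "\<And>h h'. (\<And>\<omega> \<omega>'. (\<And>s. s < D \<Longrightarrow> \<omega> s < p) \<Longrightarrow> (\<And>s. s < D \<Longrightarrow> \<omega>' s < q) \<Longrightarrow> h \<omega> \<omega>' = h' \<omega> \<omega>') \<Longrightarrow> H h = H h'"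
    by (rule tensorial_linear[OF P]) blast
  have "H (tens D (cm C)) = H (\<lambda>\<omega> \<omega>'. \<Sum>y\<in>X. const (c y) * tens D (cm (K y)) \<omega> \<omega>')"
  proof (rule H(4))
    fix \<omega> \<omega>' assume w: "\<And>s. s < D \<Longrightarrow> \<omega> s < p" "\<And>s. s < D \<Longrightarrow> \<omega>' s < q"
    show "(tens D (cm C) \<omega> \<omega>' :: ('x, 'k) mpoly) = (\<Sum>y\<in>X. const (c y) * tens D (cm (K y)) \<omega> \<omega>')"
    proof -
      have "tens D (ent C) \<omega> \<omega>' = (\<Sum>y\<in>X. c y * tens D (ent (K y)) \<omega> \<omega>')" by (rule c) (use w in auto)
      then have "(const (tens D (ent C) \<omega> \<omega>') :: ('x, 'k) mpoly) = const (\<Sum>y\<in>X. c y * tens D (ent (K y)) \<omega> \<omega>')"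
        by (rule arg_cong)
      then show ?thesis by (simp only: const_tens const.hom_sum const.hom_mult)
    qed
  qed
  then show ?thesis by (simp only: linear_functional_sum[of H, OF H(1,2)] H(2,3) scal_def)
qed

section \<open>Invertible matrices\<close>

lemma carrier_GL: "carrier (GL n) = {B. B \<in> carrier_mat n n \<and> (\<exists>B'\<in>carrier_mat n n. B' * B = 1\<^sub>m n \<and> B * B' = 1\<^sub>m n)}"
  by (auto simp: GL_def units_of_carrier Units_def ring_mat_def)

lemma GL_inv:
  fixes B :: "'k::field mat"
  assumes "B \<in> carrier (GL n)"
  shows "inv\<^bsub>GL n\<^esub> B \<in> carrier_mat n n" "B * inv\<^bsub>GL n\<^esub> B = 1\<^sub>m n"
proof -
  interpret R: ring "ring_mat TYPE('k) n ()" by (rule ring_mat)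
  interpret G: group "GL n :: 'k mat monoid" unfolding GL_def by (rule R.units_group)
  have "inv\<^bsub>GL n\<^esub> B \<in> carrier (GL n)" using assms by simp
  then show "inv\<^bsub>GL n\<^esub> B \<in> carrier_mat n n" by (simp add: carrier_GL)
  have "B \<otimes>\<^bsub>GL n\<^esub> inv\<^bsub>GL n\<^esub> B = \<one>\<^bsub>GL n\<^esub>" using assms by (rule G.r_inv)
  then show "B * inv\<^bsub>GL n\<^esub> B = 1\<^sub>m n" by (simp add: GL_def units_of_mult units_of_one ring_mat_def)
qed

lemma GL_one: "1\<^sub>m n \<in> carrier (GL n)" "inv\<^bsub>GL n\<^esub> (1\<^sub>m n) = (1\<^sub>m n :: 'k::field mat)"
proof -
  show 1: "1\<^sub>m n \<in> carrier (GL n)" for n :: nat unfolding carrier_GL by (auto intro!: bexI[of _ "1\<^sub>m n"])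
  show "inv\<^bsub>GL n\<^esub> (1\<^sub>m n) = (1\<^sub>m n :: 'k mat)" using GL_inv[OF 1, of n] by (metis left_mult_one_mat)
qed

text \<open>The group acts on polynomials through inverses. As every invertible matrix is an
  inverse, equivariance covers \<open>ract\<close> for all of them.\<close>

lemma GL_inverse_of:
  fixes C :: "'k::field mat"
  assumes C: "C \<in> carrier_mat n n" "det C \<noteq> 0"
  obtains B where "B \<in> carrier (GL n)" "inv\<^bsub>GL n\<^esub> B = C"
proof -
  have "C \<in> Units (ring_mat TYPE('k) n ())" by (rule det_non_zero_imp_unit[OF C])
  then have CG: "C \<in> carrier (GL n)" by (simp add: GL_def units_of_carrier)
  interpret R: ring "ring_mat TYPE('k) n ()" by (rule ring_mat)
  interpret G: group "GL n :: 'k mat monoid" unfolding GL_def by (rule R.units_group)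
  show ?thesis using that[of "inv\<^bsub>GL n\<^esub> C"] CG by simp
qed

lemma sum_lessThan_append:
  fixes r r' :: nat
  shows "(\<Sum>i<r + r'. if i < r then g i else h (i - r)) = (\<Sum>i<r. g i) + (\<Sum>i<r'. h i :: 'a::comm_monoid_add)"
  by (induction r') (auto simp: add.assoc)

section \<open>Linear maps between Schur modules\<close>

lemma schur_add: "u \<in> schur n \<mu> \<Longrightarrow> v \<in> schur n \<mu> \<Longrightarrow> u + v \<in> schur n \<mu>"
  and schur_scal: "u \<in> schur n \<mu> \<Longrightarrow> scal c u \<in> schur n \<mu>"
  and schur_zero: "0 \<in> schur n \<mu>"
  and schur_sum: "(\<And>i. i \<in> X \<Longrightarrow> h i \<in> schur n \<mu>) \<Longrightarrow> (\<Sum>i\<in>X. h i) \<in> schur n \<mu>"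
  unfolding schur_def by (simp_all add: kpoly.span_add kpoly.span_scale kpoly.span_zero kpoly.span_sum)

lemma bischur_add:
  assumes "\<phi> \<in> bischur m n \<gamma> \<mu>" "\<psi> \<in> bischur m n \<gamma> \<mu>"
  shows "(\<lambda>w. \<phi> w + \<psi> w) \<in> bischur m n \<gamma> \<mu>"
proof -
  obtain r u f where 1: "\<phi> = (\<lambda>w. \<Sum>i<(r::nat). scal (f i w) (u i))" "\<forall>i<r. u i \<in> schur m \<gamma> \<and> f i \<in> dual_space (schur n \<mu>)"
    using assms(1) unfolding bischur_def by blast
  obtain r' u' f' where 2: "\<psi> = (\<lambda>w. \<Sum>i<(r'::nat). scal (f' i w) (u' i))" "\<forall>i<r'. u' i \<in> schur m \<gamma> \<and> f' i \<in> dual_space (schur n \<mu>)"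
    using assms(2) unfolding bischur_def by blast
  define F where "F i = (if i < r then f i else f' (i - r))" for i
  define U where "U i = (if i < r then u i else u' (i - r))" for i
  have "(\<lambda>w. \<phi> w + \<psi> w) = (\<lambda>w. \<Sum>i<r + r'. scal (F i w) (U i))"
    unfolding 1 2 F_def U_def sum_lessThan_append[symmetric] by (auto intro!: sum.cong)
  moreover have "\<forall>i<r + r'. U i \<in> schur m \<gamma> \<and> F i \<in> dual_space (schur n \<mu>)"
    using 1(2) 2(2) by (auto simp: F_def U_def)
  ultimately show ?thesis unfolding bischur_def by blast
qed

text \<open>Finite sums of pure tensors are stable under linear maps on either side. Truncation to
  zero outside the Schur module matches the convention of \<open>dual_space\<close>.\<close>

lemma bischur_map:
  assumes \<phi>: "\<phi> \<in> bischur m n \<gamma> \<mu>"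
    and g: "\<And>u. u \<in> schur m \<gamma> \<Longrightarrow> g u \<in> schur m \<gamma>" "\<And>u v. g (u + v) = g u + g v" "\<And>c u. g (scal c u) = scal c (g u)"
    and h: "\<And>w. w \<in> schur n' \<mu>' \<Longrightarrow> h w \<in> schur n \<mu>" "\<And>u v. h (u + v) = h u + h v" "\<And>c u. h (scal c u) = scal c (h u)"
  shows "(\<lambda>w. if w \<in> schur n' \<mu>' then g (\<phi> (h w)) else 0) \<in> bischur m n' \<gamma> \<mu>'"
proof -
  obtain r u f where 1: "\<phi> = (\<lambda>w. \<Sum>i<(r::nat). scal (f i w) (u i))" "\<forall>i<r. u i \<in> schur m \<gamma> \<and> f i \<in> dual_space (schur n \<mu>)"
    using \<phi> unfolding bischur_def by blast
  have g0: "g 0 = 0" using g(3)[of 0 0] by simp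
  have gs: "g (\<Sum>i<r. x i) = (\<Sum>i<r. g (x i))" for x and r :: nat by (induction r) (simp_all add: g0 g(2))
  define F where "F i w = (if w \<in> schur n' \<mu>' then f i (h w) else 0)" for i w
  have "(\<lambda>w. if w \<in> schur n' \<mu>' then g (\<phi> (h w)) else 0) = (\<lambda>w. \<Sum>i<r. scal (F i w) (g (u i)))"
    by (auto simp: fun_eq_iff 1(1) F_def gs g(3))
  moreover have "F i \<in> dual_space (schur n' \<mu>')" if "i < r" for i
    using 1(2) that unfolding dual_space_def F_def by (auto simp: h schur_add schur_scal)
  ultimately show ?thesis unfolding bischur_def using 1(2) g(1)
    by (intro CollectI exI[of _ r] exI[of _ "\<lambda>i. g (u i)"] exI[of _ F]) auto
qed

lemma bischur_props:
  assumes "\<phi> \<in> bischur m n \<gamma> \<mu>"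
  shows "w \<notin> schur n \<mu> \<Longrightarrow> \<phi> w = 0"
    and "w \<in> schur n \<mu> \<Longrightarrow> w' \<in> schur n \<mu> \<Longrightarrow> \<phi> (w + w') = \<phi> w + \<phi> w'"
    and "w \<in> schur n \<mu> \<Longrightarrow> \<phi> (scal c w) = scal c (\<phi> w)"
    and "\<phi> w \<in> schur m \<gamma>"
proof -
  obtain r u f where 1: "\<phi> = (\<lambda>w. \<Sum>i<(r::nat). scal (f i w) (u i))" "\<forall>i<r. u i \<in> schur m \<gamma> \<and> f i \<in> dual_space (schur n \<mu>)"
    using assms unfolding bischur_def by blast
  have f: "w \<notin> schur n \<mu> \<Longrightarrow> f i w = 0" "w \<in> schur n \<mu> \<Longrightarrow> w' \<in> schur n \<mu> \<Longrightarrow> f i (w + w') = f i w + f i w'"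
    "w \<in> schur n \<mu> \<Longrightarrow> f i (scal c w) = c * f i w" if "i < r" for i w w' c
    using 1(2) that unfolding dual_space_def by blast+
  show "w \<notin> schur n \<mu> \<Longrightarrow> \<phi> w = 0" by (simp add: 1(1) f)
  show "w \<in> schur n \<mu> \<Longrightarrow> w' \<in> schur n \<mu> \<Longrightarrow> \<phi> (w + w') = \<phi> w + \<phi> w'"
    by (simp add: 1(1) f kpoly.scale_left_distrib sum.distrib)
  show "w \<in> schur n \<mu> \<Longrightarrow> \<phi> (scal c w) = scal c (\<phi> w)"
    by (simp add: 1(1) f scal_sum)
  show "\<phi> w \<in> schur m \<gamma>"
    using 1(2) unfolding 1(1) schur_def by (intro kpoly.span_sum kpoly.span_scale) auto
qed

lemma bischur_zero: "(\<lambda>w. 0) \<in> bischur m n \<gamma> \<mu>"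
  unfolding bischur_def by (intro CollectI exI[of _ "0::nat"]) auto

lemma bischur_scal:
  assumes "\<phi> \<in> bischur m n \<gamma> \<mu>"
  shows "(\<lambda>w. scal c (\<phi> w)) \<in> bischur m n \<gamma> \<mu>"
proof -
  have "(\<lambda>w. scal c (\<phi> w)) = (\<lambda>w. if w \<in> schur n \<mu> then scal c (\<phi> w) else 0)"
    using bischur_props(1)[OF assms] by (auto simp: fun_eq_iff)
  then show ?thesis
    using bischur_map[OF assms, of "scal c" n \<mu> "\<lambda>w. w"] by (simp add: schur_scal scal_add mult.commute)
qed

lemma bischur_sum: "(\<And>i. i \<in> X \<Longrightarrow> \<phi> i \<in> bischur m n \<gamma> \<mu>) \<Longrightarrow> (\<lambda>w. \<Sum>i\<in>X. \<phi> i w) \<in> bischur m n \<gamma> \<mu>"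
  by (induction X rule: infinite_finite_induct) (simp_all add: bischur_zero bischur_add)

lemma bischur_lincomb: 
  assumes "\<phi> \<in> bischur m n \<gamma> \<mu>" "\<And>i. i \<in> X \<Longrightarrow> w i \<in> schur n \<mu>"
  shows "\<phi> (\<Sum>i\<in>X. scal (c i) (w i)) = (\<Sum>i\<in>X. scal (c i) (\<phi> (w i)))"
proof -
  have "\<phi> 0 = 0" using bischur_props(3)[OF assms(1) schur_zero, of 0] by simp
  with assms(2) show ?thesis
    by (induction X rule: infinite_finite_induct)
      (simp_all add: bischur_props[OF assms(1)] schur_scal schur_sum)
qed

text \<open>The action on the dual factor, extended to rectangular \<open>C\<close>. It is
  contravariant like \<open>ract\<close>, and for an inverse it is the second half of
  \<open>bischur_act\<close>.\<close>

definition pull :: "nat \<Rightarrow> nat list \<Rightarrow> nat \<Rightarrow> 'k::field mat \<Rightarrow> ((nat \<times> nat, 'k) mpoly \<Rightarrow> (nat \<times> nat, 'k) mpoly) \<Rightarrow>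
    (nat \<times> nat, 'k) mpoly \<Rightarrow> (nat \<times> nat, 'k) mpoly" where
  "pull n' \<mu> n C \<phi> = (\<lambda>w. if w \<in> schur n' \<mu> then \<phi> (schur_act n C w) else 0)"

lemma pull_bischur: "\<phi> \<in> bischur m n \<gamma> \<mu> \<Longrightarrow> C \<in> carrier_mat n n' \<Longrightarrow> pull n' \<mu> n C \<phi> \<in> bischur m n' \<gamma> \<mu>"
  unfolding pull_def using bischur_map[of \<phi> m n \<gamma> \<mu> "\<lambda>u. u" n' \<mu> "schur_act n C"]
  by (simp add: schur_act_schur schur_act_add schur_act_scal)

lemma pull_pull:
  assumes "C \<in> carrier_mat n n'" "C' \<in> carrier_mat n' n''"
  shows "pull n'' \<mu> n' C' (pull n' \<mu> n C \<phi>) = pull n'' \<mu> n (C * C') \<phi>"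
  using assms by (auto simp: pull_def fun_eq_iff schur_act_schur schur_act_schur_act[OF schur_poly_UNIV])

lemma post_bischur:
  assumes "\<phi> \<in> bischur m n \<gamma> \<mu>" "A \<in> carrier_mat m m"
  shows "(\<lambda>w. schur_act m A (\<phi> w)) \<in> bischur m n \<gamma> \<mu>"
proof -
  have "(\<lambda>w. schur_act m A (\<phi> w)) = (\<lambda>w. if w \<in> schur n \<mu> then schur_act m A (\<phi> w) else 0)"
    using bischur_props(1)[OF assms(1)] by (auto simp: fun_eq_iff)
  then show ?thesis
    using bischur_map[OF assms(1), of "schur_act m A" n \<mu> "\<lambda>w. w"] assms(2)
    by (simp add: schur_act_schur schur_act_add schur_act_scal)
qed

lemma bischur_act_eq:
  assumes "\<phi> \<in> bischur m n \<gamma> \<mu>"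
  shows "bischur_act m n \<mu> A B \<phi> = (\<lambda>w. schur_act m A (pull n \<mu> n (inv\<^bsub>GL n\<^esub> B) \<phi> w))"
  by (auto simp: bischur_act_def pull_def fun_eq_iff)

section \<open>Scalar matrices and degrees\<close>

lemma mono_eval_scaled: "mono_eval (\<lambda>x. scal c (\<theta> x)) u = scal (c ^ mono_degree u) (mono_eval \<theta> u)"
  unfolding mono_eval_def mono_degree_def scal_def
  by (simp add: power_mult_distrib prod.distrib const.hom_power const.hom_prod power_sum)

lemma subst_scaled:
  assumes "f \<in> poly_ring X" "homogeneous d f"
  shows "subst (\<lambda>x. scal c (var x)) f = scal (c ^ d) f"
proof (rule homogeneous_subspace_induct[OF assms])
  show "subst (\<lambda>x. scal c (var x)) (scal b (mono_eval var u)) = scal (c ^ d) (scal b (mono_eval var u))"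
    if "mono_degree u = d" for b u
    using that by (simp add: subst_scal mono_eval_hom mono_eval_scaled mult.commute)
qed (simp_all add: subst_add scal_add)

lemma lookup_subst_scaled:
  "Poly_Mapping.lookup (subst (\<lambda>x. scal c (var x)) f) u = c ^ mono_degree u * Poly_Mapping.lookup f u"
proof -
  have "subst (\<lambda>x. scal c (var x)) f = (\<Sum>v\<in>Poly_Mapping.keys f. Poly_Mapping.single v (c ^ mono_degree v * Poly_Mapping.lookup f v))"
    unfolding subst_eq mono_eval_scaled mono_eval_var by (simp add: scal_def[symmetric] scal_single mult.commute)
  then show ?thesis by (auto simp: lookup_sum lookup_single when_def in_keys_iff)
qed

lemma minor_smult_one:
  assumes J: "J \<in> subsets t n" and L: "L \<in> subsets t n"
  shows "minor (c \<cdot>\<^sub>m 1\<^sub>m n) J L = (if J = L then c ^ t else 0 :: 'a::comm_ring_1)"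
proof -
  have "minor (c \<cdot>\<^sub>m 1\<^sub>m n) J L = det (c \<cdot>\<^sub>m mat t t (\<lambda>(a, b). 1\<^sub>m n $$ (pick J a, pick L b)))"
    unfolding minor_eq[OF smult_carrier_mat[OF one_carrier_mat] J L]
    using pick_subset[OF J] pick_subset[OF L] by (intro arg_cong[of _ _ det] eq_matI) auto
  also have "\<dots> = c ^ t * minor (1\<^sub>m n) J L"
    unfolding minor_eq[OF one_carrier_mat J L] by simp
  finally show ?thesis by (simp add: minor_one[OF J L])
qed

lemma ract_smult_one:
  assumes f: "f \<in> S_ring t m n"
  shows "ract t n (c \<cdot>\<^sub>m 1\<^sub>m n) f = subst (\<lambda>x. scal (c ^ t) (var x)) f"
  unfolding ract_def
proof (rule subst_cong[OF f[unfolded S_ring_def]], clarify)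
  fix I J assume J: "J \<in> subsets t n"
  have "(\<Sum>L\<in>subsets t n. scal (minor (c \<cdot>\<^sub>m 1\<^sub>m n) J L) (var (I, L))) =
     (\<Sum>L\<in>subsets t n. if J = L then scal (c ^ t) (var (I, L)) else 0 :: (_, 'a) mpoly)"
    by (intro sum.cong refl) (simp add: minor_smult_one[OF J])
  also have "\<dots> = scal (c ^ t) (var (I, J))" using J by simp
  finally show "(\<Sum>L\<in>subsets t n. scal (minor (c \<cdot>\<^sub>m 1\<^sub>m n) J L) (var (I, L))) = scal (c ^ t) (var (I, J))" .
qed

lemma schur_act_smult_one:
  assumes w: "w \<in> schur n \<mu>"
  shows "schur_act n (c \<cdot>\<^sub>m 1\<^sub>m n) w = scal (c ^ sum_list \<mu>) w"
proof -
  have "schur_act n (c \<cdot>\<^sub>m 1\<^sub>m n) w = subst (\<lambda>x. scal c (var x)) w"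
    unfolding schur_act_def
  proof (rule subst_cong[OF schur_poly_UNIV[OF w]], clarify)
    fix i j assume i: "i < n"
    have "(\<Sum>k<n. scal ((c \<cdot>\<^sub>m 1\<^sub>m n) $$ (k, i)) (var (k, j))) = (\<Sum>k<n. if k = i then scal c (var (k, j)) else 0 :: (_, 'a) mpoly)"
      using i by (intro sum.cong refl) auto
    then show "(\<Sum>k<n. scal ((c \<cdot>\<^sub>m 1\<^sub>m n) $$ (k, i)) (var (k, j))) = (scal c (var (i, j)) :: (_, 'a) mpoly)" using i by simp
  qed
  also have "\<dots> = scal (c ^ sum_list \<mu>) w"
    using schur_poly[OF w, of "Max (set \<mu>)"] by (intro subst_scaled) auto
  finally show ?thesis .
qed

section \<open>Degrees of minimal generators\<close>

text \<open>If in degree d every relation for m + t columns were redundant, then so would be each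
  compression of f, since it passes through such a relation and comes back by
  \<open>ract_S1J\<close>. Then f itself would be redundant.\<close>

lemma minimal_generator_bound:
  fixes f :: "(_, 'k::field_char_0) mpoly"
  assumes "minimal_generator t m n d f"
  shows "\<exists>g :: (_, 'k) mpoly. minimal_generator t m (m + t) d g"
proof (rule ccontr)
  assume none: "\<nexists>g :: (_, 'k) mpoly. minimal_generator t m (m + t) d g"
  have f: "f \<in> J_ideal t m n" "homogeneous d f" "f \<notin> S1J t m n" using assms by (auto simp: minimal_generator_def)
  have fS: "f \<in> S_ring t m n" using f by (simp add: J_ideal_def)
  obtain r and a :: "nat \<Rightarrow> 'k" and C C' r2 b A E E' where S: "splitting n (m + t) (d * t) r a C C' r2 b A E E'"
    by (rule splitting_exists)
  have "ract t n (C i * C' i) f \<in> S1J t m n" if i: "i < r" for i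
  proof -
    have C: "C i \<in> carrier_mat n (m + t)" "C' i \<in> carrier_mat (m + t) n" using S i unfolding splitting_def by auto
    have "ract t (m + t) (C i) f \<in> S1J t m (m + t)"
      using none ract_J_ideal[OF f(1) C(1)] ract_homogeneous[OF fS f(2)] unfolding minimal_generator_def by blast
    then show ?thesis using ract_S1J[OF _ C(2)] ract_ract[OF fS C] by metis
  qed
  then show False using S1J_if_compressions_S1J[OF S fS f(2)] f(3) by blast
qed

lemma max_gen_degree_bound: "max_gen_degree TYPE('k::field_char_0) t m n \<le> max_gen_degree TYPE('k) t m (m + t)"
  unfolding max_gen_degree_def
  by (rule SUP_subset_mono) (use minimal_generator_bound in blast)+

section \<open>Transport of irreducible representations\<close>

lemma subspace_S1J: "kpoly.subspace (S1J t m n)"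
  unfolding S1J_def by (rule kpoly.subspace_span)

text \<open>Turns injectivity on cosets into trivial intersection with \<open>S1J\<close>.\<close>

lemma subspace_diff_coset:
  assumes S: "kpoly.subspace S"
  shows "(+) x ` S = (+) y ` S \<longleftrightarrow> x - y \<in> S"
proof
  assume eq: "(+) x ` S = (+) y ` S"
  have "x + 0 \<in> (+) x ` S" using kpoly.subspace_0[OF S] by blast
  then obtain s where "s \<in> S" "x = y + s" using eq by auto
  then show "x - y \<in> S" by simp
next
  have sub: "(+) x ` S \<subseteq> (+) y ` S" if "x - y \<in> S" for x y
  proof (rule image_subsetI)
    fix s assume "s \<in> S"
    then have "(x - y) + s \<in> S" using kpoly.subspace_add[OF S that] by simp
    moreover have "x + s = y + ((x - y) + s)" by simp
    ultimately show "x + s \<in> (+) y ` S" by blast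
  qed
  assume d: "x - y \<in> S"
  then have "y - x \<in> S" using kpoly.subspace_neg[OF S, of "x - y"] by simp
  with d show "(+) x ` S = (+) y ` S" using sub by blast
qed

lemma J_ideal_lincomb:
  assumes "\<And>i. i \<in> X \<Longrightarrow> f i \<in> J_ideal t m n"
  shows "(\<Sum>i\<in>X. scal (c i) (f i)) \<in> J_ideal t m n"
  using assms unfolding J_ideal_def S_ring_def minor_map_def
  by (auto simp: subst_sum subst_scal intro!: poly_ring_sum poly_ring_scal)

text \<open>A nonzero equivariant linear map into the polynomial ring; this alone fixes degrees and
  extends equivariance to singular matrices. Injectivity and minimality are added
  separately.\<close>

locale bischur_embedding =
  fixes t m n :: nat and \<gamma> \<mu> :: "nat list"
    and \<Phi> :: "((nat \<times> nat, 'k::field_char_0) mpoly \<Rightarrow> (nat \<times> nat, 'k) mpoly) \<Rightarrow> (nat set \<times> nat set, 'k) mpoly"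
  assumes t: "1 \<le> t"
    and \<Phi>_ring: "\<phi> \<in> bischur m n \<gamma> \<mu> \<Longrightarrow> \<Phi> \<phi> \<in> S_ring t m n"
    and \<Phi>_add: "\<phi> \<in> bischur m n \<gamma> \<mu> \<Longrightarrow> \<psi> \<in> bischur m n \<gamma> \<mu> \<Longrightarrow> \<Phi> (\<lambda>w. \<phi> w + \<psi> w) = \<Phi> \<phi> + \<Phi> \<psi>"
    and \<Phi>_scal: "\<phi> \<in> bischur m n \<gamma> \<mu> \<Longrightarrow> \<Phi> (\<lambda>w. scal c (\<phi> w)) = scal c (\<Phi> \<phi>)"
    and \<Phi>_act: "A \<in> carrier (GL m) \<Longrightarrow> B \<in> carrier (GL n) \<Longrightarrow> \<phi> \<in> bischur m n \<gamma> \<mu> \<Longrightarrow>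
      \<Phi> (bischur_act m n \<mu> A B \<phi>) = S_act t m n A B (\<Phi> \<phi>)"
    and \<Phi>_nonzero: "\<exists>\<phi>\<in>bischur m n \<gamma> \<mu>. \<Phi> \<phi> \<noteq> 0"
begin

lemma \<Phi>_zero: "\<Phi> (\<lambda>w. 0) = 0"
  using \<Phi>_scal[OF bischur_zero, of 0] by simp

lemma \<Phi>_lincomb:
  "(\<And>i. i \<in> X \<Longrightarrow> \<phi> i \<in> bischur m n \<gamma> \<mu>) \<Longrightarrow> \<Phi> (\<lambda>w. \<Sum>i\<in>X. scal (c i) (\<phi> i w)) = (\<Sum>i\<in>X. scal (c i) (\<Phi> (\<phi> i)))"
  by (induction X rule: infinite_finite_induct)
    (simp_all add: \<Phi>_zero \<Phi>_add \<Phi>_scal bischur_scal bischur_sum)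

lemma \<Phi>_post:
  assumes A: "A \<in> carrier (GL m)" and \<phi>: "\<phi> \<in> bischur m n \<gamma> \<mu>"
  shows "\<Phi> (\<lambda>w. schur_act m A (\<phi> w)) = lact t m A (\<Phi> \<phi>)"
proof -
  have "bischur_act m n \<mu> A (1\<^sub>m n) \<phi> = (\<lambda>w. schur_act m A (\<phi> w))"
    using bischur_props(1)[OF \<phi>]
    by (auto simp: bischur_act_def GL_one fun_eq_iff schur_act_one[OF schur_poly_UNIV])
  then show ?thesis using \<Phi>_act[OF A GL_one(1) \<phi>] by (simp add: S_act_eq GL_one ract_one[OF \<Phi>_ring[OF \<phi>]])
qed

lemma \<Phi>_pull_invertible:
  assumes C: "C \<in> carrier_mat n n" "det C \<noteq> 0" and \<phi>: "\<phi> \<in> bischur m n \<gamma> \<mu>"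
  shows "\<Phi> (pull n \<mu> n C \<phi>) = ract t n C (\<Phi> \<phi>)"
proof -
  obtain B where B: "B \<in> carrier (GL n)" "inv\<^bsub>GL n\<^esub> B = C" by (rule GL_inverse_of[OF C])
  have "bischur_act m n \<mu> (1\<^sub>m m) B \<phi> = pull n \<mu> n C \<phi>"
    by (auto simp: fun_eq_iff bischur_act_def pull_def B(2) schur_act_one[OF schur_poly_UNIV[OF bischur_props(4)[OF \<phi>]]])
  then show ?thesis
    using \<Phi>_act[OF GL_one(1) B(1) \<phi>] by (simp add: S_act_eq B(2) lact_one[OF ract_S_ring[OF \<Phi>_ring[OF \<phi>]]])
qed

text \<open>Compare the action of twice the identity matrix: it scales the Schur module by 2 to the
  power \<open>sum_list \<mu>\<close> and a monomial by 2 to t times its degree. Powers of 2 are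
  distinct in characteristic 0.\<close>

lemma degree_eq:
  assumes \<phi>: "\<phi> \<in> bischur m n \<gamma> \<mu>" and u: "u \<in> Poly_Mapping.keys (\<Phi> \<phi>)"
  shows "mono_degree u * t = sum_list \<mu>"
proof -
  let ?C = "2 \<cdot>\<^sub>m 1\<^sub>m n :: 'k mat"
  have "det ?C \<noteq> 0" by simp
  have "pull n \<mu> n ?C \<phi> = (\<lambda>w. scal (2 ^ sum_list \<mu>) (\<phi> w))"
    using bischur_props(1,3)[OF \<phi>] by (auto simp: pull_def fun_eq_iff schur_act_smult_one)
  then have "scal (2 ^ sum_list \<mu>) (\<Phi> \<phi>) = ract t n ?C (\<Phi> \<phi>)"
    using \<Phi>_pull_invertible[OF _ \<open>det ?C \<noteq> 0\<close> \<phi>] \<Phi>_scal[OF \<phi>] by simp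
  also have "\<dots> = subst (\<lambda>x. scal (2 ^ t) (var x)) (\<Phi> \<phi>)" by (rule ract_smult_one[OF \<Phi>_ring[OF \<phi>]])
  finally have "2 ^ sum_list \<mu> * Poly_Mapping.lookup (\<Phi> \<phi>) u = (2 ^ t) ^ mono_degree u * Poly_Mapping.lookup (\<Phi> \<phi>) u"
    by (metis lookup_scal lookup_subst_scaled)
  then have "(2 :: 'k) ^ sum_list \<mu> = 2 ^ (t * mono_degree u)" using u by (simp add: in_keys_iff power_mult)
  then have "(of_nat (2 ^ sum_list \<mu>) :: 'k) = of_nat (2 ^ (t * mono_degree u))" by simp
  then have "(2 :: nat) ^ sum_list \<mu> = 2 ^ (t * mono_degree u)" by (simp only: of_nat_eq_iff)
  then show ?thesis by (simp add: mult.commute)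
qed

text \<open>The common degree of all images. The division is exact by \<open>deg_eq\<close>, because
  some image is nonzero.\<close>

definition deg :: nat where "deg = sum_list \<mu> div t"

lemma deg_eq: "deg * t = sum_list \<mu>"
proof -
  obtain \<phi> where \<phi>: "\<phi> \<in> bischur m n \<gamma> \<mu>" "\<Phi> \<phi> \<noteq> 0" using \<Phi>_nonzero by blast
  then obtain u where "u \<in> Poly_Mapping.keys (\<Phi> \<phi>)" by (metis keys_eq_empty all_not_in_conv)
  from degree_eq[OF \<phi>(1) this] show ?thesis unfolding deg_def by (metis dvd_div_mult_self dvd_triv_right)
qed

lemma \<Phi>_homogeneous: "\<phi> \<in> bischur m n \<gamma> \<mu> \<Longrightarrow> homogeneous deg (\<Phi> \<phi>)"
  unfolding homogeneous_def using degree_eq deg_eq t by (metis mult_right_cancel not_one_le_zero)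

lemma schur_homogeneous: "w \<in> schur p \<mu> \<Longrightarrow> homogeneous (sum_list \<mu>) w"
  using schur_poly(2)[of w p \<mu> "Max (set \<mu>)"] by simp

text \<open>Both sides are forms of the same degree in the entries of \<open>C\<close> and agree on
  the invertible shifts of \<open>C\<close>; the interpolation weights carry the equality over to
  \<open>C\<close>.\<close>

lemma \<Phi>_pull:
  assumes C: "C \<in> carrier_mat n n" and \<phi>: "\<phi> \<in> bischur m n \<gamma> \<mu>"
  shows "\<Phi> (pull n \<mu> n C \<phi>) = ract t n C (\<Phi> \<phi>)"
proof -
  let ?K = "char_matrix C"
  obtain X c where X: "finite X" "\<And>y. y \<in> X \<Longrightarrow> det (?K y) \<noteq> 0"
    and c: "\<And>\<omega> \<omega>'. (\<And>s. s < sum_list \<mu> \<Longrightarrow> \<omega> s < n) \<Longrightarrow> (\<And>s. s < sum_list \<mu> \<Longrightarrow> \<omega>' s < n) \<Longrightarrow>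
      tens (sum_list \<mu>) (ent C) \<omega> \<omega>' = (\<Sum>y\<in>X. c y * tens (sum_list \<mu>) (ent (?K y)) \<omega> \<omega>')"
    by (rule tensor_density[OF C, of "sum_list \<mu>"]) blast
  have K: "?K y \<in> carrier_mat n n" for y using C by simp
  have w: "schur_act n C w = (\<Sum>y\<in>X. scal (c y) (schur_act n (?K y) w))" if w: "w \<in> schur n \<mu>" for w
  proof -
    obtain P where P: "tensorial n n (sum_list \<mu>) P" "\<And>C. P (cm C) = schur_act n C w"
      by (rule schur_act_tensorial[OF schur_poly_UNIV[OF w] schur_homogeneous[OF w], where n = n]) blast
    show ?thesis using tensorial_density[OF P(1), where C = C and X = X and c = c and K = ?K] c by (simp add: P(2))
  qed
  have "pull n \<mu> n C \<phi> = (\<lambda>w. \<Sum>y\<in>X. scal (c y) (pull n \<mu> n (?K y) \<phi> w))"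
  proof
    fix w
    show "pull n \<mu> n C \<phi> w = (\<Sum>y\<in>X. scal (c y) (pull n \<mu> n (?K y) \<phi> w))"
    proof (cases "w \<in> schur n \<mu>")
      case True
      then show ?thesis
        by (simp add: pull_def w[OF True] bischur_lincomb[OF \<phi>] schur_act_schur[OF True K])
    qed (simp add: pull_def)
  qed
  then have "\<Phi> (pull n \<mu> n C \<phi>) = (\<Sum>y\<in>X. scal (c y) (ract t n (?K y) (\<Phi> \<phi>)))"
    using X by (simp add: \<Phi>_lincomb pull_bischur[OF \<phi> K] \<Phi>_pull_invertible[OF K _ \<phi>])
  \<comment> \<open>The weights were chosen for degree \<open>sum_list \<mu>\<close>, which equals
    \<open>deg * t\<close>, so they serve here as well.\<close>
  also have "\<dots> = ract t n C (\<Phi> \<phi>)"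
  proof -
    obtain P where P: "tensorial n n (deg * t) P" "\<And>C. C \<in> carrier_mat n n \<Longrightarrow> P (cm C) = ract t n C (\<Phi> \<phi>)"
      by (rule ract_tensorial[OF \<Phi>_ring[OF \<phi>] \<Phi>_homogeneous[OF \<phi>]]) blast
    show ?thesis using tensorial_density[OF P(1), where C = C and X = X and c = c and K = ?K] c by (simp add: P(2) C K deg_eq)
  qed
  finally show ?thesis .
qed

lemma schur_nontrivial: "schur n \<mu> \<noteq> ({0} :: (_, 'k) mpoly set)"
proof
  assume 0: "schur n \<mu> = ({0} :: (_, 'k) mpoly set)"
  obtain \<phi> where \<phi>: "\<phi> \<in> bischur m n \<gamma> \<mu>" "\<Phi> \<phi> \<noteq> 0" using \<Phi>_nonzero by blast
  have "\<phi> w = 0" for w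
    using bischur_props(1)[OF \<phi>(1), of w] bischur_props(3)[OF \<phi>(1) schur_zero, of 0] 0 by (cases "w = 0") auto
  then have "\<phi> = (\<lambda>w. 0)" by auto
  then show False using \<phi>(2) \<Phi>_zero by simp
qed

lemma parts_le: "k < length \<mu> \<Longrightarrow> \<mu> ! k \<le> n"
  using schur_trivial[of k \<mu> n, where 'a = 'k] schur_nontrivial by (meson not_le)

end

locale minimal_bischur_embedding = bischur_embedding t m n \<gamma> \<mu> \<Phi>
  for t m n \<gamma> \<mu> and \<Phi> :: "((nat \<times> nat, 'k::field_char_0) mpoly \<Rightarrow> (nat \<times> nat, 'k) mpoly) \<Rightarrow> (nat set \<times> nat set, 'k) mpoly" +
  assumes \<Phi>_inj: "inj_on \<Phi> (bischur m n \<gamma> \<mu>)"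
    and \<Phi>_J: "\<phi> \<in> bischur m n \<gamma> \<mu> \<Longrightarrow> \<Phi> \<phi> \<in> J_ideal t m n"
    and \<Phi>_minimal: "\<phi> \<in> bischur m n \<gamma> \<mu> \<Longrightarrow> \<Phi> \<phi> \<in> S1J t m n \<Longrightarrow> \<Phi> \<phi> = 0"
begin

text \<open>A part larger than m + t makes the Schur module of \<open>k^(m + t)\<close> zero. All
  compressions of \<open>\<Phi> \<phi>\<close> through that space then vanish, so
  \<open>\<Phi> \<phi>\<close> lies in \<open>S1J\<close>, against minimality.\<close>

lemma parts_le_bound:
  assumes k: "k < length \<mu>"
  shows "\<mu> ! k \<le> m + t"
proof (rule ccontr)
  assume "\<not> \<mu> ! k \<le> m + t"
  then have triv: "schur (m + t) \<mu> = ({0} :: (_, 'k) mpoly set)" using k by (intro schur_trivial) auto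
  obtain \<phi> where \<phi>: "\<phi> \<in> bischur m n \<gamma> \<mu>" "\<Phi> \<phi> \<noteq> 0" using \<Phi>_nonzero by blast
  obtain r and a :: "nat \<Rightarrow> 'k" and C C' r2 b A E E' where S: "splitting n (m + t) (deg * t) r a C C' r2 b A E E'"
    by (rule splitting_exists)
  have "ract t n (C i * C' i) (\<Phi> \<phi>) \<in> S1J t m n" if i: "i < r" for i
  proof -
    have C: "C i \<in> carrier_mat n (m + t)" "C' i \<in> carrier_mat (m + t) n" using S i unfolding splitting_def by auto
    have "pull n \<mu> n (C i * C' i) \<phi> = (\<lambda>w. 0)"
    proof
      fix w
      show "pull n \<mu> n (C i * C' i) \<phi> w = 0"
      proof (cases "w \<in> schur n \<mu>")
        case True
        have "schur_act (m + t) (C' i) w = 0" using schur_act_schur[OF True C(2)] triv by simp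
        then have "schur_act n (C i * C' i) w = 0"
          using schur_act_schur_act[OF schur_poly_UNIV[OF True] C] by simp
        then show ?thesis using bischur_props(3)[OF \<phi>(1) schur_zero, of 0] by (simp add: pull_def)
      qed (simp add: pull_def)
    qed
    then have "ract t n (C i * C' i) (\<Phi> \<phi>) = 0"
      using \<Phi>_pull[OF mult_carrier_mat[OF C] \<phi>(1)] \<Phi>_zero by simp
    then show ?thesis by (simp add: S1J_zero)
  qed
  then have "\<Phi> \<phi> \<in> S1J t m n" by (rule S1J_if_compressions_S1J[OF S \<Phi>_ring[OF \<phi>(1)] \<Phi>_homogeneous[OF \<phi>(1)]])
  then show False using \<Phi>_minimal[OF \<phi>(1)] \<phi>(2) by simp
qed

text \<open>The new map \<Psi> is characterised by \<open>ract t n K (\<Psi> \<phi>) = \<Phi> (pull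
  n \<mu> N K \<phi>)\<close> for all \<open>K\<close> from dimension n to N, together with
  stability. Every required property of \<Psi> is tested after applying such \<open>K\<close>, where
  it becomes the known property of \<open>\<Phi>\<close>.\<close>

lemma transported_irrep:
  assumes N: "\<And>k. k < length \<mu> \<Longrightarrow> \<mu> ! k \<le> N"
  shows "\<exists>Q :: (nat set \<times> nat set, 'k) mpoly set. G_submodule t m N Q \<and> Q \<subseteq> J_ideal t m N \<and> Q \<noteq> {0} \<and>
        G_iso_bischur t m N \<gamma> \<mu> Q \<and> inj_on (\<lambda>q. (+) q ` S1J t m N) Q"
proof -
  let ?D = "deg * t"
  \<comment> \<open>Here the identity of \<open>k^N\<close> is split through \<open>k^n\<close>. Its
    alternators in n + 1 letters do not act on the Schur module, all parts being at most n by
    \<open>parts_le\<close>.\<close>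
  obtain r and a :: "nat \<Rightarrow> 'k" and C C' r2 b A E E' where S: "splitting N n ?D r a C C' r2 b A E E'"
    by (rule splitting_exists)
  have S\<mu>: "splitting N n (sum_list \<mu>) r a C C' r2 b A E E'" using S by (simp add: deg_eq)
  have C: "C i \<in> carrier_mat N n" "C' i \<in> carrier_mat n N" if "i < r" for i using S that unfolding splitting_def by auto
  \<comment> \<open>Go to dimension n by \<open>C i\<close>, apply \<open>\<Phi>\<close> there, and
    return by \<open>C' i\<close>; the weights make the round trips add up to the identity.\<close>
  define \<Psi> where "\<Psi> \<phi> = (\<Sum>i<r. scal (a i) (ract t N (C' i) (\<Phi> (pull n \<mu> N (C i) \<phi>))))" for \<phi>
  let ?B = "bischur m n \<gamma> \<mu>" and ?BN = "bischur m N \<gamma> \<mu>"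
  \<comment> \<open>Elements for which the splitting is exact without alternators. They are
    determined by their images in dimension n and contain everything that comes from there.\<close>
  define stable where "stable x \<longleftrightarrow> x = (\<Sum>i<r. scal (a i) (ract t N (C i * C' i) x))" for x
  have pullC: "pull n \<mu> N (C i) \<phi> \<in> ?B" if "i < r" "\<phi> \<in> ?BN" for i \<phi> using that C by (intro pull_bischur)
  have \<Psi>_ring: "\<Psi> \<phi> \<in> S_ring t m N" if "\<phi> \<in> ?BN" for \<phi>
    using ract_S_ring[OF \<Phi>_ring[OF pullC[OF _ that]]] unfolding \<Psi>_def S_ring_def
    by (intro poly_ring_sum poly_ring_scal) auto
  have \<Psi>_J: "\<Psi> \<phi> \<in> J_ideal t m N" if "\<phi> \<in> ?BN" for \<phi>
    unfolding \<Psi>_def using ract_J_ideal[OF \<Phi>_J[OF pullC[OF _ that]] C(2)] by (intro J_ideal_lincomb) auto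
  have pull_add: "pull n \<mu> N K (\<lambda>w. \<phi> w + \<psi> w) = (\<lambda>w. pull n \<mu> N K \<phi> w + pull n \<mu> N K \<psi> w)" for K :: "'k mat" and \<phi> \<psi>
    by (auto simp: pull_def)
  have pull_scal: "pull n \<mu> N K (\<lambda>w. scal c (\<phi> w)) = (\<lambda>w. scal c (pull n \<mu> N K \<phi> w))" for K :: "'k mat" and \<phi> c
    by (auto simp: pull_def)
  have \<Psi>_add: "\<Psi> (\<lambda>w. \<phi> w + \<psi> w) = \<Psi> \<phi> + \<Psi> \<psi>" if "\<phi> \<in> ?BN" "\<psi> \<in> ?BN" for \<phi> \<psi>
    unfolding \<Psi>_def using that by (simp add: pull_add \<Phi>_add pullC ract_add scal_add sum.distrib)
  have \<Psi>_scal: "\<Psi> (\<lambda>w. scal c (\<phi> w)) = scal c (\<Psi> \<phi>)" if "\<phi> \<in> ?BN" for \<phi> c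
    unfolding \<Psi>_def using that by (simp add: pull_scal \<Phi>_scal pullC ract_scal scal_sum mult.commute)
  have expand: "w = (\<Sum>i<r. scal (a i) (schur_act N (C i * C' i) w))" if "w \<in> schur N \<mu>" for w
    using schur_splitting[OF S\<mu> that] parts_le by blast
  have \<Psi>_pull: "ract t n K (\<Psi> \<phi>) = \<Phi> (pull n \<mu> N K \<phi>)" if K: "K \<in> carrier_mat N n" and \<phi>: "\<phi> \<in> ?BN" for K \<phi>
  proof -
    have "ract t n K (\<Psi> \<phi>) = (\<Sum>i<r. scal (a i) (\<Phi> (pull n \<mu> n (C' i * K) (pull n \<mu> N (C i) \<phi>))))"
      unfolding \<Psi>_def ract_sum ract_scal
    proof (intro sum.cong refl arg_cong2[of _ _ _ _ scal])
      fix i assume "i \<in> {..<r}"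
      then have i: "i < r" by simp
      show "ract t n K (ract t N (C' i) (\<Phi> (pull n \<mu> N (C i) \<phi>))) = \<Phi> (pull n \<mu> n (C' i * K) (pull n \<mu> N (C i) \<phi>))"
        using \<Phi>_pull[OF mult_carrier_mat[OF C(2)[OF i] K] pullC[OF i \<phi>]]
          ract_ract[OF \<Phi>_ring[OF pullC[OF i \<phi>]] C(2)[OF i] K] by simp
    qed
    also have "\<dots> = \<Phi> (\<lambda>w. \<Sum>i<r. scal (a i) (pull n \<mu> n (C' i * K) (pull n \<mu> N (C i) \<phi>) w))"
      by (rule \<Phi>_lincomb[symmetric], rule pull_bischur[OF pullC[OF _ \<phi>] mult_carrier_mat[OF C(2) K]]) auto
    also have "(\<lambda>w. \<Sum>i<r. scal (a i) (pull n \<mu> n (C' i * K) (pull n \<mu> N (C i) \<phi>) w)) = pull n \<mu> N K \<phi>"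
    proof
      fix w
      show "(\<Sum>i<r. scal (a i) (pull n \<mu> n (C' i * K) (pull n \<mu> N (C i) \<phi>) w)) = pull n \<mu> N K \<phi> w"
      proof (cases "w \<in> schur n \<mu>")
        case True
        let ?v = "schur_act N K w"
        have v: "?v \<in> schur N \<mu>" by (rule schur_act_schur[OF True K])
        have "pull n \<mu> n (C' i * K) (pull n \<mu> N (C i) \<phi>) w = \<phi> (schur_act N (C i * C' i) ?v)" if i: "i < r" for i
        proof -
          note Ci = C(1)[OF i] C(2)[OF i]
          have "schur_act N (C i * C' i) ?v = schur_act N (C i * C' i * K) w"
            by (rule schur_act_schur_act[OF schur_poly_UNIV[OF True] mult_carrier_mat[OF Ci] K])
          also have "C i * C' i * K = C i * (C' i * K)" by (rule assoc_mult_mat[OF Ci K])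
          also have "\<phi> (schur_act N \<dots> w) = pull n \<mu> n (C' i * K) (pull n \<mu> N (C i) \<phi>) w"
            unfolding pull_pull[OF Ci(1) mult_carrier_mat[OF Ci(2) K]] using True by (simp add: pull_def)
          finally show ?thesis by simp
        qed
        then have "(\<Sum>i<r. scal (a i) (pull n \<mu> n (C' i * K) (pull n \<mu> N (C i) \<phi>) w)) =
          \<phi> (\<Sum>i<r. scal (a i) (schur_act N (C i * C' i) ?v))"
          using C by (subst bischur_lincomb[OF \<phi>]) (auto intro!: schur_act_schur[OF v] mult_carrier_mat)
        also have "\<dots> = pull n \<mu> N K \<phi> w" using expand[OF v] True by (simp add: pull_def)
        finally show ?thesis .
      qed (simp add: pull_def)
    qed
    finally show ?thesis .
  qed
  have stable_image: "stable (ract t N K x)" if "x \<in> S_ring t m n" "homogeneous deg x" "K \<in> carrier_mat n N" for K x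
    unfolding stable_def by (rule ract_image_splitting[OF S that])
  have stable_sum: "stable (\<Sum>i<r. scal (a i) (x i))" if "\<And>i. i < r \<Longrightarrow> stable (x i)" for x
  proof -
    have "(\<Sum>j<r. scal (a j) (ract t N (C j * C' j) (\<Sum>i<r. scal (a i) (x i)))) =
      (\<Sum>j<r. \<Sum>i<r. scal (a i) (scal (a j) (ract t N (C j * C' j) (x i))))"
      by (simp add: ract_sum ract_scal scal_sum mult.commute)
    also have "\<dots> = (\<Sum>i<r. scal (a i) (\<Sum>j<r. scal (a j) (ract t N (C j * C' j) (x i))))"
      unfolding scal_sum by (rule sum.swap)
    also have "\<dots> = (\<Sum>i<r. scal (a i) (x i))"
      using that[unfolded stable_def, symmetric] by (intro sum.cong refl) simp
    finally show ?thesis by (simp add: stable_def)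
  qed
  have stable_eq: "x = y" if x: "stable x" "x \<in> S_ring t m N" and y: "stable y" "y \<in> S_ring t m N"
    and eq: "\<And>K. K \<in> carrier_mat N n \<Longrightarrow> ract t n K x = ract t n K y" for x y
  proof -
    have "x = (\<Sum>i<r. scal (a i) (ract t N (C i * C' i) x))" using x(1) by (simp add: stable_def)
    also have "\<dots> = (\<Sum>i<r. scal (a i) (ract t N (C i * C' i) y))"
    proof (intro sum.cong refl arg_cong2[of _ _ _ _ scal])
      fix i assume "i \<in> {..<r}"
      then have i: "i < r" by simp
      show "ract t N (C i * C' i) x = ract t N (C i * C' i) y"
        using ract_ract[OF x(2) C(1)[OF i] C(2)[OF i]] ract_ract[OF y(2) C(1)[OF i] C(2)[OF i]] eq[OF C(1)[OF i]] by simp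
    qed
    also have "\<dots> = y" using y(1) by (simp add: stable_def)
    finally show ?thesis .
  qed
  \<comment> \<open>By construction \<Psi> is a combination of images from dimension n.\<close>
  have \<Psi>_stable: "stable (\<Psi> \<phi>)" if "\<phi> \<in> ?BN" for \<phi>
    unfolding \<Psi>_def using \<Phi>_ring[OF pullC[OF _ that]] \<Phi>_homogeneous[OF pullC[OF _ that]] C(2)
    by (intro stable_sum stable_image) auto
  have \<Psi>_eq: "\<phi> = \<psi>" if \<phi>: "\<phi> \<in> ?BN" and \<psi>: "\<psi> \<in> ?BN" and eq: "\<Psi> \<phi> = \<Psi> \<psi>" for \<phi> \<psi>
  proof
    fix w
    show "\<phi> w = \<psi> w"
    proof (cases "w \<in> schur N \<mu>")
      case True
      have "\<phi> (schur_act N (C i * C' i) w) = \<psi> (schur_act N (C i * C' i) w)" if i: "i < r" for i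
      proof -
        have "\<Phi> (pull n \<mu> N (C i) \<phi>) = \<Phi> (pull n \<mu> N (C i) \<psi>)"
          using \<Psi>_pull[OF C(1)[OF i] \<phi>] \<Psi>_pull[OF C(1)[OF i] \<psi>] eq by simp
        then have "pull n \<mu> N (C i) \<phi> = pull n \<mu> N (C i) \<psi>"
          using inj_onD[OF \<Phi>_inj] pullC[OF i \<phi>] pullC[OF i \<psi>] by blast
        from fun_cong[OF this, of "schur_act n (C' i) w"]
        have "\<phi> (schur_act N (C i) (schur_act n (C' i) w)) = \<psi> (schur_act N (C i) (schur_act n (C' i) w))"
          using schur_act_schur[OF True C(2)[OF i]] by (simp add: pull_def)
        then show ?thesis using schur_act_schur_act[OF schur_poly_UNIV[OF True] C(1)[OF i] C(2)[OF i]] by simp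
      qed
      moreover have "schur_act N (C i * C' i) w \<in> schur N \<mu>" if "i < r" for i
        by (rule schur_act_schur[OF True mult_carrier_mat[OF C[OF that]]])
      ultimately have "\<phi> (\<Sum>i<r. scal (a i) (schur_act N (C i * C' i) w)) = \<psi> (\<Sum>i<r. scal (a i) (schur_act N (C i * C' i) w))"
        by (subst bischur_lincomb[OF \<phi>], simp, subst bischur_lincomb[OF \<psi>], simp) (intro sum.cong, auto)
      then show ?thesis using expand[OF True] by simp
    next
      case False then show ?thesis using bischur_props(1)[OF \<phi>] bischur_props(1)[OF \<psi>] by simp
    qed
  qed
  have act_bischur: "bischur_act m N \<mu> A B \<phi> \<in> ?BN"
    if A: "A \<in> carrier (GL m)" and B: "B \<in> carrier (GL N)" and \<phi>: "\<phi> \<in> ?BN" for A B \<phi>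
    unfolding bischur_act_eq[OF \<phi>] using A GL_inv(1)[OF B]
    by (intro post_bischur pull_bischur[OF \<phi>]) (auto simp: carrier_GL)
  have \<Psi>_act: "\<Psi> (bischur_act m N \<mu> A B \<phi>) = S_act t m N A B (\<Psi> \<phi>)"
    if A: "A \<in> carrier (GL m)" and B: "B \<in> carrier (GL N)" and \<phi>: "\<phi> \<in> ?BN" for A B \<phi>
  proof (rule stable_eq)
    let ?Bi = "inv\<^bsub>GL N\<^esub> B"
    have Bi: "?Bi \<in> carrier_mat N N" by (rule GL_inv(1)[OF B])
    have Am: "A \<in> carrier_mat m m" using A by (simp add: carrier_GL)
    have AB: "bischur_act m N \<mu> A B \<phi> \<in> ?BN" by (rule act_bischur[OF A B \<phi>])
    show "stable (\<Psi> (bischur_act m N \<mu> A B \<phi>))" "\<Psi> (bischur_act m N \<mu> A B \<phi>) \<in> S_ring t m N"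
      by (rule \<Psi>_stable[OF AB], rule \<Psi>_ring[OF AB])
    show "S_act t m N A B (\<Psi> \<phi>) \<in> S_ring t m N"
      unfolding S_act_eq by (intro lact_S_ring ract_S_ring[OF \<Psi>_ring[OF \<phi>]])
    \<comment> \<open>Stability of the transformed element is seen by moving \<open>A\<close> inside
      \<open>\<Phi>\<close> and absorbing the inverse of \<open>B\<close> into the map that leads
      back from dimension n.\<close>
    have "S_act t m N A B (\<Psi> \<phi>) =
      (\<Sum>i<r. scal (a i) (ract t N (C' i * ?Bi) (\<Phi> (\<lambda>w. schur_act m A (pull n \<mu> N (C i) \<phi> w)))))"
      unfolding S_act_eq \<Psi>_def ract_sum ract_scal lact_sum lact_scal lact_ract
      using \<Phi>_post[OF A] pullC[OF _ \<phi>] ract_ract[OF lact_S_ring[OF \<Phi>_ring[OF pullC[OF _ \<phi>]]] C(2) Bi]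
      by (intro sum.cong refl) (simp add: lact_ract)
    also have "stable \<dots>"
      using post_bischur[OF pullC[OF _ \<phi>] Am] mult_carrier_mat[OF C(2) Bi]
      by (intro stable_sum stable_image \<Phi>_ring \<Phi>_homogeneous) auto
    finally show "stable (S_act t m N A B (\<Psi> \<phi>))" .
    fix K :: "'k mat" assume K: "K \<in> carrier_mat N n"
    have BK: "?Bi * K \<in> carrier_mat N n" by (rule mult_carrier_mat[OF Bi K])
    have "ract t n K (\<Psi> (bischur_act m N \<mu> A B \<phi>)) = \<Phi> (pull n \<mu> N K (bischur_act m N \<mu> A B \<phi>))"
      by (rule \<Psi>_pull[OF K AB])
    also have "pull n \<mu> N K (bischur_act m N \<mu> A B \<phi>) = (\<lambda>w. schur_act m A (pull n \<mu> N K (pull N \<mu> N ?Bi \<phi>) w))"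
      unfolding bischur_act_eq[OF \<phi>] by (auto simp: pull_def)
    also have "pull n \<mu> N K (pull N \<mu> N ?Bi \<phi>) = pull n \<mu> N (?Bi * K) \<phi>" by (rule pull_pull[OF Bi K])
    also have "\<Phi> (\<lambda>w. schur_act m A (pull n \<mu> N (?Bi * K) \<phi> w)) = lact t m A (\<Phi> (pull n \<mu> N (?Bi * K) \<phi>))"
      by (rule \<Phi>_post[OF A pull_bischur[OF \<phi> BK]])
    also have "\<dots> = lact t m A (ract t n (?Bi * K) (\<Psi> \<phi>))" by (simp add: \<Psi>_pull[OF BK \<phi>])
    also have "\<dots> = ract t n K (S_act t m N A B (\<Psi> \<phi>))"
      unfolding S_act_eq by (simp add: ract_ract[OF \<Psi>_ring[OF \<phi>] Bi K, symmetric] lact_ract)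
    finally show "ract t n K (\<Psi> (bischur_act m N \<mu> A B \<phi>)) = ract t n K (S_act t m N A B (\<Psi> \<phi>))" .
  qed
  define Q where "Q = \<Psi> ` ?BN"
  have \<Psi>_zero: "\<Psi> (\<lambda>w. 0) = 0" using \<Psi>_scal[OF bischur_zero, of 0] by simp
  have sub: "kpoly.subspace Q"
    unfolding kpoly.subspace_def
  proof (intro conjI ballI allI)
    show "0 \<in> Q" unfolding Q_def using \<Psi>_zero bischur_zero by (metis imageI)
    show "x + y \<in> Q" if "x \<in> Q" "y \<in> Q" for x y
      using that unfolding Q_def by (auto simp: \<Psi>_add[symmetric] intro!: imageI bischur_add)
    show "scal c x \<in> Q" if "x \<in> Q" for x c
      using that unfolding Q_def by (auto simp: \<Psi>_scal[symmetric] intro!: imageI bischur_scal)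
  qed
  have "G_submodule t m N Q"
    unfolding G_submodule_def using sub \<Psi>_ring \<Psi>_act act_bischur by (auto simp: Q_def simp flip: \<Psi>_act intro!: imageI)
  moreover have "Q \<subseteq> J_ideal t m N" using \<Psi>_J by (auto simp: Q_def)
  moreover have "G_iso_bischur t m N \<gamma> \<mu> Q"
    unfolding G_iso_bischur_def
    by (rule exI[of _ \<Psi>]) (use \<Psi>_eq \<Psi>_add \<Psi>_scal \<Psi>_act in \<open>auto simp: Q_def bij_betw_def inj_on_def\<close>)
  moreover have "Q \<noteq> {0}"
  proof
    assume Q0: "Q = {0}"
    obtain \<phi> where \<phi>: "\<phi> \<in> ?B" "\<Phi> \<phi> \<noteq> 0" using \<Phi>_nonzero by blast
    \<comment> \<open>The reverse splitting, of \<open>k^n\<close> through \<open>k^N\<close>, is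
      exact on the Schur module since all parts are at most N. If \<Psi> were zero, then by
      injectivity all pullbacks of \<open>\<phi>\<close> to dimension N would vanish, and with them
      \<open>\<phi>\<close>.\<close>
    obtain r' and a' :: "nat \<Rightarrow> 'k" and K K' r2' b' A' F F' where S': "splitting n N (sum_list \<mu>) r' a' K K' r2' b' A' F F'"
      by (rule splitting_exists)
    have K: "K i \<in> carrier_mat n N" "K' i \<in> carrier_mat N n" if "i < r'" for i using S' that unfolding splitting_def by auto
    have "\<phi> w = 0" for w
    proof (cases "w \<in> schur n \<mu>")
      case True
      have "\<phi> (schur_act n (K i * K' i) w) = 0" if i: "i < r'" for i
      proof -
        have p: "pull N \<mu> n (K i) \<phi> \<in> ?BN" by (rule pull_bischur[OF \<phi>(1) K(1)[OF i]])
        then have "\<Psi> (pull N \<mu> n (K i) \<phi>) \<in> Q" unfolding Q_def by (rule imageI)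
        then have "\<Psi> (pull N \<mu> n (K i) \<phi>) = \<Psi> (\<lambda>w. 0)" using Q0 \<Psi>_zero by simp
        then have "pull N \<mu> n (K i) \<phi> = (\<lambda>w. 0)" by (rule \<Psi>_eq[OF p bischur_zero])
        from fun_cong[OF this, of "schur_act N (K' i) w"]
        have "\<phi> (schur_act n (K i) (schur_act N (K' i) w)) = 0"
          using schur_act_schur[OF True K(2)[OF i]] by (simp add: pull_def)
        then show ?thesis using schur_act_schur_act[OF schur_poly_UNIV[OF True] K(1)[OF i] K(2)[OF i]] by simp
      qed
      moreover have "schur_act n (K i * K' i) w \<in> schur n \<mu>" if "i < r'" for i
        by (rule schur_act_schur[OF True mult_carrier_mat[OF K[OF that]]])
      ultimately have "\<phi> (\<Sum>i<r'. scal (a' i) (schur_act n (K i * K' i) w)) = 0"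
        by (subst bischur_lincomb[OF \<phi>(1)]) auto
      then show ?thesis using schur_splitting[OF S' True] N by simp
    qed (simp add: bischur_props(1)[OF \<phi>(1)])
    then have "\<phi> = (\<lambda>w. 0)" by auto
    then show False using \<phi>(2) \<Phi>_zero by simp
  qed
  moreover have "inj_on (\<lambda>q. (+) q ` S1J t m N) Q"
  proof (rule inj_onI)
    fix x y assume "x \<in> Q" "y \<in> Q" "(+) x ` S1J t m N = (+) y ` S1J t m N"
    then have d: "x - y \<in> S1J t m N" and "x - y \<in> Q"
      using kpoly.subspace_diff[OF sub] by (auto simp: subspace_diff_coset[OF subspace_S1J])
    then obtain \<phi> where \<phi>: "\<phi> \<in> ?BN" "x - y = \<Psi> \<phi>" by (auto simp: Q_def)
    \<comment> \<open>Each image in dimension n lies in \<open>S1J\<close> and in the range of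
      \<open>\<Phi>\<close>, so it is zero by minimality there; stability then forces the element
      itself to be zero.\<close>
    have "\<Psi> \<phi> = 0"
    proof (rule stable_eq[OF \<Psi>_stable[OF \<phi>(1)] \<Psi>_ring[OF \<phi>(1)]])
      show "stable 0" by (simp add: stable_def)
      show "0 \<in> S_ring t m N" by (simp add: S_ring_def)
      fix K :: "'k mat" assume K: "K \<in> carrier_mat N n"
      have "ract t n K (\<Psi> \<phi>) \<in> S1J t m n" using ract_S1J[OF d K] \<phi>(2) by simp
      then have "ract t n K (\<Psi> \<phi>) = 0"
        using \<Phi>_minimal[OF pull_bischur[OF \<phi>(1) K]] by (simp add: \<Psi>_pull[OF K \<phi>(1)])
      then show "ract t n K (\<Psi> \<phi>) = ract t n K 0" by simp
    qed
    then show "x = y" using \<phi>(2) by simp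
  qed
  ultimately show ?thesis by blast
qed

end

lemma minimal_irrep_bound:
  assumes t: "1 \<le> t" and irr: "minimal_irrep TYPE('k::field_char_0) t m n \<gamma> \<mu>"
  shows "minimal_irrep TYPE('k) t m (m + t) \<gamma> \<mu>"
proof -
  obtain Q :: "(nat set \<times> nat set, 'k) mpoly set" where part: "is_partition \<gamma>" "is_partition \<mu>"
    and Q: "G_submodule t m n Q" "Q \<subseteq> J_ideal t m n" "Q \<noteq> {0}" "G_iso_bischur t m n \<gamma> \<mu> Q"
      "inj_on (\<lambda>q. (+) q ` S1J t m n) Q"
    using irr unfolding minimal_irrep_def by blast
  obtain \<Phi> where \<Phi>: "bij_betw \<Phi> (bischur m n \<gamma> \<mu>) Q"
     "\<forall>\<phi>\<in>bischur m n \<gamma> \<mu>. \<forall>\<psi>\<in>bischur m n \<gamma> \<mu>. \<Phi> (\<lambda>w. \<phi> w + \<psi> w) = \<Phi> \<phi> + \<Phi> \<psi>"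
     "\<forall>c. \<forall>\<phi>\<in>bischur m n \<gamma> \<mu>. \<Phi> (\<lambda>w. scal c (\<phi> w)) = scal c (\<Phi> \<phi>)"
     "\<forall>A\<in>carrier (GL m). \<forall>B\<in>carrier (GL n). \<forall>\<phi>\<in>bischur m n \<gamma> \<mu>.
        \<Phi> (bischur_act m n \<mu> A B \<phi>) = S_act t m n A B (\<Phi> \<phi>)"
    using Q(4) unfolding G_iso_bischur_def by blast
  have in_Q: "\<Phi> \<phi> \<in> Q" if "\<phi> \<in> bischur m n \<gamma> \<mu>" for \<phi> using bij_betwE[OF \<Phi>(1)] that by blast
  have Q0: "0 \<in> Q" using Q(1) unfolding G_submodule_def by (blast intro: kpoly.subspace_0)
  interpret minimal_bischur_embedding t m n \<gamma> \<mu> \<Phi>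
  proof
    show "\<Phi> \<phi> \<in> S_ring t m n" if "\<phi> \<in> bischur m n \<gamma> \<mu>" for \<phi>
      using in_Q[OF that] Q(1) unfolding G_submodule_def by blast
    obtain q where "q \<in> Q" "q \<noteq> 0" using Q(3) Q0 by blast
    then show "\<exists>\<phi>\<in>bischur m n \<gamma> \<mu>. \<Phi> \<phi> \<noteq> 0" using bij_betw_imp_surj_on[OF \<Phi>(1)] by blast
    show "\<Phi> \<phi> \<in> J_ideal t m n" if "\<phi> \<in> bischur m n \<gamma> \<mu>" for \<phi> using in_Q[OF that] Q(2) by blast
    \<comment> \<open>An element of \<open>Q\<close> in \<open>S1J\<close> has the same coset as 0,
      which also belongs to \<open>Q\<close>.\<close>
    show "\<Phi> \<phi> = 0" if "\<phi> \<in> bischur m n \<gamma> \<mu>" "\<Phi> \<phi> \<in> S1J t m n" for \<phi>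
      using inj_onD[OF Q(5) _ in_Q[OF that(1)] Q0] subspace_diff_coset[OF subspace_S1J, of "\<Phi> \<phi>" t m n 0] that(2)
      by simp
    show "inj_on \<Phi> (bischur m n \<gamma> \<mu>)" using \<Phi>(1) by (rule bij_betw_imp_inj_on)
  qed (use t \<Phi>(2-4) in auto)
  show ?thesis
    unfolding minimal_irrep_def using part transported_irrep[of "m + t"] parts_le_bound by blast
qed

theorem theorem3p4:
  fixes t m n :: nat
  assumes "1 \<le> t" and "t \<le> m" and "m \<le> n"
  shows "(\<forall>\<gamma> \<mu>. minimal_irrep TYPE('k::field_char_0) t m n \<gamma> \<mu> \<longrightarrow>
            minimal_irrep TYPE('k) t m (m + t) \<gamma> \<mu>) \<and>
         max_gen_degree TYPE('k) t m n \<le> max_gen_degree TYPE('k) t m (m + t)"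
  using minimal_irrep_bound[OF assms(1)] max_gen_degree_bound by blast

end
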